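(* Let $\Bbbk$ be an algebraically closed field of characteristic zero, $N>1$ an odd integer, $q\in\Bbbk$ a root of unity of order $N$, and $\alpha,\beta,\xi\in\Bbbk$ with $(\alpha,\beta)\neq(0,0)$. The left $u_q$-comodule algebra $\mathscr{A}_4(\alpha,\beta;\xi):={}_\sigma(\mathscr{L}_4(\alpha,\beta;\xi))$ is generated by the single element $W$ subject to the relation $\phi_{\alpha,\beta,\xi}(W)=0$, where $$\phi_{\alpha,\beta,\xi}(T)=\sum_{k=0}^{(N-1)/2}\left(\frac{N}{N-k}\binom{N-k}{k}\left(\frac{\alpha\beta}{q^2-1}\right)^kT^{N-2k}\right)-\xi.$$ The left coaction of $u_q$ on $\mathscr{A}_4(\alpha,\beta;\xi)$ is given on the generator by $\delta(W)=(\alpha\tilde E+\beta F)\otimes1+K^{-1}\otimes W$.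
   Context: The Hopf algebra $u_q=u_q(\mathfrak{sl}_2)$ is generated by $E,F,K$ subject to $KE=q^2EK$, $KF=q^{-2}FK$, $K^N=1$, $E^N=F^N=0$, $EF-FE=(K-K^{-1})/(q-q^{-1})$, with $\Delta(E)=E\otimes K+1\otimes E$, $\Delta(F)=F\otimes1+K^{-1}\otimes F$, $\Delta(K)=K\otimes K$. Put $\tilde E=(q-q^{-1})K^{-1}E$. The Hopf algebra $H=\mathrm{gr}(u_q)$ (associated graded with respect to the coradical filtration) is generated by $x,y,g$ subject to $x^N=y^N=0$, $g^N=1$, $gx=q^2xg$, $gy=q^{-2}yg$, $xy=q^2yx$, with $\Delta(x)=x\otimes1+g^{-1}\otimes x$, $\Delta(y)=y\otimes1+g^{-1}\otimes y$, $\Delta(g)=g\otimes g$. There is a Hopf 2-cocycle $\sigma$ on $H$ given by $\sigma(x^{i_1}y^{j_1}g^{k_1},x^{i_2}y^{j_2}g^{k_2})=\delta_{i_1,j_2}\delta_{j_1,0}\delta_{i_2,0}\,(i_1)_{q^2}!\,q^{-2i_1k_1}$ for $0\le i_1,j_1,k_1,i_2,j_2,k_2\le N-1$, where $(m)_t!=\prod_{i=1}^m(1+t+\cdots+t^{i-1})$; the cocycle deformation $H^\sigma$ (same coalgebra, product $\sigma(a_{(1)},b_{(1)})a_{(2)}b_{(2)}\sigma^{-1}(a_{(3)},b_{(3)})$) is identified with $u_q$ via $x\mapsto\tilde E$, $y\mapsto F$, $g\mapsto K$. For a left $H$-comodule algebra $L$, ${}_\sigma L$ is the left $H^\sigma$-comodule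 algebra (hence $u_q$-comodule algebra) with the same underlying comodule and multiplication $a*_\sigma b=\sigma(a_{(-1)},b_{(-1)})a_{(0)}b_{(0)}$. $\mathscr{L}_4(\alpha,\beta;\xi)$ is the left $H$-comodule algebra generated by $W$ subject to $W^N=\xi$, with coaction $\delta(W)=(\alpha x+\beta y)\otimes1+g^{-1}\otimes W$. *)

theory Defs
  imports "HOL-Algebra.Algebraic_Closure_Type" "HOL-Library.Poly_Mapping"
begin

section \<open>Algebras over a field\<close>

definition scalar_algebra :: "('k::field, 'k) module" where
  "scalar_algebra =
     ring.extend (ring_of_type_algebra :: 'k ring) (module.fields (*))"

locale k_algebra =
  fixes A :: "('k::field, 'a, 'm) module_scheme" (structure)
  assumes is_vector_space: "module (ring_of_type_algebra :: 'k ring) A"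
    and is_ring: "ring A"
    and smult_mult_left: "\<lbrakk>a \<in> carrier A; b \<in> carrier A\<rbrakk> \<Longrightarrow> (c \<odot> a) \<otimes> b = c \<odot> (a \<otimes> b)"
    and smult_mult_right: "\<lbrakk>a \<in> carrier A; b \<in> carrier A\<rbrakk> \<Longrightarrow> a \<otimes> (c \<odot> b) = c \<odot> (a \<otimes> b)"

definition alg_hom ::
    "('k, 'a, 'm) module_scheme \<Rightarrow> ('k, 'b, 'n) module_scheme \<Rightarrow> ('a \<Rightarrow> 'b) set" where
  "alg_hom A B =
     {h \<in> ring_hom A B. \<forall>c. \<forall>a \<in> carrier A. h (c \<odot>\<^bsub>A\<^esub> a) = c \<odot>\<^bsub>B\<^esub> h a}"

definition linear_map ::
    "('k, 'a, 'm) module_scheme \<Rightarrow> ('k, 'b, 'n) module_scheme \<Rightarrow> ('a \<Rightarrow> 'b) \<Rightarrow> bool" where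
  "linear_map A B h \<longleftrightarrow>
     h \<in> carrier A \<rightarrow> carrier B \<and>
     (\<forall>a \<in> carrier A. \<forall>b \<in> carrier A. h (a \<oplus>\<^bsub>A\<^esub> b) = h a \<oplus>\<^bsub>B\<^esub> h b) \<and>
     (\<forall>c. \<forall>a \<in> carrier A. h (c \<odot>\<^bsub>A\<^esub> a) = c \<odot>\<^bsub>B\<^esub> h a)"

definition bilinear_form ::
    "('k::field, 'a, 'm) module_scheme \<Rightarrow> ('a \<Rightarrow> 'a \<Rightarrow> 'k) \<Rightarrow> bool" where
  "bilinear_form A f \<longleftrightarrow>
     (\<forall>a \<in> carrier A. linear_map A scalar_algebra (f a)) \<and>
     (\<forall>b \<in> carrier A. linear_map A scalar_algebra (\<lambda>a. f a b))"


section \<open>Generators and relations\<close>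

text \<open>
  Lists form a monoid under concatenation, so that \<open>'g list \<Rightarrow>\<^sub>0 'k\<close>, with the convolution
  product of \<^theory>\<open>HOL-Library.Poly_Mapping\<close>, is the free associative algebra over \<open>'k\<close> on
  the set of generators \<open>'g\<close>.
\<close>

instantiation list :: (type) monoid_add
begin

definition zero_list :: "'a list" where "zero_list = []"

definition plus_list :: "'a list \<Rightarrow> 'a list \<Rightarrow> 'a list" where "plus_list = append"

instance by standard (simp_all add: zero_list_def plus_list_def)

end

type_synonym ('k, 'g) free_algebra = "'g list \<Rightarrow>\<^sub>0 'k"

abbreviation gen :: "'g \<Rightarrow> ('k::field, 'g) free_algebra" where
  "gen s \<equiv> Poly_Mapping.single [s] 1"

abbreviation const :: "'k \<Rightarrow> ('k::field, 'g) free_algebra" where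
  "const c \<equiv> Poly_Mapping.single [] c"

definition word_eval :: "('k, 'a, 'm) module_scheme \<Rightarrow> ('g \<Rightarrow> 'a) \<Rightarrow> 'g list \<Rightarrow> 'a" where
  "word_eval A f w = foldr (\<lambda>s a. f s \<otimes>\<^bsub>A\<^esub> a) w \<one>\<^bsub>A\<^esub>"

definition free_eval ::
    "('k::field, 'a, 'm) module_scheme \<Rightarrow> ('g \<Rightarrow> 'a) \<Rightarrow> ('k, 'g) free_algebra \<Rightarrow> 'a" where
  "free_eval A f p =
     finsum A (\<lambda>w. Poly_Mapping.lookup p w \<odot>\<^bsub>A\<^esub> word_eval A f w) (Poly_Mapping.keys p)"

text \<open>
  \<open>A\<close> is generated by the elements \<open>f s\<close> subject to the relations \<open>r = 0\<close>, \<open>r \<in> R\<close>: the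
  canonical map from the free algebra to \<open>A\<close> is onto, and its kernel is the two-sided ideal
  generated by \<open>R\<close>.
\<close>

definition presented_by ::
    "('k::field, 'a, 'm) module_scheme \<Rightarrow> ('g \<Rightarrow> 'a) \<Rightarrow> ('k, 'g) free_algebra set \<Rightarrow> bool" where
  "presented_by A f R \<longleftrightarrow>
     k_algebra A \<and> range f \<subseteq> carrier A \<and>
     range (free_eval A f) = carrier A \<and>
     a_kernel (ring_of_type_algebra :: ('k, 'g) free_algebra ring) A (free_eval A f) =
       genideal ring_of_type_algebra R"


section \<open>Tensor products\<close>

text \<open>
  The vector space with basis \<open>carrier A \<times> carrier B\<close>, with the componentwise product of basis
  elements extended bilinearly.
\<close>

definition pre_tensor ::
    "('k::field, 'a, 'm) module_scheme \<Rightarrow> ('k, 'b, 'n) module_scheme \<Rightarrow>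
     ('k, 'a \<times> 'b \<Rightarrow>\<^sub>0 'k) module" where
  "pre_tensor A B =
     \<lparr>carrier = {p. Poly_Mapping.keys p \<subseteq> carrier A \<times> carrier B},
      monoid.mult = (\<lambda>p r. \<Sum>u \<in> Poly_Mapping.keys p. \<Sum>v \<in> Poly_Mapping.keys r.
        Poly_Mapping.single (fst u \<otimes>\<^bsub>A\<^esub> fst v, snd u \<otimes>\<^bsub>B\<^esub> snd v)
          (Poly_Mapping.lookup p u * Poly_Mapping.lookup r v)),
      one = Poly_Mapping.single (\<one>\<^bsub>A\<^esub>, \<one>\<^bsub>B\<^esub>) 1,
      ring.zero = 0,
      add = (+),
      module.smult = (\<lambda>c. Poly_Mapping.map ((*) c))\<rparr>"

text \<open>
  The linear span of the bilinearity relations. The arbitrary coefficient \<open>c\<close> in the relations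
  makes closure under scalar multiplication automatic.
\<close>

inductive_set tensor_null ::
    "('k::field, 'a, 'm) module_scheme \<Rightarrow> ('k, 'b, 'n) module_scheme \<Rightarrow> ('a \<times> 'b \<Rightarrow>\<^sub>0 'k) set"
  for A :: "('k::field, 'a, 'm) module_scheme" and B :: "('k, 'b, 'n) module_scheme"
where
  zero: "0 \<in> tensor_null A B"
| diff: "\<lbrakk>p \<in> tensor_null A B; r \<in> tensor_null A B\<rbrakk> \<Longrightarrow> p - r \<in> tensor_null A B"
| add_left: "\<lbrakk>a \<in> carrier A; a' \<in> carrier A; b \<in> carrier B\<rbrakk> \<Longrightarrow>
    Poly_Mapping.single (a \<oplus>\<^bsub>A\<^esub> a', b) c - Poly_Mapping.single (a, b) c
      - Poly_Mapping.single (a', b) c \<in> tensor_null A B"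
| add_right: "\<lbrakk>a \<in> carrier A; b \<in> carrier B; b' \<in> carrier B\<rbrakk> \<Longrightarrow>
    Poly_Mapping.single (a, b \<oplus>\<^bsub>B\<^esub> b') c - Poly_Mapping.single (a, b) c
      - Poly_Mapping.single (a, b') c \<in> tensor_null A B"
| smult_left: "\<lbrakk>a \<in> carrier A; b \<in> carrier B\<rbrakk> \<Longrightarrow>
    Poly_Mapping.single (d \<odot>\<^bsub>A\<^esub> a, b) c - Poly_Mapping.single (a, b) (c * d) \<in> tensor_null A B"
| smult_right: "\<lbrakk>a \<in> carrier A; b \<in> carrier B\<rbrakk> \<Longrightarrow>
    Poly_Mapping.single (a, d \<odot>\<^bsub>B\<^esub> b) c - Poly_Mapping.single (a, b) (c * d) \<in> tensor_null A B"

type_synonym ('k, 'a, 'b) tensor = "('a \<times> 'b \<Rightarrow>\<^sub>0 'k) set"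

definition tensor ::
    "('k::field, 'a, 'm) module_scheme \<Rightarrow> ('k, 'b, 'n) module_scheme \<Rightarrow>
     ('k, ('k, 'a, 'b) tensor) module" where
  "tensor A B =
     ring.extend (pre_tensor A B Quot tensor_null A B)
       (module.fields (\<lambda>c t. \<Union>p \<in> t.
          tensor_null A B +>\<^bsub>pre_tensor A B\<^esub> (c \<odot>\<^bsub>pre_tensor A B\<^esub> p)))"

definition pure_tensor ::
    "('k::field, 'a, 'm) module_scheme \<Rightarrow> ('k, 'b, 'n) module_scheme \<Rightarrow>
     'a \<Rightarrow> 'b \<Rightarrow> ('k, 'a, 'b) tensor" where
  "pure_tensor A B a b = tensor_null A B +>\<^bsub>pre_tensor A B\<^esub> Poly_Mapping.single (a, b) 1"

text \<open>
  For a bilinear map \<open>f\<close> into the vector space \<open>C\<close>, \<open>tensor_lift C f\<close> is the induced linear map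
  on the tensor product; its value on a coset is the common value on all representatives.
  It also renders Sweedler notation: \<open>f(a\<^sub>(\<^sub>1\<^sub>), a\<^sub>(\<^sub>2\<^sub>))\<close> is \<open>tensor_lift C f (\<Delta> a)\<close>.
\<close>

definition tensor_lift ::
    "('k::field, 'c, 'm) module_scheme \<Rightarrow> ('a \<Rightarrow> 'b \<Rightarrow> 'c) \<Rightarrow> ('k, 'a, 'b) tensor \<Rightarrow> 'c" where
  "tensor_lift C f t =
     the_elem ((\<lambda>p. finsum C (\<lambda>u. Poly_Mapping.lookup p u \<odot>\<^bsub>C\<^esub> f (fst u) (snd u))
                    (Poly_Mapping.keys p)) ` t)"


section \<open>Hopf algebras and comodule algebras\<close>

record (overloaded) ('k, 'a) bialgebra = "('k, 'a) module" +
  comult :: "'a \<Rightarrow> ('k, 'a, 'a) tensor"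
  counit :: "'a \<Rightarrow> 'k"

text \<open>\<open>(\<Delta> \<otimes> id) \<circ> \<delta> = (id \<otimes> \<delta>) \<circ> \<delta>\<close> in \<open>H \<otimes> (H \<otimes> L)\<close>, and \<open>(\<epsilon> \<otimes> id) \<circ> \<delta> = id\<close>.\<close>

definition left_comodule ::
    "('k::field, 'h, 'm) bialgebra_scheme \<Rightarrow> ('k, 'l, 'n) module_scheme \<Rightarrow>
     ('l \<Rightarrow> ('k, 'h, 'l) tensor) \<Rightarrow> bool" where
  "left_comodule H L \<delta> \<longleftrightarrow>
     linear_map L (tensor H L) \<delta> \<and>
     (\<forall>a \<in> carrier L.
        tensor_lift (tensor H (tensor H L))
          (\<lambda>h l. tensor_lift (tensor H (tensor H L))
             (\<lambda>h1 h2. pure_tensor H (tensor H L) h1 (pure_tensor H L h2 l)) (comult H h)) (\<delta> a) =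
        tensor_lift (tensor H (tensor H L))
          (\<lambda>h l. pure_tensor H (tensor H L) h (\<delta> l)) (\<delta> a)) \<and>
     (\<forall>a \<in> carrier L. tensor_lift L (\<lambda>h l. counit H h \<odot>\<^bsub>L\<^esub> l) (\<delta> a) = a)"

definition is_bialgebra :: "('k::field, 'h, 'm) bialgebra_scheme \<Rightarrow> bool" where
  "is_bialgebra H \<longleftrightarrow>
     k_algebra H \<and>
     comult H \<in> alg_hom H (tensor H H) \<and>
     counit H \<in> alg_hom H scalar_algebra \<and>
     left_comodule H H (comult H) \<and>
     (\<forall>a \<in> carrier H. tensor_lift H (\<lambda>a1 a2. counit H a2 \<odot>\<^bsub>H\<^esub> a1) (comult H a) = a)"

definition is_hopf_algebra :: "('k::field, 'h, 'm) bialgebra_scheme \<Rightarrow> bool" where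
  "is_hopf_algebra H \<longleftrightarrow>
     is_bialgebra H \<and>
     (\<exists>S. linear_map H H S \<and>
       (\<forall>a \<in> carrier H.
          tensor_lift H (\<lambda>a1 a2. S a1 \<otimes>\<^bsub>H\<^esub> a2) (comult H a) = counit H a \<odot>\<^bsub>H\<^esub> \<one>\<^bsub>H\<^esub> \<and>
          tensor_lift H (\<lambda>a1 a2. a1 \<otimes>\<^bsub>H\<^esub> S a2) (comult H a) = counit H a \<odot>\<^bsub>H\<^esub> \<one>\<^bsub>H\<^esub>))"

text \<open>Bialgebra isomorphisms between Hopf algebras automatically commute with the antipodes.\<close>

definition hopf_iso ::
    "('k::field, 'a, 'm) bialgebra_scheme \<Rightarrow> ('k, 'b, 'n) bialgebra_scheme \<Rightarrow> ('a \<Rightarrow> 'b) \<Rightarrow> bool" where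
  "hopf_iso H U \<iota> \<longleftrightarrow>
     is_hopf_algebra H \<and> is_hopf_algebra U \<and>
     \<iota> \<in> alg_hom H U \<and> bij_betw \<iota> (carrier H) (carrier U) \<and>
     (\<forall>a \<in> carrier H. counit U (\<iota> a) = counit H a \<and>
        comult U (\<iota> a) =
          tensor_lift (tensor U U) (\<lambda>a1 a2. pure_tensor U U (\<iota> a1) (\<iota> a2)) (comult H a))"

definition left_comodule_algebra ::
    "('k::field, 'h, 'm) bialgebra_scheme \<Rightarrow> ('k, 'l, 'n) module_scheme \<Rightarrow>
     ('l \<Rightarrow> ('k, 'h, 'l) tensor) \<Rightarrow> bool" where
  "left_comodule_algebra H L \<delta> \<longleftrightarrow>
     k_algebra L \<and> left_comodule H L \<delta> \<and> \<delta> \<in> alg_hom L (tensor H L)"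


section \<open>Cocycles and cocycle deformations\<close>

definition convolution ::
    "('k::field, 'h, 'm) bialgebra_scheme \<Rightarrow> ('h \<Rightarrow> 'h \<Rightarrow> 'k) \<Rightarrow> ('h \<Rightarrow> 'h \<Rightarrow> 'k) \<Rightarrow> 'h \<Rightarrow> 'h \<Rightarrow> 'k" where
  "convolution H \<sigma> \<tau> a b =
     tensor_lift scalar_algebra (\<lambda>a1 a2. tensor_lift scalar_algebra
       (\<lambda>b1 b2. \<sigma> a1 b1 * \<tau> a2 b2) (comult H b)) (comult H a)"

definition is_convolution_inverse ::
    "('k::field, 'h, 'm) bialgebra_scheme \<Rightarrow> ('h \<Rightarrow> 'h \<Rightarrow> 'k) \<Rightarrow> ('h \<Rightarrow> 'h \<Rightarrow> 'k) \<Rightarrow> bool" where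
  "is_convolution_inverse H \<sigma> \<tau> \<longleftrightarrow>
     bilinear_form H \<tau> \<and>
     (\<forall>a \<in> carrier H. \<forall>b \<in> carrier H.
        convolution H \<sigma> \<tau> a b = counit H a * counit H b \<and>
        convolution H \<tau> \<sigma> a b = counit H a * counit H b)"

text \<open>
  \<open>\<sigma>(a\<^sub>(\<^sub>1\<^sub>), b\<^sub>(\<^sub>1\<^sub>)) \<sigma>(a\<^sub>(\<^sub>2\<^sub>) b\<^sub>(\<^sub>2\<^sub>), c) = \<sigma>(b\<^sub>(\<^sub>1\<^sub>), c\<^sub>(\<^sub>1\<^sub>)) \<sigma>(a, b\<^sub>(\<^sub>2\<^sub>) c\<^sub>(\<^sub>2\<^sub>))\<close>, normalised and convolution
  invertible.
\<close>

definition hopf_2_cocycle ::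
    "('k::field, 'h, 'm) bialgebra_scheme \<Rightarrow> ('h \<Rightarrow> 'h \<Rightarrow> 'k) \<Rightarrow> bool" where
  "hopf_2_cocycle H \<sigma> \<longleftrightarrow>
     bilinear_form H \<sigma> \<and>
     (\<exists>\<tau>. is_convolution_inverse H \<sigma> \<tau>) \<and>
     (\<forall>a \<in> carrier H. \<sigma> a \<one>\<^bsub>H\<^esub> = counit H a \<and> \<sigma> \<one>\<^bsub>H\<^esub> a = counit H a) \<and>
     (\<forall>a \<in> carrier H. \<forall>b \<in> carrier H. \<forall>c \<in> carrier H.
        convolution H \<sigma> (\<lambda>a2 b2. \<sigma> (a2 \<otimes>\<^bsub>H\<^esub> b2) c) a b =
        convolution H \<sigma> (\<lambda>b2 c2. \<sigma> a (b2 \<otimes>\<^bsub>H\<^esub> c2)) b c)"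

text \<open>The convolution inverse; on \<open>carrier H\<close> it is unique.\<close>

definition conv_inv ::
    "('k::field, 'h, 'm) bialgebra_scheme \<Rightarrow> ('h \<Rightarrow> 'h \<Rightarrow> 'k) \<Rightarrow> 'h \<Rightarrow> 'h \<Rightarrow> 'k" where
  "conv_inv H \<sigma> = (SOME \<tau>. is_convolution_inverse H \<sigma> \<tau>)"

text \<open>\<open>C\<close>-valued \<open>f(a\<^sub>(\<^sub>1\<^sub>), a\<^sub>(\<^sub>2\<^sub>), a\<^sub>(\<^sub>3\<^sub>))\<close> for a trilinear map \<open>f\<close>.\<close>

definition sweedler3 ::
    "('k::field, 'h, 'm) bialgebra_scheme \<Rightarrow> ('k, 'c, 'n) module_scheme \<Rightarrow>
     ('h \<Rightarrow> 'h \<Rightarrow> 'h \<Rightarrow> 'c) \<Rightarrow> 'h \<Rightarrow> 'c" where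
  "sweedler3 H C f a =
     tensor_lift C (\<lambda>u a3. tensor_lift C (\<lambda>a1 a2. f a1 a2 a3) (comult H u)) (comult H a)"

definition cocycle_deformation ::
    "('k::field, 'h) bialgebra \<Rightarrow> ('h \<Rightarrow> 'h \<Rightarrow> 'k) \<Rightarrow> ('k, 'h) bialgebra" where
  "cocycle_deformation H \<sigma> =
     H\<lparr>monoid.mult := (\<lambda>a b.
        sweedler3 H H (\<lambda>a1 a2 a3. sweedler3 H H (\<lambda>b1 b2 b3.
          (\<sigma> a1 b1 * conv_inv H \<sigma> a3 b3) \<odot>\<^bsub>H\<^esub> (a2 \<otimes>\<^bsub>H\<^esub> b2)) b) a)\<rparr>"

definition twisted_algebra ::
    "('h \<Rightarrow> 'h \<Rightarrow> 'k::field) \<Rightarrow> ('k, 'l) module \<Rightarrow> ('l \<Rightarrow> ('k, 'h, 'l) tensor) \<Rightarrow> ('k, 'l) module" where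
  "twisted_algebra \<sigma> L \<delta> =
     L\<lparr>monoid.mult := (\<lambda>a b.
        tensor_lift L (\<lambda>h a0. tensor_lift L (\<lambda>h' b0. \<sigma> h h' \<odot>\<^bsub>L\<^esub> (a0 \<otimes>\<^bsub>L\<^esub> b0)) (\<delta> b)) (\<delta> a))\<rparr>"

text \<open>The \<open>U\<close>-coaction \<open>(\<iota> \<otimes> id) \<circ> \<delta>\<close> obtained from a coaction \<open>\<delta>\<close> and a coalgebra map \<open>\<iota>\<close> to \<open>U\<close>.\<close>

definition push_coaction ::
    "('k::field, 'u, 'm) bialgebra_scheme \<Rightarrow> ('k, 'l, 'n) module_scheme \<Rightarrow> ('h \<Rightarrow> 'u) \<Rightarrow>
     ('l \<Rightarrow> ('k, 'h, 'l) tensor) \<Rightarrow> 'l \<Rightarrow> ('k, 'u, 'l) tensor" where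
  "push_coaction U L \<iota> \<delta> a =
     tensor_lift (tensor U L) (\<lambda>h l. pure_tensor U L (\<iota> h) l) (\<delta> a)"


section \<open>The Hopf algebras \<open>u\<^sub>q(sl\<^sub>2)\<close> and \<open>gr(u\<^sub>q(sl\<^sub>2))\<close>\<close>

text \<open>Below \<open>K\<^sup>-\<^sup>1\<close> is written \<open>K ^ (N - 1)\<close> in the free algebra, in view of the relation \<open>K ^ N = 1\<close>.\<close>

datatype uq_gen = gen_E | gen_F | gen_K

definition uq_relations :: "nat \<Rightarrow> 'k::field \<Rightarrow> ('k, uq_gen) free_algebra set" where
  "uq_relations N q =
     (let E = gen gen_E; F = gen gen_F; K = gen gen_K in
      {K * E - const (q ^ 2) * E * K,
       K * F - const (inverse q ^ 2) * F * K,
       K ^ N - 1,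
       E ^ N,
       F ^ N,
       E * F - F * E - const (1 / (q - inverse q)) * (K - K ^ (N - 1))})"

definition is_uq_sl2 ::
    "nat \<Rightarrow> 'k::field \<Rightarrow> ('k, 'u, 'm) bialgebra_scheme \<Rightarrow> 'u \<Rightarrow> 'u \<Rightarrow> 'u \<Rightarrow> bool" where
  "is_uq_sl2 N q U E F K \<longleftrightarrow>
     is_hopf_algebra U \<and>
     presented_by U (case_uq_gen E F K) (uq_relations N q) \<and>
     comult U E = pure_tensor U U E K \<oplus>\<^bsub>tensor U U\<^esub> pure_tensor U U \<one>\<^bsub>U\<^esub> E \<and>
     comult U F = pure_tensor U U F \<one>\<^bsub>U\<^esub> \<oplus>\<^bsub>tensor U U\<^esub> pure_tensor U U (inv\<^bsub>U\<^esub> K) F \<and>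
     comult U K = pure_tensor U U K K"

definition E_tilde :: "('k::field, 'u, 'm) bialgebra_scheme \<Rightarrow> 'k \<Rightarrow> 'u \<Rightarrow> 'u \<Rightarrow> 'u" where
  "E_tilde U q E K = (q - inverse q) \<odot>\<^bsub>U\<^esub> (inv\<^bsub>U\<^esub> K \<otimes>\<^bsub>U\<^esub> E)"

datatype gr_gen = gen_x | gen_y | gen_g

definition gr_uq_relations :: "nat \<Rightarrow> 'k::field \<Rightarrow> ('k, gr_gen) free_algebra set" where
  "gr_uq_relations N q =
     (let x = gen gen_x; y = gen gen_y; g = gen gen_g in
      {x ^ N,
       y ^ N,
       g ^ N - 1,
       g * x - const (q ^ 2) * x * g,
       g * y - const (inverse q ^ 2) * y * g,
       x * y - const (q ^ 2) * y * x})"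

definition is_gr_uq_sl2 ::
    "nat \<Rightarrow> 'k::field \<Rightarrow> ('k, 'h, 'm) bialgebra_scheme \<Rightarrow> 'h \<Rightarrow> 'h \<Rightarrow> 'h \<Rightarrow> bool" where
  "is_gr_uq_sl2 N q H x y g \<longleftrightarrow>
     is_hopf_algebra H \<and>
     presented_by H (case_gr_gen x y g) (gr_uq_relations N q) \<and>
     comult H x = pure_tensor H H x \<one>\<^bsub>H\<^esub> \<oplus>\<^bsub>tensor H H\<^esub> pure_tensor H H (inv\<^bsub>H\<^esub> g) x \<and>
     comult H y = pure_tensor H H y \<one>\<^bsub>H\<^esub> \<oplus>\<^bsub>tensor H H\<^esub> pure_tensor H H (inv\<^bsub>H\<^esub> g) y \<and>
     comult H g = pure_tensor H H g g"

definition q_fact :: "'k::field \<Rightarrow> nat \<Rightarrow> 'k" where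
  "q_fact t m = (\<Prod>i = 1..m. \<Sum>j<i. t ^ j)"

definition PBW_monomial ::
    "('k, 'h, 'm) module_scheme \<Rightarrow> 'h \<Rightarrow> 'h \<Rightarrow> 'h \<Rightarrow> nat \<Rightarrow> nat \<Rightarrow> nat \<Rightarrow> 'h" where
  "PBW_monomial H x y g i j k = x [^]\<^bsub>H\<^esub> i \<otimes>\<^bsub>H\<^esub> y [^]\<^bsub>H\<^esub> j \<otimes>\<^bsub>H\<^esub> g [^]\<^bsub>H\<^esub> k"

text \<open>
  The PBW monomials with exponents below \<open>N\<close> form a basis of \<open>H\<close>, so these values determine
  the bilinear form \<open>\<sigma>\<close> on \<open>carrier H\<close>.
\<close>

definition is_uq_cocycle ::
    "nat \<Rightarrow> 'k::field \<Rightarrow> ('k, 'h, 'm) bialgebra_scheme \<Rightarrow> 'h \<Rightarrow> 'h \<Rightarrow> 'h \<Rightarrow>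
     ('h \<Rightarrow> 'h \<Rightarrow> 'k) \<Rightarrow> bool" where
  "is_uq_cocycle N q H x y g \<sigma> \<longleftrightarrow>
     hopf_2_cocycle H \<sigma> \<and>
     (\<forall>i1 < N. \<forall>j1 < N. \<forall>k1 < N. \<forall>i2 < N. \<forall>j2 < N. \<forall>k2 < N.
        \<sigma> (PBW_monomial H x y g i1 j1 k1) (PBW_monomial H x y g i2 j2 k2) =
          (if i1 = j2 \<and> j1 = 0 \<and> i2 = 0
           then q_fact (q ^ 2) i1 * inverse q ^ (2 * i1 * k1) else 0))"

definition is_L4 ::
    "nat \<Rightarrow> ('k::field, 'h, 'm) bialgebra_scheme \<Rightarrow> 'h \<Rightarrow> 'h \<Rightarrow> 'h \<Rightarrow> 'k \<Rightarrow> 'k \<Rightarrow> 'k \<Rightarrow>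
     ('k, 'l, 'n) module_scheme \<Rightarrow> ('l \<Rightarrow> ('k, 'h, 'l) tensor) \<Rightarrow> 'l \<Rightarrow> bool" where
  "is_L4 N H x y g \<alpha> \<beta> \<xi> L \<delta> W \<longleftrightarrow>
     left_comodule_algebra H L \<delta> \<and>
     presented_by L (\<lambda>_::unit. W) {gen () ^ N - const \<xi>} \<and>
     \<delta> W = pure_tensor H L (\<alpha> \<odot>\<^bsub>H\<^esub> x \<oplus>\<^bsub>H\<^esub> \<beta> \<odot>\<^bsub>H\<^esub> y) \<one>\<^bsub>L\<^esub>
             \<oplus>\<^bsub>tensor H L\<^esub> pure_tensor H L (inv\<^bsub>H\<^esub> g) W"

definition phi :: "nat \<Rightarrow> 'k::field \<Rightarrow> 'k \<Rightarrow> 'k \<Rightarrow> 'k \<Rightarrow> ('k, 'g) free_algebra \<Rightarrow> ('k, 'g) free_algebra" where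
  "phi N q \<alpha> \<beta> \<xi> T =
     (\<Sum>k = 0..(N - 1) div 2.
        const (of_nat N / of_nat (N - k) * of_nat ((N - k) choose k)
                 * (\<alpha> * \<beta> / (q ^ 2 - 1)) ^ k)
        * T ^ (N - 2 * k))
     - const \<xi>"

end

theory Submission
  imports Defs
begin

text \<open>
  Twisting by the cocycle \<open>\<sigma>\<close> replaces the product of \<open>L\<close> by
  \<open>a * b = \<sigma>(a\<^sub>(\<^sub>-\<^sub>1\<^sub>), b\<^sub>(\<^sub>-\<^sub>1\<^sub>)) a\<^sub>(\<^sub>0\<^sub>) b\<^sub>(\<^sub>0\<^sub>)\<close> and keeps the space with basis \<open>1, W, \<dots>, W\<^bsup>N-1\<^esup>\<close>.

  \<^bold>\<open>The comodule algebra.\<close> That the twist is a comodule algebra over the deformed Hopf algebra is a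
  general fact. For a finite basis \<open>e i\<close> of \<open>L\<close> write \<open>\<delta> a = \<Sum>i. h i a \<otimes> e i\<close>. The axioms of a
  comodule algebra are then equivalent to identities for the coefficients: \<open>\<Delta>(h i a)\<close> is the matrix
  product \<open>\<Sum>j. h j a \<otimes> h i (e j)\<close>, the counit of \<open>h i a\<close> is the \<open>i\<close>-th coordinate of \<open>a\<close>, and
  \<open>h i (a b)\<close> is given by the structure constants of \<open>L\<close>
  (\<open>comodule_algebra_imp_coefficient_family\<close> and \<open>coefficient_family_imp_comodule_algebra\<close>). Sweedler
  sums thereby become finite sums of scalars: the cocycle identity gives associativity of the twist
  (\<open>k_algebra_twisted\<close>), and cancelling \<open>\<sigma>\<close> against its inverse gives the coefficient identities over
  the deformation (\<open>twisted_coefficient_family\<close>). They are preserved by the isomorphism onto \<open>u\<^sub>q\<close>,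
  which proves \<open>twisted_comodule_algebra\<close>.

  \<^bold>\<open>The twisted powers of \<open>W\<close>.\<close> On \<open>H\<close> the form satisfies \<open>\<sigma>(g\<^sup>-\<^sup>1, b) = \<epsilon>(b)\<close> and \<open>\<sigma>(y, b) = 0\<close>, while
  \<open>\<sigma>(x, -)\<close> is a skew derivation dual to \<open>y\<close>: it kills \<open>x b\<close>, sends \<open>y b\<close> to \<open>\<epsilon>(b)\<close> and \<open>g\<^sup>-\<^sup>1 b\<close> to
  \<open>q\<^sup>2 \<sigma>(x, b)\<close>. Hence \<open>W * W\<^bsup>m+1\<^esup> = W\<^bsup>m+2\<^esup> + \<alpha> \<beta> [m+1] W\<^bsup>m\<^esup>\<close> with \<open>[m+1] = 1 + q\<^sup>2 + \<dots> + q\<^bsup>2m\<^esup>\<close>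
  (\<open>twisted_mult_W_pow\<close>). So the element \<open>W\<^bsup>m\<^esup>\<close> of \<open>L\<close> is the value at \<open>W\<close>, computed in the twist, of
  the monic q-Hermite polynomial \<open>P\<^sub>m\<close> given by \<open>P\<^sub>0 = 1\<close>, \<open>P\<^sub>1 = T\<close> and
  \<open>P\<^sub>m\<^sub>+\<^sub>2 = T P\<^sub>m\<^sub>+\<^sub>1 - \<alpha> \<beta> [m+1] P\<^sub>m\<close>, and \<open>W\<^bsup>N\<^esup> = \<xi>\<close> says that
  \<open>P\<^sub>N - \<xi>\<close> vanishes at \<open>W\<close>. As the \<open>P\<^sub>m\<close> with \<open>m < N\<close> are a basis of the polynomials of degree below
  \<open>N\<close> and their values are a basis of the twist, this is the only relation
  (\<open>presented_by_change_of_basis\<close>).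

  \<^bold>\<open>The polynomial \<open>P\<^sub>N\<close>.\<close> Substitute \<open>T = u + v\<close> with \<open>u v = - \<alpha> \<beta> / (q\<^sup>2 - 1)\<close>, which is possible over an
  algebraically closed field. Then \<open>P\<^sub>m\<close> becomes the Rogers-Szegoe polynomial
  \<open>\<Sum>k. [m choose k] u\<^bsup>k\<^esup> v\<^bsup>m-k\<^esup>\<close> with Gaussian binomials at \<open>q\<^sup>2\<close>. Because \<open>N\<close> is odd, \<open>q\<^sup>2\<close> is again a
  primitive \<open>N\<close>-th root of unity, so the inner Gaussian binomials of \<open>N\<close> vanish and
  \<open>P\<^sub>N = u\<^bsup>N\<^esup> + v\<^bsup>N\<^esup>\<close>. Girard's formula expresses this power sum through \<open>u + v\<close> and \<open>u v\<close>; the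
  result is \<open>\<phi> + \<xi>\<close> (\<open>q_hermite_root_of_unity\<close>).
\<close>

section \<open>Vector spaces and linear maps\<close>

text \<open>
  Modules over \<open>ring_of_type_algebra\<close> with their laws restated through the type class operations of the
  field, so that scalars are simplified as elements of a field type.
\<close>

locale k_space =
  fixes M :: "('k::field, 'a, 'm) module_scheme" (structure)
  assumes module: "module (ring_of_type_algebra :: 'k ring) M"

sublocale k_space \<subseteq> abelian_group M
  using module by (rule module.axioms)

context k_space
begin

lemma smult_closed [simp, intro]: "v \<in> carrier M \<Longrightarrow> c \<odot> v \<in> carrier M"
  using module.smult_closed[OF module, of c v] by (simp add: ring_of_type_algebra_def)

lemma smult_add_left: "v \<in> carrier M \<Longrightarrow> (c + d) \<odot> v = c \<odot> v \<oplus> d \<odot> v"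
  using module.smult_l_distr[OF module, of c d v] by (simp add: ring_of_type_algebra_def)

lemma smult_add_right: "v \<in> carrier M \<Longrightarrow> w \<in> carrier M \<Longrightarrow> c \<odot> (v \<oplus> w) = c \<odot> v \<oplus> c \<odot> w"
  using module.smult_r_distr[OF module, of c v w] by (simp add: ring_of_type_algebra_def)

lemma smult_smult: "v \<in> carrier M \<Longrightarrow> c \<odot> (d \<odot> v) = (c * d) \<odot> v"
  using module.smult_assoc1[OF module, of c d v] by (simp add: ring_of_type_algebra_def)

lemma smult_one [simp]: "v \<in> carrier M \<Longrightarrow> 1 \<odot> v = v"
  using module.smult_one[OF module, of v] by (simp add: ring_of_type_algebra_def)

lemma smult_zero_left [simp]: "v \<in> carrier M \<Longrightarrow> 0 \<odot> v = \<zero>"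
  using module.smult_l_null[OF module, of v] by (simp add: ring_of_type_algebra_def)

lemma smult_zero_right [simp]: "c \<odot> \<zero> = \<zero>"
  using module.smult_r_null[OF module, of c] by (simp add: ring_of_type_algebra_def)

lemma smult_finsum:
  assumes "f \<in> I \<rightarrow> carrier M"
  shows "c \<odot> finsum M f I = finsum M (\<lambda>i. c \<odot> f i) I"
  using assms
  by (induction I rule: infinite_finite_induct) (simp_all add: smult_add_right Pi_def)

lemma sum_smult:
  assumes "v \<in> carrier M"
  shows "sum f I \<odot> v = finsum M (\<lambda>i. f i \<odot> v) I"
  using assms
  by (induction I rule: infinite_finite_induct) (simp_all add: smult_add_left Pi_def)

lemma finsum_swap:
  assumes "finite I" "finite J" "\<And>i j. i \<in> I \<Longrightarrow> j \<in> J \<Longrightarrow> f i j \<in> carrier M"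
  shows "(\<Oplus>i\<in>I. \<Oplus>j\<in>J. f i j) = (\<Oplus>j\<in>J. \<Oplus>i\<in>I. f i j)"
  using assms(1,3)
proof (induction I rule: finite_induct)
  case (insert i I)
  have "(\<Oplus>i\<in>insert i I. \<Oplus>j\<in>J. f i j) = (\<Oplus>j\<in>J. f i j) \<oplus> (\<Oplus>i\<in>I. \<Oplus>j\<in>J. f i j)"
    using insert by (subst finsum_insert) (auto intro!: finsum_closed)
  also have "\<dots> = (\<Oplus>j\<in>J. f i j) \<oplus> (\<Oplus>j\<in>J. \<Oplus>i\<in>I. f i j)"
    using insert by simp
  also have "\<dots> = (\<Oplus>j\<in>J. f i j \<oplus> (\<Oplus>i\<in>I. f i j))"
    using insert by (subst finsum_addf) (auto intro!: finsum_closed)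
  also have "\<dots> = (\<Oplus>j\<in>J. \<Oplus>i\<in>insert i I. f i j)"
    using insert by (intro finsum_cong) (auto simp: simp_implies_def)
  finally show ?case .
qed simp

end

text \<open>
  The linear extension of a map on basis elements to formal linear combinations. Both evaluation of
  free algebras and linear maps out of tensor products are instances.
\<close>

definition linear_extension ::
    "('k::field, 'a, 'm) module_scheme \<Rightarrow> ('w \<Rightarrow> 'a) \<Rightarrow> ('w \<Rightarrow>\<^sub>0 'k) \<Rightarrow> 'a" where
  "linear_extension M f p = finsum M (\<lambda>u. Poly_Mapping.lookup p u \<odot>\<^bsub>M\<^esub> f u) (Poly_Mapping.keys p)"

context k_space
begin

lemma linear_extension_superset:
  assumes "finite S" "Poly_Mapping.keys p \<subseteq> S" "\<And>u. u \<in> S \<Longrightarrow> f u \<in> carrier M"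
  shows "linear_extension M f p = (\<Oplus>u\<in>S. Poly_Mapping.lookup p u \<odot> f u)"
  unfolding linear_extension_def using assms
  by (intro add.finprod_mono_neutral_cong_left)
     (auto simp: Pi_def not_in_keys_iff_lookup_eq_zero subset_iff)

lemma linear_extension_closed:
  "(\<And>u. u \<in> Poly_Mapping.keys p \<Longrightarrow> f u \<in> carrier M) \<Longrightarrow> linear_extension M f p \<in> carrier M"
  unfolding linear_extension_def by (intro finsum_closed) auto

lemma linear_extension_add:
  assumes f: "\<And>u. u \<in> Poly_Mapping.keys p \<union> Poly_Mapping.keys r \<Longrightarrow> f u \<in> carrier M"
  shows "linear_extension M f (p + r) = linear_extension M f p \<oplus> linear_extension M f r"
proof -
  let ?S = "Poly_Mapping.keys p \<union> Poly_Mapping.keys r"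
  have cl: "(\<lambda>u. g u \<odot> f u) \<in> ?S \<rightarrow> carrier M" for g
    using f by blast
  have "linear_extension M f (p + r) = (\<Oplus>u\<in>?S. Poly_Mapping.lookup (p + r) u \<odot> f u)"
    using f by (intro linear_extension_superset) (auto simp: Poly_Mapping.keys_add)
  also have "\<dots> = (\<Oplus>u\<in>?S. Poly_Mapping.lookup p u \<odot> f u \<oplus> Poly_Mapping.lookup r u \<odot> f u)"
    using f cl by (intro finsum_cong') (auto simp: lookup_add smult_add_left)
  also have "\<dots> = linear_extension M f p \<oplus> linear_extension M f r"
    using f cl linear_extension_superset[of ?S p f] linear_extension_superset[of ?S r f]
    by (simp add: finsum_addf)
  finally show ?thesis .
qed

lemma linear_extension_smult:
  assumes f: "\<And>u. u \<in> Poly_Mapping.keys p \<Longrightarrow> f u \<in> carrier M"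
    and r: "\<And>u. Poly_Mapping.lookup r u = c * Poly_Mapping.lookup p u"
  shows "linear_extension M f r = c \<odot> linear_extension M f p"
proof -
  have "linear_extension M f r = (\<Oplus>u\<in>Poly_Mapping.keys p. Poly_Mapping.lookup r u \<odot> f u)"
    using f by (intro linear_extension_superset) (auto simp: in_keys_iff r)
  also have "\<dots> = (\<Oplus>u\<in>Poly_Mapping.keys p. c \<odot> (Poly_Mapping.lookup p u \<odot> f u))"
    using f by (intro finsum_cong') (auto simp: smult_smult r)
  also have "\<dots> = c \<odot> linear_extension M f p"
    unfolding linear_extension_def using f by (intro smult_finsum[symmetric]) auto
  finally show ?thesis .
qed

lemma linear_extension_single:
  "f u \<in> carrier M \<Longrightarrow> linear_extension M f (Poly_Mapping.single u c) = c \<odot> f u"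
  by (cases "c = 0") (simp_all add: linear_extension_def)

lemma linear_extension_zero [simp]: "linear_extension M f 0 = \<zero>"
  by (simp add: linear_extension_def)

end

lemma poly_mapping_sum_single:
  "p = (\<Sum>u\<in>Poly_Mapping.keys p. Poly_Mapping.single u (Poly_Mapping.lookup p u))"
  by (rule poly_mapping_eqI)
     (simp add: lookup_sum lookup_single when_def not_in_keys_iff_lookup_eq_zero)

lemma poly_mapping_induct_add [case_names single add]:
  assumes "\<And>u c. P (Poly_Mapping.single u c)" "\<And>p r. P p \<Longrightarrow> P r \<Longrightarrow> P (p + r)"
  shows "P (p :: 'w \<Rightarrow>\<^sub>0 'k :: comm_monoid_add)"
proof -
  have "P (\<Sum>u\<in>S. Poly_Mapping.single u (Poly_Mapping.lookup p u))" for S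
    using assms(1)[of undefined 0] assms by (induction S rule: infinite_finite_induct) simp_all
  then show ?thesis using poly_mapping_sum_single[of p] by metis
qed

lemma ring_of_type_algebra_simps [simp]:
  "carrier (ring_of_type_algebra :: 'a::ring_1 ring) = UNIV"
  "\<zero>\<^bsub>(ring_of_type_algebra :: 'a ring)\<^esub> = 0"
  "\<one>\<^bsub>(ring_of_type_algebra :: 'a ring)\<^esub> = 1"
  "a \<oplus>\<^bsub>(ring_of_type_algebra :: 'a ring)\<^esub> b = a + b"
  "a \<otimes>\<^bsub>(ring_of_type_algebra :: 'a ring)\<^esub> b = a * b"
  by (simp_all add: ring_of_type_algebra_def)

lemma k_spaceI:
  fixes M (structure)
  assumes "abelian_group M"
    "\<And>(c :: 'k :: field) v. v \<in> carrier M \<Longrightarrow> c \<odot> v \<in> carrier M"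
    "\<And>c d v. v \<in> carrier M \<Longrightarrow> (c + d) \<odot> v = c \<odot> v \<oplus> d \<odot> v"
    "\<And>c v w. v \<in> carrier M \<Longrightarrow> w \<in> carrier M \<Longrightarrow> c \<odot> (v \<oplus> w) = c \<odot> v \<oplus> c \<odot> w"
    "\<And>c d v. v \<in> carrier M \<Longrightarrow> (c * d) \<odot> v = c \<odot> (d \<odot> v)"
    "\<And>v. v \<in> carrier M \<Longrightarrow> 1 \<odot> v = v"
  shows "k_space M"
  by (rule k_space.intro, rule moduleI)
     (use assms in \<open>auto intro: cring_from_type_algebra\<close>)

sublocale k_algebra \<subseteq> k_space A
  by (rule k_space.intro) (rule is_vector_space)

sublocale k_algebra \<subseteq> ring A
  by (rule is_ring)

lemma scalar_algebra_simps [simp]: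
  "carrier (scalar_algebra :: ('k::field, 'k) module) = UNIV"
  "\<zero>\<^bsub>(scalar_algebra :: ('k::field, 'k) module)\<^esub> = 0"
  "\<one>\<^bsub>(scalar_algebra :: ('k::field, 'k) module)\<^esub> = 1"
  "a \<oplus>\<^bsub>(scalar_algebra :: ('k::field, 'k) module)\<^esub> b = a + b"
  "a \<otimes>\<^bsub>(scalar_algebra :: ('k::field, 'k) module)\<^esub> b = a * b"
  "a \<odot>\<^bsub>(scalar_algebra :: ('k::field, 'k) module)\<^esub> b = a * b"
  by (simp_all add: scalar_algebra_def ring.extend_def module.fields_def ring_of_type_algebra_def)

lemma k_space_scalar_algebra [simp]: "k_space (scalar_algebra :: ('k::field, 'k) module)"
proof (rule k_spaceI)
  show "abelian_group (scalar_algebra :: ('k::field, 'k) module)"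
  proof (rule abelian_groupI)
    fix x :: 'k
    show "\<exists>y\<in>carrier scalar_algebra. y \<oplus>\<^bsub>scalar_algebra\<^esub> x = \<zero>\<^bsub>scalar_algebra\<^esub>"
      by (rule bexI[of _ "- x"]) simp_all
  qed (simp_all add: add.assoc add.commute)
qed (simp_all add: algebra_simps)

lemma finsum_scalar_algebra [simp]: "finsum scalar_algebra f I = sum f I"
proof -
  interpret k_space "scalar_algebra :: ('k::field, 'k) module" by simp
  show ?thesis
    by (induction I rule: infinite_finite_induct) simp_all
qed

lemma linear_map_closed: "linear_map A B h \<Longrightarrow> a \<in> carrier A \<Longrightarrow> h a \<in> carrier B"
  by (auto simp: linear_map_def)

lemma linear_map_add:
  "linear_map A B h \<Longrightarrow> a \<in> carrier A \<Longrightarrow> b \<in> carrier A \<Longrightarrow> h (a \<oplus>\<^bsub>A\<^esub> b) = h a \<oplus>\<^bsub>B\<^esub> h b"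
  by (auto simp: linear_map_def)

lemma linear_map_smult:
  "linear_map A B h \<Longrightarrow> a \<in> carrier A \<Longrightarrow> h (c \<odot>\<^bsub>A\<^esub> a) = c \<odot>\<^bsub>B\<^esub> h a"
  by (auto simp: linear_map_def)

lemma linear_mapI:
  "\<lbrakk>\<And>a. a \<in> carrier A \<Longrightarrow> h a \<in> carrier B;
    \<And>a b. a \<in> carrier A \<Longrightarrow> b \<in> carrier A \<Longrightarrow> h (a \<oplus>\<^bsub>A\<^esub> b) = h a \<oplus>\<^bsub>B\<^esub> h b;
    \<And>c a. a \<in> carrier A \<Longrightarrow> h (c \<odot>\<^bsub>A\<^esub> a) = c \<odot>\<^bsub>B\<^esub> h a\<rbrakk> \<Longrightarrow> linear_map A B h"
  by (auto simp: linear_map_def)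

lemma linear_map_zero:
  assumes "k_space A" "k_space B" "linear_map A B h"
  shows "h \<zero>\<^bsub>A\<^esub> = \<zero>\<^bsub>B\<^esub>"
proof -
  interpret A: k_space A by fact
  interpret B: k_space B by fact
  have "h (0 \<odot>\<^bsub>A\<^esub> \<zero>\<^bsub>A\<^esub>) = 0 \<odot>\<^bsub>B\<^esub> h \<zero>\<^bsub>A\<^esub>"
    using linear_map_smult[OF assms(3)] by blast
  then show ?thesis
    using linear_map_closed[OF assms(3)] by simp
qed

lemma linear_map_finsum:
  assumes "k_space A" "k_space B" "linear_map A B h" "f \<in> I \<rightarrow> carrier A"
  shows "h (finsum A f I) = finsum B (\<lambda>i. h (f i)) I"
proof -
  interpret A: k_space A by fact
  interpret B: k_space B by fact
  show ?thesis
    using assms(4)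
    by (induction I rule: infinite_finite_induct)
       (simp_all add: linear_map_zero[OF assms(1-3)] Pi_def linear_map_closed[OF assms(3)]
         linear_map_add[OF assms(3)] A.finsum_closed)
qed

lemma linear_map_comp:
  "linear_map A B f \<Longrightarrow> linear_map B C h \<Longrightarrow> linear_map A C (\<lambda>a. h (f a))"
  by (auto simp: linear_map_def Pi_def)

lemma linear_map_cong:
  assumes "linear_map A B f" "\<And>a. a \<in> carrier A \<Longrightarrow> f a = h a" "k_space A"
  shows "linear_map A B h"
proof -
  interpret k_space A by fact
  show ?thesis
    using assms(1) by (auto simp: linear_map_def Pi_def simp flip: assms(2))
qed

lemma linear_map_scale:
  assumes "k_space B" "linear_map A B f"
  shows "linear_map A B (\<lambda>a. c \<odot>\<^bsub>B\<^esub> f a)"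
proof -
  interpret k_space B by fact
  show ?thesis using assms(2)
    by (auto simp: linear_map_def Pi_def smult_smult smult_add_right mult.commute)
qed

lemma linear_map_scale_vector:
  assumes "k_space B" "linear_map A scalar_algebra f" "v \<in> carrier B"
  shows "linear_map A B (\<lambda>a. f a \<odot>\<^bsub>B\<^esub> v)"
proof -
  interpret k_space B by fact
  show ?thesis using assms(2,3)
    by (auto simp: linear_map_def Pi_def smult_smult smult_add_left)
qed

lemma linear_map_plus:
  assumes "k_space B" "linear_map A B f" "linear_map A B h"
  shows "linear_map A B (\<lambda>a. f a \<oplus>\<^bsub>B\<^esub> h a)"
proof -
  interpret k_space B by fact
  show ?thesis
    by (rule linear_mapI)
       (simp_all add: linear_map_closed[OF assms(2)] linear_map_closed[OF assms(3)]
         linear_map_add[OF assms(2)] linear_map_add[OF assms(3)]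
         linear_map_smult[OF assms(2)] linear_map_smult[OF assms(3)] smult_add_right a_ac)
qed

lemma linear_map_const_zero:
  assumes "k_space B"
  shows "linear_map A B (\<lambda>a. \<zero>\<^bsub>B\<^esub>)"
proof -
  interpret k_space B by fact
  show ?thesis by (auto simp: linear_map_def Pi_def)
qed

lemma linear_map_sum:
  assumes "k_space B" "\<And>i. i \<in> I \<Longrightarrow> linear_map A B (f i)"
  shows "linear_map A B (\<lambda>a. finsum B (\<lambda>i. f i a) I)"
proof -
  interpret k_space B by fact
  have cl: "a \<in> carrier A \<Longrightarrow> (\<lambda>i. f i a) \<in> I \<rightarrow> carrier B" for a
    by (auto intro: linear_map_closed[OF assms(2)])
  show ?thesis
  proof (rule linear_mapI)
    fix a b assume ab: "a \<in> carrier A" "b \<in> carrier A"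
    have "finsum B (\<lambda>i. f i (a \<oplus>\<^bsub>A\<^esub> b)) I = finsum B (\<lambda>i. f i a \<oplus>\<^bsub>B\<^esub> f i b) I"
      using ab cl by (intro finsum_cong') (auto simp: linear_map_add[OF assms(2)])
    also have "\<dots> = finsum B (\<lambda>i. f i a) I \<oplus>\<^bsub>B\<^esub> finsum B (\<lambda>i. f i b) I"
      using ab cl by (intro finsum_addf)
    finally show "finsum B (\<lambda>i. f i (a \<oplus>\<^bsub>A\<^esub> b)) I = \<dots>" .
  next
    fix c a assume a: "a \<in> carrier A"
    have "finsum B (\<lambda>i. f i (c \<odot>\<^bsub>A\<^esub> a)) I = finsum B (\<lambda>i. c \<odot>\<^bsub>B\<^esub> f i a) I"
      using a cl[OF a] by (intro finsum_cong') (auto simp: linear_map_smult[OF assms(2)])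
    also have "\<dots> = c \<odot>\<^bsub>B\<^esub> finsum B (\<lambda>i. f i a) I"
      using cl[OF a] by (rule smult_finsum[symmetric])
    finally show "finsum B (\<lambda>i. f i (c \<odot>\<^bsub>A\<^esub> a)) I = \<dots>" .
  qed (use cl in \<open>auto intro: finsum_closed\<close>)
qed

lemma linear_map_id: "linear_map A A (\<lambda>a. a)"
  by (simp add: linear_map_def)

definition bilinear_map ::
    "('k, 'a, 'm) module_scheme \<Rightarrow> ('k, 'b, 'n) module_scheme \<Rightarrow> ('k, 'c, 'p) module_scheme \<Rightarrow>
     ('a \<Rightarrow> 'b \<Rightarrow> 'c) \<Rightarrow> bool" where
  "bilinear_map A B C f \<longleftrightarrow>
     (\<forall>a \<in> carrier A. linear_map B C (f a)) \<and> (\<forall>b \<in> carrier B. linear_map A C (\<lambda>a. f a b))"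

lemma bilinear_mapI:
  "\<lbrakk>\<And>a. a \<in> carrier A \<Longrightarrow> linear_map B C (f a);
    \<And>b. b \<in> carrier B \<Longrightarrow> linear_map A C (\<lambda>a. f a b)\<rbrakk> \<Longrightarrow> bilinear_map A B C f"
  by (simp add: bilinear_map_def)

lemma bilinear_map_left: "bilinear_map A B C f \<Longrightarrow> b \<in> carrier B \<Longrightarrow> linear_map A C (\<lambda>a. f a b)"
  by (simp add: bilinear_map_def)

lemma bilinear_map_right: "bilinear_map A B C f \<Longrightarrow> a \<in> carrier A \<Longrightarrow> linear_map B C (f a)"
  by (simp add: bilinear_map_def)

lemma bilinear_map_closed:
  "bilinear_map A B C f \<Longrightarrow> a \<in> carrier A \<Longrightarrow> b \<in> carrier B \<Longrightarrow> f a b \<in> carrier C"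
  by (rule linear_map_closed[OF bilinear_map_right])

lemma bilinear_map_comp:
  "\<lbrakk>bilinear_map A B C f; linear_map A' A u; linear_map B' B v\<rbrakk> \<Longrightarrow>
     bilinear_map A' B' C (\<lambda>a b. f (u a) (v b))"
  by (rule bilinear_mapI)
     (erule (1) linear_map_comp[OF _ bilinear_map_right] linear_map_comp[OF _ bilinear_map_left];
       erule (1) linear_map_closed)+

lemma bilinear_map_linear:
  "bilinear_map A B C f \<Longrightarrow> linear_map C D h \<Longrightarrow> bilinear_map A B D (\<lambda>a b. h (f a b))"
  unfolding bilinear_map_def
  using linear_map_comp[of B C "f a" D h for a] linear_map_comp[of A C "\<lambda>a. f a b" D h for b]
  by simp

lemma bilinear_form_iff: "bilinear_form A f \<longleftrightarrow> bilinear_map A A scalar_algebra f"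
  by (simp add: bilinear_form_def bilinear_map_def)

lemma (in k_algebra) bilinear_mult: "bilinear_map A A A (\<otimes>)"
  by (auto intro!: bilinear_mapI linear_mapI simp: l_distr r_distr smult_mult_left smult_mult_right)

section \<open>Tensor products\<close>

lemma lookup_pre_tensor_smult [simp]:
  "Poly_Mapping.lookup (c \<odot>\<^bsub>pre_tensor A B\<^esub> p) u = c * Poly_Mapping.lookup p u"
  by (simp add: pre_tensor_def Poly_Mapping.map.rep_eq when_def)

lemma pre_tensor_simps [simp]:
  "p \<oplus>\<^bsub>pre_tensor A B\<^esub> r = p + r" "\<zero>\<^bsub>pre_tensor A B\<^esub> = 0"
  "\<one>\<^bsub>pre_tensor A B\<^esub> = Poly_Mapping.single (\<one>\<^bsub>A\<^esub>, \<one>\<^bsub>B\<^esub>) 1"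
  by (simp_all add: pre_tensor_def)

lemma pre_tensor_smult_single [simp]:
  "c \<odot>\<^bsub>pre_tensor A B\<^esub> Poly_Mapping.single u d = Poly_Mapping.single u (c * d)"
  by (rule poly_mapping_eqI) (simp add: lookup_single when_def)

lemma pre_tensor_smult_diff:
  "c \<odot>\<^bsub>pre_tensor A B\<^esub> (p - r) = c \<odot>\<^bsub>pre_tensor A B\<^esub> p - c \<odot>\<^bsub>pre_tensor A B\<^esub> r"
  by (rule poly_mapping_eqI) (simp add: lookup_minus algebra_simps)

lemma carrier_pre_tensor_iff:
  "p \<in> carrier (pre_tensor A B) \<longleftrightarrow>
     (\<forall>u. Poly_Mapping.lookup p u \<noteq> 0 \<longrightarrow> u \<in> carrier A \<times> carrier B)"
  by (auto simp: pre_tensor_def in_keys_iff)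

lemma pre_tensor_closed:
  "0 \<in> carrier (pre_tensor A B)"
  "p \<in> carrier (pre_tensor A B) \<Longrightarrow> r \<in> carrier (pre_tensor A B) \<Longrightarrow> p + r \<in> carrier (pre_tensor A B)"
  "p \<in> carrier (pre_tensor A B) \<Longrightarrow> r \<in> carrier (pre_tensor A B) \<Longrightarrow> p - r \<in> carrier (pre_tensor A B)"
  "p \<in> carrier (pre_tensor A B) \<Longrightarrow> - p \<in> carrier (pre_tensor A B)"
  "p \<in> carrier (pre_tensor A B) \<Longrightarrow> c \<odot>\<^bsub>pre_tensor A B\<^esub> p \<in> carrier (pre_tensor A B)"
  "a \<in> carrier A \<Longrightarrow> b \<in> carrier B \<Longrightarrow> Poly_Mapping.single (a, b) c \<in> carrier (pre_tensor A B)"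
  by (auto simp: carrier_pre_tensor_iff lookup_add lookup_minus lookup_single when_def
      split: if_splits) (metis add.right_neutral diff_self mem_Sigma_iff)+

lemma k_space_pre_tensor: "k_space (pre_tensor A B)"
proof (rule k_spaceI)
  show "abelian_group (pre_tensor A B)"
    by (rule abelian_groupI)
       (auto simp: pre_tensor_closed add.assoc add.commute intro!: bexI[of _ "- x" for x])
qed (auto simp: pre_tensor_closed lookup_add algebra_simps intro!: poly_mapping_eqI)

lemma (in abelian_group) add_minus_minus:
  assumes "v \<in> carrier G" "w \<in> carrier G"
  shows "(v \<oplus> w) \<ominus> v \<ominus> w = \<zero>"
  using assms by (simp add: a_minus_def a_assoc r_neg)
    (metis a_comm a_inv_closed a_lcomm r_neg r_zero)

locale tensor_factors = A: k_space A + B: k_space B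
  for A :: "('k::field, 'a, 'm) module_scheme" and B :: "('k, 'b, 'n) module_scheme"
begin

abbreviation "Pre \<equiv> pre_tensor A B"
abbreviation "Null \<equiv> tensor_null A B"
abbreviation "AB \<equiv> tensor A B"
abbreviation "cls p \<equiv> Null +>\<^bsub>Pre\<^esub> p"
abbreviation "pt \<equiv> pure_tensor A B"

lemma null_sub: "p \<in> Null \<Longrightarrow> p \<in> carrier Pre"
  by (induction rule: tensor_null.induct) (simp_all add: pre_tensor_closed)

text \<open>
  Closure under scalars is not among the introduction rules of \<open>tensor_null\<close>; it holds because every
  bilinearity relation comes with an arbitrary coefficient.
\<close>

lemma null_smult: "p \<in> Null \<Longrightarrow> d \<odot>\<^bsub>Pre\<^esub> p \<in> Null"
proof (induction rule: tensor_null.induct)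
  case zero
  have "d \<odot>\<^bsub>Pre\<^esub> 0 = 0" by (rule poly_mapping_eqI) simp
  then show ?case by (simp add: tensor_null.zero)
qed (simp_all add: pre_tensor_smult_diff tensor_null.diff tensor_null.add_left tensor_null.add_right
    tensor_null.smult_left tensor_null.smult_right mult.assoc[symmetric])

lemma null_uminus: "p \<in> Null \<Longrightarrow> - p \<in> Null"
  using tensor_null.diff[OF tensor_null.zero, of p A B] by simp

lemma null_add: "p \<in> Null \<Longrightarrow> r \<in> Null \<Longrightarrow> p + r \<in> Null"
  using tensor_null.diff[of p A B "- r"] null_uminus by simp

lemma null_sum: "(\<And>i. i \<in> I \<Longrightarrow> f i \<in> Null) \<Longrightarrow> sum f I \<in> Null"
  by (induction I rule: infinite_finite_induct) (simp_all add: tensor_null.zero null_add)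

sublocale Pre: k_space Pre by (rule k_space_pre_tensor)

lemma a_inv_Pre: "p \<in> carrier Pre \<Longrightarrow> \<ominus>\<^bsub>Pre\<^esub> p = - p"
  by (rule Pre.minus_equality) (simp_all add: pre_tensor_closed)

sublocale Null: abelian_subgroup Null Pre
proof (rule abelian_subgroupI3)
  have "inv\<^bsub>add_monoid Pre\<^esub> p \<in> Null" if "p \<in> Null" for p
    using a_inv_Pre[OF null_sub[OF that]] null_uminus[OF that] unfolding a_inv_def by simp
  then show "additive_subgroup Null Pre"
    using null_sub null_add tensor_null.zero[of A B]
    by (intro additive_subgroup.intro subgroup.intro) auto
qed (rule Pre.abelian_group_axioms)

lemma cls_eq_iff:
  assumes "p \<in> carrier Pre" "r \<in> carrier Pre"
  shows "cls p = cls r \<longleftrightarrow> p - r \<in> Null"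
proof -
  have "cls p = cls r \<longleftrightarrow> p \<in> cls r"
    using assms Null.a_rcos_self Null.a_repr_independence' by metis
  also have "\<dots> \<longleftrightarrow> p \<oplus>\<^bsub>Pre\<^esub> \<ominus>\<^bsub>Pre\<^esub> r \<in> Null"
    by (rule Null.a_rcos_module[OF assms(2,1)])
  finally show ?thesis
    using assms by (simp add: a_minus_def a_inv_Pre)
qed

lemma mem_clsD: "r \<in> cls p \<Longrightarrow> p \<in> carrier Pre \<Longrightarrow> r \<in> carrier Pre \<and> r - p \<in> Null"
  using null_sub by (auto simp: a_r_coset_def' pre_tensor_closed)

lemma carrier_tensor: "carrier AB = cls ` carrier Pre"
  by (auto simp: tensor_def ring.extend_def module.fields_def FactRing_def A_RCOSETS_def')

lemma cls_closed [simp]: "p \<in> carrier Pre \<Longrightarrow> cls p \<in> carrier AB"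
  by (simp add: carrier_tensor)

lemma add_cls: "p \<in> carrier Pre \<Longrightarrow> r \<in> carrier Pre \<Longrightarrow> cls p \<oplus>\<^bsub>AB\<^esub> cls r = cls (p + r)"
  using Null.a_rcos_sum[of p r]
  by (simp add: tensor_def ring.extend_def module.fields_def FactRing_def)

lemma zero_cls: "\<zero>\<^bsub>AB\<^esub> = cls 0"
  using Pre.a_coset_add_zero[OF Null.a_subset]
  by (simp add: tensor_def ring.extend_def module.fields_def FactRing_def)

lemma smult_cls:
  assumes "p \<in> carrier Pre"
  shows "c \<odot>\<^bsub>AB\<^esub> cls p = cls (c \<odot>\<^bsub>Pre\<^esub> p)"
proof -
  have "cls (c \<odot>\<^bsub>Pre\<^esub> r) = cls (c \<odot>\<^bsub>Pre\<^esub> p)" if "r \<in> cls p" for r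
    using mem_clsD[OF that assms] assms null_smult[of "r - p" c]
    by (simp add: cls_eq_iff pre_tensor_closed pre_tensor_smult_diff)
  moreover have "p \<in> cls p" using assms Null.a_rcos_self by blast
  ultimately have "(\<Union>r\<in>cls p. cls (c \<odot>\<^bsub>Pre\<^esub> r)) = cls (c \<odot>\<^bsub>Pre\<^esub> p)"
    by blast
  then show ?thesis
    by (simp add: tensor_def ring.extend_def module.fields_def FactRing_def)
qed

lemma one_tensor: "\<one>\<^bsub>AB\<^esub> = pt \<one>\<^bsub>A\<^esub> \<one>\<^bsub>B\<^esub>"
  by (simp add: tensor_def ring.extend_def module.fields_def FactRing_def pure_tensor_def)

lemma tensor_cases:
  assumes "t \<in> carrier AB"
  obtains p where "p \<in> carrier Pre" "t = cls p"
  using assms by (auto simp: carrier_tensor)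

lemma k_space_tensor: "k_space AB"
proof (rule k_spaceI)
  show "abelian_group AB"
  proof (rule abelian_groupI)
    fix s assume "s \<in> carrier AB"
    then obtain p where p: "p \<in> carrier Pre" "s = cls p" by (rule tensor_cases)
    show "\<exists>r\<in>carrier AB. r \<oplus>\<^bsub>AB\<^esub> s = \<zero>\<^bsub>AB\<^esub>"
      by (rule bexI[of _ "cls (- p)"]) (simp_all add: p add_cls zero_cls pre_tensor_closed)
  qed (auto elim!: tensor_cases simp: add_cls zero_cls pre_tensor_closed ac_simps)
  fix c d :: 'k and v w assume v: "v \<in> carrier AB"
  then obtain p where p: "p \<in> carrier Pre" "v = cls p" by (rule tensor_cases)
  show "c \<odot>\<^bsub>AB\<^esub> v \<in> carrier AB" "(c * d) \<odot>\<^bsub>AB\<^esub> v = c \<odot>\<^bsub>AB\<^esub> (d \<odot>\<^bsub>AB\<^esub> v)" "1 \<odot>\<^bsub>AB\<^esub> v = v"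
       "(c + d) \<odot>\<^bsub>AB\<^esub> v = c \<odot>\<^bsub>AB\<^esub> v \<oplus>\<^bsub>AB\<^esub> d \<odot>\<^bsub>AB\<^esub> v"
    using p by (simp_all add: smult_cls pre_tensor_closed add_cls Pre.smult_smult
        Pre.smult_add_left[unfolded pre_tensor_simps])
  assume "w \<in> carrier AB"
  then obtain r where r: "r \<in> carrier Pre" "w = cls r" by (rule tensor_cases)
  show "c \<odot>\<^bsub>AB\<^esub> (v \<oplus>\<^bsub>AB\<^esub> w) = c \<odot>\<^bsub>AB\<^esub> v \<oplus>\<^bsub>AB\<^esub> c \<odot>\<^bsub>AB\<^esub> w"
    using p r by (simp add: smult_cls pre_tensor_closed add_cls
        Pre.smult_add_right[unfolded pre_tensor_simps])
qed

sublocale AB: k_space AB by (rule k_space_tensor)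

lemma pure_tensor_closed [simp]:
  "a \<in> carrier A \<Longrightarrow> b \<in> carrier B \<Longrightarrow> pt a b \<in> carrier AB"
  by (simp add: pure_tensor_def pre_tensor_closed)

lemma cls_single:
  assumes "a \<in> carrier A" "b \<in> carrier B"
  shows "cls (Poly_Mapping.single (a, b) c) = c \<odot>\<^bsub>AB\<^esub> pt a b"
  using assms by (simp add: pure_tensor_def smult_cls pre_tensor_closed)

lemma bilinear_pure_tensor: "bilinear_map A B AB pt"
proof (intro bilinear_mapI linear_mapI)
  fix a a' b assume "a \<in> carrier A" "a' \<in> carrier A" "b \<in> carrier B"
  then show "pt (a \<oplus>\<^bsub>A\<^esub> a') b = pt a b \<oplus>\<^bsub>AB\<^esub> pt a' b"
    using tensor_null.add_left[of a A a' b B 1]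
    by (simp add: pure_tensor_def add_cls cls_eq_iff pre_tensor_closed algebra_simps)
next
  fix a b b' assume "a \<in> carrier A" "b \<in> carrier B" "b' \<in> carrier B"
  then show "pt a (b \<oplus>\<^bsub>B\<^esub> b') = pt a b \<oplus>\<^bsub>AB\<^esub> pt a b'"
    using tensor_null.add_right[of a A b B b' 1]
    by (simp add: pure_tensor_def add_cls cls_eq_iff pre_tensor_closed algebra_simps)
next
  fix a b c assume "a \<in> carrier A" "b \<in> carrier B"
  then show "pt (c \<odot>\<^bsub>A\<^esub> a) b = c \<odot>\<^bsub>AB\<^esub> pt a b" "pt a (c \<odot>\<^bsub>B\<^esub> b) = c \<odot>\<^bsub>AB\<^esub> pt a b"
    using tensor_null.smult_left[of a A b B c 1] tensor_null.smult_right[of a A b B c 1]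
    by (simp_all add: pure_tensor_def smult_cls cls_eq_iff pre_tensor_closed)
qed simp_all

text \<open>
  A general element is a combination of pure tensors, and a coefficient can be moved into the left
  factor; so pure tensors and sums suffice.
\<close>

lemma tensor_induct [consumes 1, case_names pure add]:
  assumes t: "t \<in> carrier AB"
    and pure: "\<And>a b. a \<in> carrier A \<Longrightarrow> b \<in> carrier B \<Longrightarrow> P (pt a b)"
    and add: "\<And>s t. s \<in> carrier AB \<Longrightarrow> t \<in> carrier AB \<Longrightarrow> P s \<Longrightarrow> P t \<Longrightarrow> P (s \<oplus>\<^bsub>AB\<^esub> t)"
  shows "P t"
proof -
  have scaled: "P (cls (Poly_Mapping.single (a, b) c))" if "a \<in> carrier A" "b \<in> carrier B" for a b c
    using that pure[of "c \<odot>\<^bsub>A\<^esub> a" b] linear_map_smult[OF bilinear_map_left[OF bilinear_pure_tensor]]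
    by (simp add: cls_single)
  have zero: "P (cls 0)"
    using scaled[OF A.zero_closed B.zero_closed, of 0] by simp
  have "(\<Sum>u\<in>S. Poly_Mapping.single u (c u)) \<in> carrier Pre \<and>
      P (cls (\<Sum>u\<in>S. Poly_Mapping.single u (c u)))"
    if "finite S" "S \<subseteq> carrier A \<times> carrier B" for S c
    using that
  proof (induction S)
    case (insert u S)
    then show ?case
      using scaled[of "fst u" "snd u" "c u"] add
      by (auto simp: pre_tensor_closed simp flip: add_cls)
  qed (simp add: zero pre_tensor_closed)
  moreover from t obtain p where p: "p \<in> carrier Pre" "t = cls p" by (rule tensor_cases)
  moreover have "Poly_Mapping.keys p \<subseteq> carrier A \<times> carrier B"
    using p(1) by (simp add: pre_tensor_def)
  ultimately show ?thesis
    using finite_keys[of p] poly_mapping_sum_single[of p] by metis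
qed

lemma linear_map_tensor_eqI:
  assumes "linear_map AB C f" "linear_map AB C h"
    "\<And>a b. a \<in> carrier A \<Longrightarrow> b \<in> carrier B \<Longrightarrow> f (pt a b) = h (pt a b)" "t \<in> carrier AB"
  shows "f t = h t"
  using assms(4)
  by (induction rule: tensor_induct)
     (simp_all add: assms(3) linear_map_add[OF assms(1)] linear_map_add[OF assms(2)])

text \<open>
  The universal property: the linear extension of a bilinear map vanishes on \<open>tensor_null\<close>, so all
  representatives of a coset have the same value and \<open>tensor_lift\<close> picks it.
\<close>

context
  fixes C :: "('k, 'c, 'p) module_scheme" and f :: "'a \<Rightarrow> 'b \<Rightarrow> 'c"
  assumes C: "k_space C" and f: "bilinear_map A B C f"
begin

interpretation C: k_space C by (rule C)

abbreviation "ev \<equiv> linear_extension C (\<lambda>u. f (fst u) (snd u))"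

lemma f_closed: "p \<in> carrier Pre \<Longrightarrow> u \<in> Poly_Mapping.keys p \<Longrightarrow> f (fst u) (snd u) \<in> carrier C"
  using bilinear_map_closed[OF f] by (auto simp: pre_tensor_def)

lemma ev_closed: "p \<in> carrier Pre \<Longrightarrow> ev p \<in> carrier C"
  by (intro C.linear_extension_closed f_closed)

lemma ev_add: "p \<in> carrier Pre \<Longrightarrow> r \<in> carrier Pre \<Longrightarrow> ev (p + r) = ev p \<oplus>\<^bsub>C\<^esub> ev r"
  by (intro C.linear_extension_add) (auto intro: f_closed)

lemma ev_single:
  "a \<in> carrier A \<Longrightarrow> b \<in> carrier B \<Longrightarrow> ev (Poly_Mapping.single (a, b) c) = c \<odot>\<^bsub>C\<^esub> f a b"
  using C.linear_extension_single[of "\<lambda>u. f (fst u) (snd u)" "(a, b)"] bilinear_map_closed[OF f] by simp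

lemma ev_smult: "p \<in> carrier Pre \<Longrightarrow> ev (c \<odot>\<^bsub>Pre\<^esub> p) = c \<odot>\<^bsub>C\<^esub> ev p"
  by (intro C.linear_extension_smult) (auto intro: f_closed)

lemma ev_diff_eq:
  assumes "p \<in> carrier Pre" "r \<in> carrier Pre"
  shows "ev (p - r) = ev p \<ominus>\<^bsub>C\<^esub> ev r"
  using ev_add[of "p - r" r] assms ev_closed C.add.inv_solve_right[of "ev (p - r)" "ev p" "ev r"]
  by (simp add: pre_tensor_closed a_minus_def)

lemma ev_null: "p \<in> Null \<Longrightarrow> ev p = \<zero>\<^bsub>C\<^esub>"
proof (induction rule: tensor_null.induct)
  case (diff p r)
  then show ?case by (simp add: ev_diff_eq null_sub a_minus_def)
next
  case (add_left a a' b c)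
  then show ?case
    using bilinear_map_closed[OF f]
    by (simp add: ev_diff_eq pre_tensor_closed ev_single linear_map_add[OF bilinear_map_left[OF f]]
        C.smult_add_right C.add_minus_minus)
next
  case (add_right a b b' c)
  then show ?case
    using bilinear_map_closed[OF f]
    by (simp add: ev_diff_eq pre_tensor_closed ev_single linear_map_add[OF bilinear_map_right[OF f]]
        C.smult_add_right C.add_minus_minus)
next
  case (smult_left a b d c)
  then show ?case
    using bilinear_map_closed[OF f]
    by (simp add: ev_diff_eq pre_tensor_closed ev_single linear_map_smult[OF bilinear_map_left[OF f]]
        C.smult_smult a_minus_def C.r_neg)
next
  case (smult_right a b d c)
  then show ?case
    using bilinear_map_closed[OF f]
    by (simp add: ev_diff_eq pre_tensor_closed ev_single linear_map_smult[OF bilinear_map_right[OF f]]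
        C.smult_smult a_minus_def C.r_neg)
qed simp

lemma tensor_lift_cls:
  assumes p: "p \<in> carrier Pre"
  shows "tensor_lift C f (cls p) = ev p"
proof -
  have "ev r = ev p" if "r \<in> cls p" for r
    using mem_clsD[OF that p] ev_null[of "r - p"] ev_closed p ev_add[of "r - p" p]
    by (simp add: pre_tensor_closed)
  moreover have "p \<in> cls p" using p Null.a_rcos_self by blast
  ultimately have "ev ` cls p = {ev p}"
    by blast
  then show ?thesis
    by (simp add: tensor_lift_def linear_extension_def)
qed

lemma tensor_lift_pure:
  assumes "a \<in> carrier A" "b \<in> carrier B"
  shows "tensor_lift C f (pt a b) = f a b"
  using assms ev_single[OF assms, of 1] bilinear_map_closed[OF f assms]
  by (simp add: pure_tensor_def tensor_lift_cls pre_tensor_closed)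

lemma tensor_lift_linear: "linear_map AB C (tensor_lift C f)"
  by (rule linear_mapI; (elim tensor_cases)?)
     (simp_all add: tensor_lift_cls ev_closed add_cls smult_cls ev_add ev_smult pre_tensor_closed)

end

end

lemma pre_tensor_mult:
  "p \<otimes>\<^bsub>pre_tensor A B\<^esub> r = (\<Sum>u\<in>Poly_Mapping.keys p. \<Sum>v\<in>Poly_Mapping.keys r.
     Poly_Mapping.single (fst u \<otimes>\<^bsub>A\<^esub> fst v, snd u \<otimes>\<^bsub>B\<^esub> snd v)
       (Poly_Mapping.lookup p u * Poly_Mapping.lookup r v))"
  by (simp add: pre_tensor_def)

lemma pre_tensor_mult_add_left:
  fixes p :: "('a \<times> 'b) \<Rightarrow>\<^sub>0 'k :: field"
  shows "(p + p') \<otimes>\<^bsub>pre_tensor A B\<^esub> r = p \<otimes>\<^bsub>pre_tensor A B\<^esub> r + p' \<otimes>\<^bsub>pre_tensor A B\<^esub> r"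
  unfolding pre_tensor_mult
  by (rule setsum_keys_plus_distrib) (simp_all add: single_add distrib_right sum.distrib)

lemma pre_tensor_mult_commute_sums:
  "p \<otimes>\<^bsub>pre_tensor A B\<^esub> r = (\<Sum>v\<in>Poly_Mapping.keys r. \<Sum>u\<in>Poly_Mapping.keys p.
     Poly_Mapping.single (fst u \<otimes>\<^bsub>A\<^esub> fst v, snd u \<otimes>\<^bsub>B\<^esub> snd v)
       (Poly_Mapping.lookup r v * Poly_Mapping.lookup p u))"
  unfolding pre_tensor_mult
  by (subst sum.swap) (intro sum.cong refl arg_cong2[where f = Poly_Mapping.single] mult.commute)

lemma pre_tensor_mult_add_right:
  fixes p :: "('a \<times> 'b) \<Rightarrow>\<^sub>0 'k :: field"
  shows "p \<otimes>\<^bsub>pre_tensor A B\<^esub> (r + r') = p \<otimes>\<^bsub>pre_tensor A B\<^esub> r + p \<otimes>\<^bsub>pre_tensor A B\<^esub> r'"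
  unfolding pre_tensor_mult_commute_sums
  by (rule setsum_keys_plus_distrib) (simp_all add: single_add distrib_right sum.distrib)

lemma pre_tensor_mult_diff_left:
  fixes p :: "('a \<times> 'b) \<Rightarrow>\<^sub>0 'k :: field"
  shows "(p - p') \<otimes>\<^bsub>pre_tensor A B\<^esub> r = p \<otimes>\<^bsub>pre_tensor A B\<^esub> r - p' \<otimes>\<^bsub>pre_tensor A B\<^esub> r"
  using pre_tensor_mult_add_left[where p = "p - p'" and p' = p' and r = r and A = A and B = B] by simp

lemma pre_tensor_mult_diff_right:
  fixes p :: "('a \<times> 'b) \<Rightarrow>\<^sub>0 'k :: field"
  shows "p \<otimes>\<^bsub>pre_tensor A B\<^esub> (r - r') = p \<otimes>\<^bsub>pre_tensor A B\<^esub> r - p \<otimes>\<^bsub>pre_tensor A B\<^esub> r'"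
  using pre_tensor_mult_add_right[where r = "r - r'" and r' = r' and p = p and A = A and B = B] by simp

lemma pre_tensor_mult_single_left:
  "Poly_Mapping.single (a, b) c \<otimes>\<^bsub>pre_tensor A B\<^esub> r = (\<Sum>v\<in>Poly_Mapping.keys r.
     Poly_Mapping.single (a \<otimes>\<^bsub>A\<^esub> fst v, b \<otimes>\<^bsub>B\<^esub> snd v) (c * Poly_Mapping.lookup r v))"
  by (simp add: pre_tensor_mult)

locale algebra_factors = A: k_algebra A + B: k_algebra B
  for A :: "('k::field, 'a, 'm) module_scheme" and B :: "('k, 'b, 'n) module_scheme"

sublocale algebra_factors \<subseteq> tensor_factors A B ..

context algebra_factors
begin

lemma keys_in_carrier: "p \<in> carrier Pre \<Longrightarrow> u \<in> Poly_Mapping.keys p \<Longrightarrow> fst u \<in> carrier A \<and> snd u \<in> carrier B"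
  by (auto simp: pre_tensor_def)

lemma pre_tensor_sum_closed: "(\<And>i. i \<in> I \<Longrightarrow> f i \<in> carrier Pre) \<Longrightarrow> sum f I \<in> carrier Pre"
  by (induction I rule: infinite_finite_induct) (simp_all add: pre_tensor_closed)

lemma pre_tensor_mult_closed:
  assumes "p \<in> carrier Pre" "r \<in> carrier Pre"
  shows "p \<otimes>\<^bsub>Pre\<^esub> r \<in> carrier Pre"
  unfolding pre_tensor_mult using keys_in_carrier[OF assms(1)] keys_in_carrier[OF assms(2)]
  by (intro pre_tensor_sum_closed pre_tensor_closed) auto

text \<open>
  Applying linear maps to the two factors preserves the bilinearity relations. With multiplication by
  fixed elements as these maps, this makes \<open>tensor_null\<close> a two-sided ideal.
\<close>

lemma null_map:
  assumes u: "linear_map A A u" and v: "linear_map B B v" and p: "p \<in> Null"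
  shows "(\<Sum>w\<in>Poly_Mapping.keys p.
    Poly_Mapping.single (u (fst w), v (snd w)) (d * Poly_Mapping.lookup p w)) \<in> Null" (is "?S p \<in> _")
proof -
  have add: "?S (p + r) = ?S p + ?S r" for p r
    by (rule setsum_keys_plus_distrib) (simp_all add: single_add distrib_left)
  have S_diff: "?S (p - r) = ?S p - ?S r" for p r
    using add[of "p - r" r] by simp
  have S_single: "?S (Poly_Mapping.single w s) = Poly_Mapping.single (u (fst w), v (snd w)) (d * s)" for w s
    by (cases "s = 0") simp_all
  note S = S_diff S_single fst_conv snd_conv
  note cl = linear_map_closed[OF u] linear_map_closed[OF v]
  show ?thesis
    using p
  proof (induction rule: tensor_null.induct)
    case (diff p r)
    show ?case unfolding S_diff by (rule tensor_null.diff[OF diff(3,4)])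
  next
    case (add_left a a' b s)
    then show ?case unfolding S
      by (simp add: linear_map_add[OF u] tensor_null.add_left cl)
  next
    case (add_right a b b' s)
    then show ?case unfolding S
      by (simp add: linear_map_add[OF v] tensor_null.add_right cl)
  next
    case (smult_left a b r s)
    then show ?case unfolding S
      by (simp add: linear_map_smult[OF u] tensor_null.smult_left cl mult.assoc[symmetric])
  next
    case (smult_right a b r s)
    then show ?case unfolding S
      by (simp add: linear_map_smult[OF v] tensor_null.smult_right cl mult.assoc[symmetric])
  qed (simp add: tensor_null.zero)
qed

lemma null_mult_left:
  assumes "r \<in> carrier Pre" "p \<in> Null"
  shows "p \<otimes>\<^bsub>Pre\<^esub> r \<in> Null"
  unfolding pre_tensor_mult_commute_sums
  by (rule null_sum)
     (use null_map[OF bilinear_map_left[OF A.bilinear_mult] bilinear_map_left[OF B.bilinear_mult] assms(2)]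
        keys_in_carrier[OF assms(1)] in simp)

lemma null_mult_right:
  assumes "r \<in> carrier Pre" "p \<in> Null"
  shows "r \<otimes>\<^bsub>Pre\<^esub> p \<in> Null"
  unfolding pre_tensor_mult
  by (rule null_sum)
     (use null_map[OF bilinear_map_right[OF A.bilinear_mult] bilinear_map_right[OF B.bilinear_mult] assms(2)]
        keys_in_carrier[OF assms(1)] in simp)

lemma mult_cls:
  assumes p: "p \<in> carrier Pre" and r: "r \<in> carrier Pre"
  shows "cls p \<otimes>\<^bsub>AB\<^esub> cls r = cls (p \<otimes>\<^bsub>Pre\<^esub> r)"
proof -
  have "cls (p' \<otimes>\<^bsub>Pre\<^esub> r') = cls (p \<otimes>\<^bsub>Pre\<^esub> r)" if "p' \<in> cls p" "r' \<in> cls r" for p' r'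
  proof -
    have "p' \<otimes>\<^bsub>Pre\<^esub> r' - p \<otimes>\<^bsub>Pre\<^esub> r = (p' - p) \<otimes>\<^bsub>Pre\<^esub> r' + p \<otimes>\<^bsub>Pre\<^esub> (r' - r)"
      by (simp add: pre_tensor_mult_diff_left pre_tensor_mult_diff_right)
    then show ?thesis
      using mem_clsD[OF that(1) p] mem_clsD[OF that(2) r] p r
      by (simp add: cls_eq_iff pre_tensor_mult_closed null_add null_mult_left null_mult_right)
  qed
  moreover have "p \<in> cls p" "r \<in> cls r"
    using p r Null.a_rcos_self by blast+
  ultimately have "(\<Union>p'\<in>cls p. \<Union>r'\<in>cls r. cls (p' \<otimes>\<^bsub>Pre\<^esub> r')) = cls (p \<otimes>\<^bsub>Pre\<^esub> r)"
    by blast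
  then show ?thesis
    by (simp add: tensor_def ring.extend_def module.fields_def FactRing_def rcoset_mult_def)
qed

lemma mult_pure:
  assumes "a \<in> carrier A" "b \<in> carrier B" "a' \<in> carrier A" "b' \<in> carrier B"
  shows "pt a b \<otimes>\<^bsub>AB\<^esub> pt a' b' = pt (a \<otimes>\<^bsub>A\<^esub> a') (b \<otimes>\<^bsub>B\<^esub> b')"
  using assms
  by (simp add: pure_tensor_def mult_cls pre_tensor_closed pre_tensor_mult_single_left)

lemma tensor_mult_closed: "s \<in> carrier AB \<Longrightarrow> t \<in> carrier AB \<Longrightarrow> s \<otimes>\<^bsub>AB\<^esub> t \<in> carrier AB"
  by (elim tensor_cases) (simp add: mult_cls pre_tensor_mult_closed)

lemma tensor_add_mult:
  "s \<in> carrier AB \<Longrightarrow> s' \<in> carrier AB \<Longrightarrow> t \<in> carrier AB \<Longrightarrow>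
     (s \<oplus>\<^bsub>AB\<^esub> s') \<otimes>\<^bsub>AB\<^esub> t = s \<otimes>\<^bsub>AB\<^esub> t \<oplus>\<^bsub>AB\<^esub> s' \<otimes>\<^bsub>AB\<^esub> t"
  by (elim tensor_cases)
     (simp add: mult_cls pre_tensor_mult_closed add_cls pre_tensor_closed pre_tensor_mult_add_left)

lemma tensor_mult_add:
  "s \<in> carrier AB \<Longrightarrow> t \<in> carrier AB \<Longrightarrow> t' \<in> carrier AB \<Longrightarrow>
     s \<otimes>\<^bsub>AB\<^esub> (t \<oplus>\<^bsub>AB\<^esub> t') = s \<otimes>\<^bsub>AB\<^esub> t \<oplus>\<^bsub>AB\<^esub> s \<otimes>\<^bsub>AB\<^esub> t'"
  by (elim tensor_cases)
     (simp add: mult_cls pre_tensor_mult_closed add_cls pre_tensor_closed pre_tensor_mult_add_right)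

lemma smult_pure_left: "a \<in> carrier A \<Longrightarrow> b \<in> carrier B \<Longrightarrow> c \<odot>\<^bsub>AB\<^esub> pt a b = pt (c \<odot>\<^bsub>A\<^esub> a) b"
  using linear_map_smult[OF bilinear_map_left[OF bilinear_pure_tensor]] by simp

lemma tensor_smult_mult:
  assumes "s \<in> carrier AB" "t \<in> carrier AB"
  shows "(c \<odot>\<^bsub>AB\<^esub> s) \<otimes>\<^bsub>AB\<^esub> t = c \<odot>\<^bsub>AB\<^esub> (s \<otimes>\<^bsub>AB\<^esub> t)"
    and "s \<otimes>\<^bsub>AB\<^esub> (c \<odot>\<^bsub>AB\<^esub> t) = c \<odot>\<^bsub>AB\<^esub> (s \<otimes>\<^bsub>AB\<^esub> t)"
proof -
  have "(c \<odot>\<^bsub>AB\<^esub> s) \<otimes>\<^bsub>AB\<^esub> t = c \<odot>\<^bsub>AB\<^esub> (s \<otimes>\<^bsub>AB\<^esub> t) \<and> s \<otimes>\<^bsub>AB\<^esub> (c \<odot>\<^bsub>AB\<^esub> t) = c \<odot>\<^bsub>AB\<^esub> (s \<otimes>\<^bsub>AB\<^esub> t)"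
    using assms
  proof (induction s rule: tensor_induct)
    case (pure a b)
    from pure(3,1,2) show ?case
    proof (induction t rule: tensor_induct)
      case (pure a' b')
      then show ?case
        by (simp add: smult_pure_left mult_pure A.smult_mult_left A.smult_mult_right)
    next
      case (add t t')
      then show ?case
        by (simp add: tensor_mult_add AB.smult_add_right tensor_mult_closed)
    qed
  next
    case (add s s')
    then show ?case
      by (simp add: tensor_add_mult AB.smult_add_right tensor_mult_closed)
  qed
  then show "(c \<odot>\<^bsub>AB\<^esub> s) \<otimes>\<^bsub>AB\<^esub> t = c \<odot>\<^bsub>AB\<^esub> (s \<otimes>\<^bsub>AB\<^esub> t)"
    and "s \<otimes>\<^bsub>AB\<^esub> (c \<odot>\<^bsub>AB\<^esub> t) = c \<odot>\<^bsub>AB\<^esub> (s \<otimes>\<^bsub>AB\<^esub> t)"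
    by blast+
qed

lemma bilinear_tensor_mult: "bilinear_map AB AB AB (\<lambda>s t. s \<otimes>\<^bsub>AB\<^esub> t)"
  by (intro bilinear_mapI linear_mapI)
     (simp_all add: tensor_mult_closed tensor_mult_add tensor_add_mult tensor_smult_mult)


end

section \<open>Comodule algebras in coordinates\<close>

lemma tensor_factorsI [intro]: "k_space A \<Longrightarrow> k_space B \<Longrightarrow> tensor_factors A B"
  by (rule tensor_factors.intro)

text \<open>
  A parameter of the bilinear map passes linearly through \<open>tensor_lift\<close>. Nested Sweedler sums are
  multilinear for this reason.
\<close>

lemma (in tensor_factors) tensor_lift_param:
  assumes C: "k_space C"
    and f: "\<And>l. l \<in> carrier D \<Longrightarrow> bilinear_map A B C (f l)"
    and lin: "\<And>a b. a \<in> carrier A \<Longrightarrow> b \<in> carrier B \<Longrightarrow> linear_map D C (\<lambda>l. f l a b)"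
    and t: "t \<in> carrier AB" and D: "k_space D"
  shows "linear_map D C (\<lambda>l. tensor_lift C (f l) t)"
  using t
proof (induction rule: tensor_induct)
  case (pure a b)
  show ?case
    by (rule linear_map_cong[OF lin[OF pure]]) (simp_all add: tensor_lift_pure[OF C f] pure D)
next
  case (add s t)
  show ?case
    by (rule linear_map_cong[OF linear_map_plus[OF C add(3,4)]])
       (simp_all add: linear_map_add[OF tensor_lift_linear[OF C f]] add D)
qed

lemma (in abelian_monoid) finsum_cartesian:
  assumes "finite I" "finite J" "\<And>i j. i \<in> I \<Longrightarrow> j \<in> J \<Longrightarrow> f i j \<in> carrier G"
  shows "(\<Oplus>i\<in>I. \<Oplus>j\<in>J. f i j) = (\<Oplus>w\<in>I \<times> J. f (fst w) (snd w))"
  using assms(1,3)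
proof (induction I rule: finite_induct)
  case (insert i I)
  have "insert i I \<times> J = Pair i ` J \<union> I \<times> J" by auto
  moreover have "(\<Oplus>w\<in>Pair i ` J. f (fst w) (snd w)) = (\<Oplus>j\<in>J. f i j)"
    using insert assms(2) by (subst finsum_reindex) (auto simp: inj_on_def)
  moreover have "(\<Oplus>w\<in>Pair i ` J \<union> I \<times> J. f (fst w) (snd w)) =
      (\<Oplus>w\<in>Pair i ` J. f (fst w) (snd w)) \<oplus> (\<Oplus>w\<in>I \<times> J. f (fst w) (snd w))"
    using insert assms(2) by (intro finsum_Un_disjoint) auto
  ultimately show ?case
    using insert by (simp add: Pi_def finsum_closed)
qed simp

lemma bilinear_map_finsum:
  assumes "k_space A" "k_space B" "k_space C" "bilinear_map A B C f" "finite I" "finite J"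
    "\<And>i. i \<in> I \<Longrightarrow> a i \<in> carrier A" "\<And>j. j \<in> J \<Longrightarrow> b j \<in> carrier B"
  shows "f (finsum A a I) (finsum B b J) = finsum C (\<lambda>w. f (a (fst w)) (b (snd w))) (I \<times> J)"
proof -
  interpret A: k_space A by fact
  interpret B: k_space B by fact
  interpret C: k_space C by fact
  note cl = bilinear_map_closed[OF assms(4)]
  have "f (finsum A a I) (finsum B b J) = finsum C (\<lambda>i. f (a i) (finsum B b J)) I"
    using assms(7,8)
    by (intro linear_map_finsum[OF assms(1,3) bilinear_map_left[OF assms(4)]]) auto
  also have "\<dots> = finsum C (\<lambda>i. finsum C (\<lambda>j. f (a i) (b j)) J) I"
    using assms(7,8) cl
    by (intro C.finsum_cong' linear_map_finsum[OF assms(2,3) bilinear_map_right[OF assms(4)]]) auto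
  also have "\<dots> = finsum C (\<lambda>w. f (a (fst w)) (b (snd w))) (I \<times> J)"
    using assms(5-8) cl by (intro C.finsum_cartesian) auto
  finally show ?thesis .
qed

lemma (in k_space) bilinear_functional_right:
  "k_space D \<Longrightarrow> linear_map D scalar_algebra f \<Longrightarrow> bilinear_map M D M (\<lambda>v l. f l \<odot> v)"
  by (intro bilinear_mapI linear_map_scale linear_map_id linear_map_scale_vector k_space_axioms)

lemma (in k_space) bilinear_functional_left:
  "k_space D \<Longrightarrow> linear_map D scalar_algebra f \<Longrightarrow> bilinear_map D M M (\<lambda>l v. f l \<odot> v)"
  by (intro bilinear_mapI linear_map_scale linear_map_id linear_map_scale_vector k_space_axioms)

locale finite_basis = k_space L
  for L :: "('k::field, 'l, 'n) module_scheme" (structure) +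
  fixes I :: "'i set" and e :: "'i \<Rightarrow> 'l" and c :: "'i \<Rightarrow> 'l \<Rightarrow> 'k"
  assumes finite_index [simp]: "finite I"
    and e_closed [simp]: "i \<in> I \<Longrightarrow> e i \<in> carrier L"
    and coord_linear: "i \<in> I \<Longrightarrow> linear_map L scalar_algebra (c i)"
    and coord_e: "i \<in> I \<Longrightarrow> j \<in> I \<Longrightarrow> c i (e j) = (if i = j then 1 else 0)"
    and expansion: "a \<in> carrier L \<Longrightarrow> (\<Oplus>i\<in>I. c i a \<odot> e i) = a"
begin

lemma coord_finsum: "i \<in> I \<Longrightarrow> f \<in> J \<rightarrow> carrier L \<Longrightarrow> c i (finsum L f J) = (\<Sum>j\<in>J. c i (f j))"
  using linear_map_finsum[OF k_space_axioms k_space_scalar_algebra coord_linear] by simp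

lemma coord_smult: "i \<in> I \<Longrightarrow> a \<in> carrier L \<Longrightarrow> c i (r \<odot> a) = r * c i a"
  using linear_map_smult[OF coord_linear] by simp

lemma functional_expansion:
  assumes f: "linear_map L scalar_algebra f" and a: "a \<in> carrier L"
  shows "(\<Sum>i\<in>I. c i a * f (e i)) = f a"
proof -
  have "f a = f (\<Oplus>i\<in>I. c i a \<odot> e i)" using a by (simp add: expansion)
  also have "\<dots> = (\<Sum>i\<in>I. f (c i a \<odot> e i))"
    by (subst linear_map_finsum[OF k_space_axioms k_space_scalar_algebra f]) auto
  also have "\<dots> = (\<Sum>i\<in>I. c i a * f (e i))"
    by (intro sum.cong) (simp_all add: linear_map_smult[OF f])
  finally show ?thesis ..
qed

lemma coord_eqI:
  assumes "a \<in> carrier L" "b \<in> carrier L" "\<And>i. i \<in> I \<Longrightarrow> c i a = c i b"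
  shows "a = b"
proof -
  have "a = (\<Oplus>i\<in>I. c i a \<odot> e i)" using assms(1) by (simp add: expansion)
  also have "\<dots> = (\<Oplus>i\<in>I. c i b \<odot> e i)" using assms(3) by (intro finsum_cong') auto
  also have "\<dots> = b" using assms(2) by (simp add: expansion)
  finally show ?thesis .
qed

lemma coord_expansion:
  assumes "i \<in> I" shows "c i (\<Oplus>j\<in>I. r j \<odot> e j) = r i"
proof -
  have "c i (\<Oplus>j\<in>I. r j \<odot> e j) = (\<Sum>j\<in>I. r j * c i (e j))"
    using assms by (simp add: coord_finsum coord_smult)
  also have "\<dots> = r i"
    using assms by (simp add: coord_e if_distrib cong: if_cong)
  finally show ?thesis .
qed

end

text \<open>
  \<open>slice H f\<close> is the map \<open>id \<otimes> f\<close> followed by the identification of \<open>H \<otimes> k\<close> with \<open>H\<close>. Applied to a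
  coaction and the coordinate functionals of a basis it yields the matrix coefficients.
\<close>

definition slice :: "('k::field, 'h, 'm) module_scheme \<Rightarrow> ('l \<Rightarrow> 'k) \<Rightarrow> ('k, 'h, 'l) tensor \<Rightarrow> 'h" where
  "slice H f = tensor_lift H (\<lambda>h l. f l \<odot>\<^bsub>H\<^esub> h)"

locale based_tensor = H: k_space H + L: finite_basis L I e c
  for H :: "('k::field, 'h, 'm) module_scheme" and L :: "('k, 'l, 'n) module_scheme" and I e c
begin

sublocale HL: tensor_factors H L
  by (intro tensor_factorsI H.k_space_axioms L.k_space_axioms)

lemma slice_linear: "i \<in> I \<Longrightarrow> linear_map (tensor H L) H (slice H (c i))"
  unfolding slice_def
  by (intro HL.tensor_lift_linear H.bilinear_functional_right L.coord_linear H.k_space_axioms L.k_space_axioms)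

lemma slice_pure: "i \<in> I \<Longrightarrow> h \<in> carrier H \<Longrightarrow> l \<in> carrier L \<Longrightarrow>
    slice H (c i) (pure_tensor H L h l) = c i l \<odot>\<^bsub>H\<^esub> h"
  unfolding slice_def
  by (rule HL.tensor_lift_pure[OF H.k_space_axioms H.bilinear_functional_right])
     (auto intro: L.coord_linear L.k_space_axioms)

lemma slice_expansion:
  assumes "t \<in> carrier (tensor H L)"
  shows "t = (\<Oplus>\<^bsub>tensor H L\<^esub>i\<in>I. pure_tensor H L (slice H (c i) t) (e i))"
proof -
  have sl: "linear_map (tensor H L) (tensor H L) (\<lambda>t. pure_tensor H L (slice H (c i) t) (e i))" if "i \<in> I" for i
    using that by (intro linear_map_comp[OF slice_linear] bilinear_map_left[OF HL.bilinear_pure_tensor]) auto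
  show ?thesis
  proof (rule HL.linear_map_tensor_eqI[OF linear_map_id _ _ assms])
    show "linear_map (tensor H L) (tensor H L)
        (\<lambda>t. \<Oplus>\<^bsub>tensor H L\<^esub>i\<in>I. pure_tensor H L (slice H (c i) t) (e i))"
      by (intro linear_map_sum HL.k_space_tensor sl)
    fix h l assume hl: "h \<in> carrier H" "l \<in> carrier L"
    have "pure_tensor H L h l = pure_tensor H L h (\<Oplus>\<^bsub>L\<^esub>i\<in>I. c i l \<odot>\<^bsub>L\<^esub> e i)"
      using hl by (simp add: L.expansion)
    also have "\<dots> = (\<Oplus>\<^bsub>tensor H L\<^esub>i\<in>I. pure_tensor H L h (c i l \<odot>\<^bsub>L\<^esub> e i))"
      using hl
      by (intro linear_map_finsum[OF L.k_space_axioms HL.k_space_tensor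
            bilinear_map_right[OF HL.bilinear_pure_tensor]]) auto
    also have "\<dots> = (\<Oplus>\<^bsub>tensor H L\<^esub>i\<in>I. pure_tensor H L (slice H (c i) (pure_tensor H L h l)) (e i))"
      using hl
      by (intro HL.AB.finsum_cong')
         (auto simp: slice_pure linear_map_smult[OF bilinear_map_right[OF HL.bilinear_pure_tensor]]
            linear_map_smult[OF bilinear_map_left[OF HL.bilinear_pure_tensor]])
    finally show "pure_tensor H L h l = \<dots>" .
  qed
qed

lemma tensor_lift_expansion:
  assumes "k_space C" "bilinear_map H L C f" "\<And>i. i \<in> I \<Longrightarrow> h i \<in> carrier H"
    "t = (\<Oplus>\<^bsub>tensor H L\<^esub>i\<in>I. pure_tensor H L (h i) (e i))"
  shows "tensor_lift C f t = (\<Oplus>\<^bsub>C\<^esub>i\<in>I. f (h i) (e i))"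
proof -
  interpret C: k_space C by fact
  have "tensor_lift C f t = (\<Oplus>\<^bsub>C\<^esub>i\<in>I. tensor_lift C f (pure_tensor H L (h i) (e i)))"
    unfolding assms(4) using assms(3)
    by (intro linear_map_finsum[OF HL.k_space_tensor assms(1) HL.tensor_lift_linear[OF assms(1,2)]]) auto
  also have "\<dots> = (\<Oplus>\<^bsub>C\<^esub>i\<in>I. f (h i) (e i))"
    using assms(3) bilinear_map_closed[OF assms(2)]
    by (intro C.finsum_cong') (auto simp: HL.tensor_lift_pure[OF assms(1,2)])
  finally show ?thesis .
qed

end

lemma bialgebraD:
  assumes "is_bialgebra H"
  shows "k_algebra H" "linear_map H (tensor H H) (comult H)" "linear_map H scalar_algebra (counit H)"
    "left_comodule H H (comult H)"
  using assms by (auto simp: is_bialgebra_def left_comodule_def alg_hom_def linear_map_def ring_hom_def)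

text \<open>
  The matrix coefficients of a comodule algebra: \<open>h i a\<close> is the coefficient of \<open>e i\<close> in the coaction of
  \<open>a\<close>. The clauses express linearity, unit, coassociativity, counit and multiplicativity.
\<close>

definition coefficient_family ::
    "('k::field, 'h, 'm) bialgebra_scheme \<Rightarrow> ('k, 'l, 'n) module_scheme \<Rightarrow> 'i set \<Rightarrow> ('i \<Rightarrow> 'l) \<Rightarrow>
     ('i \<Rightarrow> 'l \<Rightarrow> 'k) \<Rightarrow> ('i \<Rightarrow> 'l \<Rightarrow> 'h) \<Rightarrow> bool" where
  "coefficient_family H L I e c h \<longleftrightarrow>
     (\<forall>i\<in>I. linear_map L H (h i) \<and> h i \<one>\<^bsub>L\<^esub> = c i \<one>\<^bsub>L\<^esub> \<odot>\<^bsub>H\<^esub> \<one>\<^bsub>H\<^esub> \<and>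
       (\<forall>a\<in>carrier L.
          comult H (h i a) = (\<Oplus>\<^bsub>tensor H H\<^esub>j\<in>I. pure_tensor H H (h j a) (h i (e j))) \<and>
          counit H (h i a) = c i a \<and>
          (\<forall>b\<in>carrier L. h i (a \<otimes>\<^bsub>L\<^esub> b) =
             (\<Oplus>\<^bsub>H\<^esub>w\<in>I \<times> I. c i (e (fst w) \<otimes>\<^bsub>L\<^esub> e (snd w)) \<odot>\<^bsub>H\<^esub>
                (h (fst w) a \<otimes>\<^bsub>H\<^esub> h (snd w) b)))))"

locale bialg = k_algebra H
  for H :: "('k::field, 'h, 'm) bialgebra_scheme" (structure) +
  assumes bialg: "is_bialgebra H"
begin

sublocale HH: tensor_factors H H
  by (intro tensor_factorsI k_space_axioms)

lemmas comult_linear = bialgebraD(2)[OF bialg] and counit_linear = bialgebraD(3)[OF bialg]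

end

lemma bialgI: "is_bialgebra H \<Longrightarrow> bialg H"
  using bialgebraD(1)[of H] by (simp add: bialg_def bialg_axioms_def)

locale based_comodule_setup = H: bialg H + L: k_algebra L + based_tensor H L I e c
  for H :: "('k::field, 'h, 'm) bialgebra_scheme" and L :: "('k, 'l, 'n) module_scheme" and I :: "'i set" and e c
begin

sublocale HLa: algebra_factors H L ..
sublocale HHL: tensor_factors H "tensor H L"
  by (intro tensor_factorsI H.k_space_axioms HL.k_space_tensor)

abbreviation "T \<equiv> tensor H (tensor H L)"

lemma bilinear_nested: "l \<in> carrier L \<Longrightarrow>
    bilinear_map H H T (\<lambda>h1 h2. pure_tensor H (tensor H L) h1 (pure_tensor H L h2 l))"
  using bilinear_map_comp[OF HHL.bilinear_pure_tensor linear_map_id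
      bilinear_map_left[OF HL.bilinear_pure_tensor]] by simp

lemma bilinear_coassoc_left: "bilinear_map H L T (\<lambda>h l. tensor_lift T
     (\<lambda>h1 h2. pure_tensor H (tensor H L) h1 (pure_tensor H L h2 l)) (comult H h))"
proof (rule bilinear_mapI)
  fix h assume h: "h \<in> carrier H"
  show "linear_map L T (\<lambda>l. tensor_lift T
     (\<lambda>h1 h2. pure_tensor H (tensor H L) h1 (pure_tensor H L h2 l)) (comult H h))"
    by (intro H.HH.tensor_lift_param HHL.k_space_tensor bilinear_nested
        linear_map_comp[OF bilinear_map_right[OF HL.bilinear_pure_tensor] bilinear_map_right[OF HHL.bilinear_pure_tensor]]
        linear_map_closed[OF H.comult_linear h] L.k_space_axioms)
next
  fix l assume "l \<in> carrier L"
  then show "linear_map H T (\<lambda>h. tensor_lift T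
     (\<lambda>h1 h2. pure_tensor H (tensor H L) h1 (pure_tensor H L h2 l)) (comult H h))"
    by (intro linear_map_comp[OF H.comult_linear H.HH.tensor_lift_linear] HHL.k_space_tensor bilinear_nested)
qed

lemma bilinear_coassoc_right:
  "linear_map L (tensor H L) \<delta> \<Longrightarrow> bilinear_map H L T (\<lambda>h l. pure_tensor H (tensor H L) h (\<delta> l))"
  by (rule bilinear_map_comp[OF HHL.bilinear_pure_tensor linear_map_id])

lemma bilinear_counit: "bilinear_map H L L (\<lambda>h l. counit H h \<odot>\<^bsub>L\<^esub> l)"
  by (intro L.bilinear_functional_left H.counit_linear H.k_space_axioms)

lemma coassoc_left:
  assumes "\<And>i. i \<in> I \<Longrightarrow> h i \<in> carrier H"
    "t = (\<Oplus>\<^bsub>tensor H L\<^esub>i\<in>I. pure_tensor H L (h i) (e i))"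
  shows "tensor_lift T (\<lambda>h l. tensor_lift T
      (\<lambda>h1 h2. pure_tensor H (tensor H L) h1 (pure_tensor H L h2 l)) (comult H h)) t =
    (\<Oplus>\<^bsub>T\<^esub>i\<in>I. tensor_lift T
      (\<lambda>h1 h2. pure_tensor H (tensor H L) h1 (pure_tensor H L h2 (e i))) (comult H (h i)))"
  by (rule tensor_lift_expansion[OF HHL.k_space_tensor bilinear_coassoc_left assms])

text \<open>
  Slicing the innermost factor of \<open>H \<otimes> (H \<otimes> L)\<close> extracts one coefficient from a coassociativity
  equation and leaves an equation in \<open>H \<otimes> H\<close>.
\<close>

lemma slice_nested:
  assumes i: "i \<in> I" and j: "j \<in> I" and t: "t \<in> carrier (tensor H H)"
  shows "tensor_lift (tensor H H) (\<lambda>h t. pure_tensor H H h (slice H (c i) t))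
      (tensor_lift T (\<lambda>h1 h2. pure_tensor H (tensor H L) h1 (pure_tensor H L h2 (e j))) t) =
    (if i = j then t else \<zero>\<^bsub>tensor H H\<^esub>)"
proof -
  let ?\<Phi> = "tensor_lift (tensor H H) (\<lambda>h t. pure_tensor H H h (slice H (c i) t))"
  let ?N = "tensor_lift T (\<lambda>h1 h2. pure_tensor H (tensor H L) h1 (pure_tensor H L h2 (e j)))"
  have B: "bilinear_map H (tensor H L) (tensor H H) (\<lambda>h t. pure_tensor H H h (slice H (c i) t))"
    by (rule bilinear_map_comp[OF H.HH.bilinear_pure_tensor linear_map_id slice_linear[OF i]])
  have \<Phi>: "linear_map T (tensor H H) ?\<Phi>"
    by (rule HHL.tensor_lift_linear[OF H.HH.k_space_tensor B])
  have N: "linear_map (tensor H H) T ?N"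
    by (rule H.HH.tensor_lift_linear[OF HHL.k_space_tensor bilinear_nested]) (simp add: j)
  have R: "linear_map (tensor H H) (tensor H H) (\<lambda>t. if i = j then t else \<zero>\<^bsub>tensor H H\<^esub>)"
    by (cases "i = j") (simp_all add: linear_map_id linear_map_const_zero H.HH.k_space_tensor)
  show ?thesis
  proof (rule H.HH.linear_map_tensor_eqI[OF linear_map_comp[OF N \<Phi>] R _ t])
    fix a b assume ab: "a \<in> carrier H" "b \<in> carrier H"
    have "?\<Phi> (?N (pure_tensor H H a b)) =
        ?\<Phi> (pure_tensor H (tensor H L) a (pure_tensor H L b (e j)))"
      using ab j by (simp add: H.HH.tensor_lift_pure[OF HHL.k_space_tensor bilinear_nested])
    also have "\<dots> = pure_tensor H H a (slice H (c i) (pure_tensor H L b (e j)))"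
      using ab j by (simp add: HHL.tensor_lift_pure[OF H.HH.k_space_tensor B])
    also have "\<dots> = pure_tensor H H a ((if i = j then 1 else 0) \<odot>\<^bsub>H\<^esub> b)"
      using ab i j by (simp add: slice_pure L.coord_e)
    also have "\<dots> = (if i = j then pure_tensor H H a b else \<zero>\<^bsub>tensor H H\<^esub>)"
      using ab linear_map_zero[OF H.k_space_axioms H.HH.k_space_tensor
          bilinear_map_right[OF H.HH.bilinear_pure_tensor]] by simp
    finally show "?\<Phi> (?N (pure_tensor H H a b)) = \<dots>" .
  qed
qed

text \<open>
  Each coefficient identity is the corresponding axiom for the coaction with the coordinate
  functionals applied to its \<open>L\<close>-factor.
\<close>

theorem comodule_algebra_imp_coefficient_family:
  assumes com: "left_comodule_algebra H L \<delta>"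
  obtains h where "coefficient_family H L I e c h"
    and "\<And>a. a \<in> carrier L \<Longrightarrow> \<delta> a = (\<Oplus>\<^bsub>tensor H L\<^esub>i\<in>I. pure_tensor H L (h i a) (e i))"
proof -
  define h where "h = (\<lambda>i a. slice H (c i) (\<delta> a))"
  have \<delta>: "linear_map L (tensor H L) \<delta>"
    using com by (simp add: left_comodule_algebra_def left_comodule_def)
  have hl: "linear_map L H (h i)" if "i \<in> I" for i
    unfolding h_def using linear_map_comp[OF \<delta> slice_linear[OF that]] .
  note hc = linear_map_closed[OF hl]
  note dc = linear_map_closed[OF \<delta>]
  have exp: "\<delta> a = (\<Oplus>\<^bsub>tensor H L\<^esub>i\<in>I. pure_tensor H L (h i a) (e i))" if "a \<in> carrier L" for a
    unfolding h_def by (rule slice_expansion[OF dc[OF that]])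
  have one: "h i \<one>\<^bsub>L\<^esub> = c i \<one>\<^bsub>L\<^esub> \<odot>\<^bsub>H\<^esub> \<one>\<^bsub>H\<^esub>" if "i \<in> I" for i
    using com that slice_pure[OF that H.one_closed L.one_closed]
    by (simp add: left_comodule_algebra_def alg_hom_def ring_hom_def HL.one_tensor h_def)
  have counit: "counit H (h i a) = c i a" if "i \<in> I" "a \<in> carrier L" for i a
  proof -
    have "a = tensor_lift L (\<lambda>h l. counit H h \<odot>\<^bsub>L\<^esub> l) (\<delta> a)"
      using com that by (simp add: left_comodule_algebra_def left_comodule_def)
    also have "\<dots> = (\<Oplus>\<^bsub>L\<^esub>i\<in>I. counit H (h i a) \<odot>\<^bsub>L\<^esub> e i)"
      using that
      by (intro tensor_lift_expansion[OF L.k_space_axioms bilinear_counit _ exp] hc)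
    finally have "c i a = c i (\<Oplus>\<^bsub>L\<^esub>i\<in>I. counit H (h i a) \<odot>\<^bsub>L\<^esub> e i)" by simp
    then show ?thesis using that by (simp add: L.coord_expansion)
  qed
  have comult: "comult H (h i a) = (\<Oplus>\<^bsub>tensor H H\<^esub>j\<in>I. pure_tensor H H (h j a) (h i (e j)))"
    if i: "i \<in> I" and a: "a \<in> carrier L" for i a
  proof -
    let ?\<Phi> = "tensor_lift (tensor H H) (\<lambda>h t. pure_tensor H H h (slice H (c i) t))"
    have B: "bilinear_map H (tensor H L) (tensor H H) (\<lambda>h t. pure_tensor H H h (slice H (c i) t))"
      by (rule bilinear_map_comp[OF H.HH.bilinear_pure_tensor linear_map_id slice_linear[OF i]])
    have \<Phi>: "linear_map T (tensor H H) ?\<Phi>"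
      by (rule HHL.tensor_lift_linear[OF H.HH.k_space_tensor B])
    let ?N = "\<lambda>j. tensor_lift T (\<lambda>h1 h2. pure_tensor H (tensor H L) h1 (pure_tensor H L h2 (e j)))"
    have cl: "j \<in> I \<Longrightarrow> comult H (h j a) \<in> carrier (tensor H H)" for j
      using linear_map_closed[OF H.comult_linear hc] a by simp
    have Ncl: "j \<in> I \<Longrightarrow> t \<in> carrier (tensor H H) \<Longrightarrow> ?N j t \<in> carrier T" for j t
      using linear_map_closed[OF H.HH.tensor_lift_linear[OF HHL.k_space_tensor bilinear_nested]] by simp
    have "(\<Oplus>\<^bsub>T\<^esub>j\<in>I. ?N j (comult H (h j a))) =
        tensor_lift T (\<lambda>h l. tensor_lift T
          (\<lambda>h1 h2. pure_tensor H (tensor H L) h1 (pure_tensor H L h2 l)) (comult H h)) (\<delta> a)"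
      using a by (intro coassoc_left[symmetric] exp hc)
    also have "\<dots> = tensor_lift T (\<lambda>h l. pure_tensor H (tensor H L) h (\<delta> l)) (\<delta> a)"
      using com a by (simp add: left_comodule_algebra_def left_comodule_def)
    also have "\<dots> = (\<Oplus>\<^bsub>T\<^esub>j\<in>I. pure_tensor H (tensor H L) (h j a) (\<delta> (e j)))"
      using a by (intro tensor_lift_expansion[OF HHL.k_space_tensor bilinear_coassoc_right[OF \<delta>] _ exp] hc)
    finally have eq: "?\<Phi> (\<Oplus>\<^bsub>T\<^esub>j\<in>I. ?N j (comult H (h j a))) =
        ?\<Phi> (\<Oplus>\<^bsub>T\<^esub>j\<in>I. pure_tensor H (tensor H L) (h j a) (\<delta> (e j)))" by simp
    have "?\<Phi> (\<Oplus>\<^bsub>T\<^esub>j\<in>I. ?N j (comult H (h j a))) =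
        (\<Oplus>\<^bsub>tensor H H\<^esub>j\<in>I. ?\<Phi> (?N j (comult H (h j a))))"
      by (intro linear_map_finsum[OF HHL.k_space_tensor H.HH.k_space_tensor \<Phi>]) (auto intro: Ncl cl)
    also have "\<dots> = (\<Oplus>\<^bsub>tensor H H\<^esub>j\<in>I. if i = j then comult H (h j a) else \<zero>\<^bsub>tensor H H\<^esub>)"
      using cl i by (intro H.HH.AB.finsum_cong') (auto simp: slice_nested)
    also have "\<dots> = comult H (h i a)"
      using cl i by (subst H.HH.AB.finsum_singleton) auto
    also note eq
    also have "?\<Phi> (\<Oplus>\<^bsub>T\<^esub>j\<in>I. pure_tensor H (tensor H L) (h j a) (\<delta> (e j))) =
        (\<Oplus>\<^bsub>tensor H H\<^esub>j\<in>I. ?\<Phi> (pure_tensor H (tensor H L) (h j a) (\<delta> (e j))))"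
      using a by (intro linear_map_finsum[OF HHL.k_space_tensor H.HH.k_space_tensor \<Phi>])
        (auto intro!: HHL.pure_tensor_closed hc dc)
    also have "\<dots> = (\<Oplus>\<^bsub>tensor H H\<^esub>j\<in>I. pure_tensor H H (h j a) (h i (e j)))"
      using a i hc dc
      by (intro H.HH.AB.finsum_cong') (auto simp: HHL.tensor_lift_pure[OF H.HH.k_space_tensor B] h_def)
    finally show ?thesis by (rule sym)
  qed
  have mult: "h i (a \<otimes>\<^bsub>L\<^esub> b) = (\<Oplus>\<^bsub>H\<^esub>w\<in>I \<times> I. c i (e (fst w) \<otimes>\<^bsub>L\<^esub> e (snd w)) \<odot>\<^bsub>H\<^esub>
                (h (fst w) a \<otimes>\<^bsub>H\<^esub> h (snd w) b))"
    if i: "i \<in> I" and a: "a \<in> carrier L" and b: "b \<in> carrier L" for i a b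
  proof -
    let ?HL = "tensor H L"
    let ?p = "\<lambda>w. pure_tensor H L (h (fst w) a \<otimes>\<^bsub>H\<^esub> h (snd w) b) (e (fst w) \<otimes>\<^bsub>L\<^esub> e (snd w))"
    have "\<delta> (a \<otimes>\<^bsub>L\<^esub> b) = \<delta> a \<otimes>\<^bsub>?HL\<^esub> \<delta> b"
      using com a b by (simp add: left_comodule_algebra_def alg_hom_def ring_hom_def)
    also have "\<dots> = (\<Oplus>\<^bsub>?HL\<^esub>i\<in>I. pure_tensor H L (h i a) (e i)) \<otimes>\<^bsub>?HL\<^esub>
        (\<Oplus>\<^bsub>?HL\<^esub>i\<in>I. pure_tensor H L (h i b) (e i))"
      using a b by (simp add: exp[symmetric])
    also have "\<dots> = (\<Oplus>\<^bsub>?HL\<^esub>w\<in>I \<times> I. pure_tensor H L (h (fst w) a) (e (fst w)) \<otimes>\<^bsub>?HL\<^esub>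
        pure_tensor H L (h (snd w) b) (e (snd w)))"
      using a b by (intro bilinear_map_finsum[OF _ _ _ HLa.bilinear_tensor_mult] HL.k_space_tensor) (auto simp: hc)
    also have "\<dots> = (\<Oplus>\<^bsub>?HL\<^esub>w\<in>I \<times> I. ?p w)"
      using a b by (intro HL.AB.finsum_cong') (auto simp: HLa.mult_pure hc)
    finally have "h i (a \<otimes>\<^bsub>L\<^esub> b) = slice H (c i) (\<Oplus>\<^bsub>?HL\<^esub>w\<in>I \<times> I. ?p w)"
      by (simp add: h_def)
    also have "\<dots> = (\<Oplus>\<^bsub>H\<^esub>w\<in>I \<times> I. slice H (c i) (?p w))"
      using a b by (intro linear_map_finsum[OF HL.k_space_tensor H.k_space_axioms slice_linear[OF i]]) (auto simp: hc)
    also have "\<dots> = (\<Oplus>\<^bsub>H\<^esub>w\<in>I \<times> I. c i (e (fst w) \<otimes>\<^bsub>L\<^esub> e (snd w)) \<odot>\<^bsub>H\<^esub>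
                (h (fst w) a \<otimes>\<^bsub>H\<^esub> h (snd w) b))"
      using a b i by (intro H.finsum_cong') (auto simp: slice_pure hc)
    finally show ?thesis .
  qed
  have "coefficient_family H L I e c h"
    unfolding coefficient_family_def using hl one comult counit mult by blast
  then show ?thesis using that exp by blast
qed

text \<open>
  Conversely the axioms are recovered by summing the identities over the basis; double sums are
  exchanged and the coordinate scalars are moved across the tensor sign.
\<close>

theorem coefficient_family_imp_comodule_algebra:
  assumes fam: "coefficient_family H L I e c h"
    and exp: "\<And>a. a \<in> carrier L \<Longrightarrow> \<delta> a = (\<Oplus>\<^bsub>tensor H L\<^esub>i\<in>I. pure_tensor H L (h i a) (e i))"
  shows "left_comodule_algebra H L \<delta>"
proof -
  let ?HL = "tensor H L"
  have hl: "linear_map L H (h i)" if "i \<in> I" for i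
    using fam that by (simp add: coefficient_family_def)
  note hc = linear_map_closed[OF hl]
  have "linear_map L ?HL (\<lambda>a. \<Oplus>\<^bsub>?HL\<^esub>i\<in>I. pure_tensor H L (h i a) (e i))"
    by (intro linear_map_sum HL.k_space_tensor linear_map_comp[OF hl]
        bilinear_map_left[OF HL.bilinear_pure_tensor]) auto
  then have \<delta>: "linear_map L ?HL \<delta>"
    by (rule linear_map_cong) (simp_all add: exp L.k_space_axioms)
  note dc = linear_map_closed[OF \<delta>]
  have coassoc: "tensor_lift T (\<lambda>h l. tensor_lift T
          (\<lambda>h1 h2. pure_tensor H (tensor H L) h1 (pure_tensor H L h2 l)) (comult H h)) (\<delta> a) =
        tensor_lift T (\<lambda>h l. pure_tensor H (tensor H L) h (\<delta> l)) (\<delta> a)" if a: "a \<in> carrier L" for a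
  proof -
    let ?N = "\<lambda>j. tensor_lift T (\<lambda>h1 h2. pure_tensor H (tensor H L) h1 (pure_tensor H L h2 (e j)))"
    have "tensor_lift T (\<lambda>h l. tensor_lift T
          (\<lambda>h1 h2. pure_tensor H (tensor H L) h1 (pure_tensor H L h2 l)) (comult H h)) (\<delta> a) =
        (\<Oplus>\<^bsub>T\<^esub>i\<in>I. ?N i (comult H (h i a)))"
      using a by (intro coassoc_left exp hc)
    also have "\<dots> = (\<Oplus>\<^bsub>T\<^esub>i\<in>I. \<Oplus>\<^bsub>T\<^esub>j\<in>I. pure_tensor H ?HL (h j a) (pure_tensor H L (h i (e j)) (e i)))"
    proof (intro HHL.AB.finsum_cong')
      fix i assume i: "i \<in> I"
      have "?N i (comult H (h i a)) =
          ?N i (\<Oplus>\<^bsub>tensor H H\<^esub>j\<in>I. pure_tensor H H (h j a) (h i (e j)))"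
        using fam i a by (simp add: coefficient_family_def)
      also have "\<dots> = (\<Oplus>\<^bsub>T\<^esub>j\<in>I. ?N i (pure_tensor H H (h j a) (h i (e j))))"
        using i a hc
        by (intro linear_map_finsum[OF H.HH.k_space_tensor HHL.k_space_tensor H.HH.tensor_lift_linear]
            HHL.k_space_tensor bilinear_nested) auto
      also have "\<dots> = (\<Oplus>\<^bsub>T\<^esub>j\<in>I. pure_tensor H ?HL (h j a) (pure_tensor H L (h i (e j)) (e i)))"
        using i a hc
        by (intro HHL.AB.finsum_cong') (auto simp: H.HH.tensor_lift_pure[OF HHL.k_space_tensor bilinear_nested])
      finally show "?N i (comult H (h i a)) = \<dots>" .
    qed (use a hc in auto)
    also have "\<dots> = (\<Oplus>\<^bsub>T\<^esub>j\<in>I. \<Oplus>\<^bsub>T\<^esub>i\<in>I. pure_tensor H ?HL (h j a) (pure_tensor H L (h i (e j)) (e i)))"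
      using a hc by (intro HHL.AB.finsum_swap) auto
    also have "\<dots> = (\<Oplus>\<^bsub>T\<^esub>j\<in>I. pure_tensor H ?HL (h j a) (\<delta> (e j)))"
    proof (intro HHL.AB.finsum_cong')
      fix j assume j: "j \<in> I"
      have "pure_tensor H ?HL (h j a) (\<delta> (e j)) =
          pure_tensor H ?HL (h j a) (\<Oplus>\<^bsub>?HL\<^esub>i\<in>I. pure_tensor H L (h i (e j)) (e i))"
        using j by (simp add: exp)
      also have "\<dots> = (\<Oplus>\<^bsub>T\<^esub>i\<in>I. pure_tensor H ?HL (h j a) (pure_tensor H L (h i (e j)) (e i)))"
        using j a hc
        by (intro linear_map_finsum[OF HL.k_space_tensor HHL.k_space_tensor
              bilinear_map_right[OF HHL.bilinear_pure_tensor]]) auto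
      finally show "(\<Oplus>\<^bsub>T\<^esub>i\<in>I. pure_tensor H ?HL (h j a) (pure_tensor H L (h i (e j)) (e i))) =
          pure_tensor H ?HL (h j a) (\<delta> (e j))" by simp
    qed (use a hc dc in auto)
    also have "\<dots> = tensor_lift T (\<lambda>h l. pure_tensor H (tensor H L) h (\<delta> l)) (\<delta> a)"
      using a
      by (intro tensor_lift_expansion[OF HHL.k_space_tensor bilinear_coassoc_right[OF \<delta>] _ exp, symmetric] hc)
    finally show ?thesis .
  qed
  have counit: "tensor_lift L (\<lambda>h l. counit H h \<odot>\<^bsub>L\<^esub> l) (\<delta> a) = a" if a: "a \<in> carrier L" for a
  proof -
    have "tensor_lift L (\<lambda>h l. counit H h \<odot>\<^bsub>L\<^esub> l) (\<delta> a) = (\<Oplus>\<^bsub>L\<^esub>i\<in>I. counit H (h i a) \<odot>\<^bsub>L\<^esub> e i)"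
      using a by (intro tensor_lift_expansion[OF L.k_space_axioms bilinear_counit _ exp] hc)
    also have "\<dots> = (\<Oplus>\<^bsub>L\<^esub>i\<in>I. c i a \<odot>\<^bsub>L\<^esub> e i)"
      using a fam by (intro L.finsum_cong') (auto simp: coefficient_family_def)
    finally show ?thesis using a by (simp add: L.expansion)
  qed
  have pull: "(\<Oplus>\<^bsub>?HL\<^esub>i\<in>I. pure_tensor H L (c i a \<odot>\<^bsub>H\<^esub> b) (e i)) = pure_tensor H L b a"
    if "b \<in> carrier H" "a \<in> carrier L" for a b
    using that slice_expansion[of "pure_tensor H L b a"] 
    by (simp add: slice_pure cong: HL.AB.finsum_cong)
  have one: "\<delta> \<one>\<^bsub>L\<^esub> = \<one>\<^bsub>?HL\<^esub>"
  proof -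
    have "\<delta> \<one>\<^bsub>L\<^esub> = (\<Oplus>\<^bsub>?HL\<^esub>i\<in>I. pure_tensor H L (c i \<one>\<^bsub>L\<^esub> \<odot>\<^bsub>H\<^esub> \<one>\<^bsub>H\<^esub>) (e i))"
      using fam by (simp add: exp coefficient_family_def cong: HL.AB.finsum_cong)
    then show ?thesis by (simp add: pull HL.one_tensor)
  qed
  have mult: "\<delta> (a \<otimes>\<^bsub>L\<^esub> b) = \<delta> a \<otimes>\<^bsub>?HL\<^esub> \<delta> b" if a: "a \<in> carrier L" and b: "b \<in> carrier L" for a b
  proof -
    let ?hh = "\<lambda>w. h (fst w) a \<otimes>\<^bsub>H\<^esub> h (snd w) b"
    let ?ee = "\<lambda>w. e (fst w) \<otimes>\<^bsub>L\<^esub> e (snd w)"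
    have "\<delta> (a \<otimes>\<^bsub>L\<^esub> b) = (\<Oplus>\<^bsub>?HL\<^esub>i\<in>I. pure_tensor H L (h i (a \<otimes>\<^bsub>L\<^esub> b)) (e i))"
      using a b by (simp add: exp)
    also have "\<dots> = (\<Oplus>\<^bsub>?HL\<^esub>i\<in>I. \<Oplus>\<^bsub>?HL\<^esub>w\<in>I \<times> I. pure_tensor H L (c i (?ee w) \<odot>\<^bsub>H\<^esub> ?hh w) (e i))"
    proof (intro HL.AB.finsum_cong')
      fix i assume i: "i \<in> I"
      have "pure_tensor H L (h i (a \<otimes>\<^bsub>L\<^esub> b)) (e i) =
          pure_tensor H L (\<Oplus>\<^bsub>H\<^esub>w\<in>I \<times> I. c i (?ee w) \<odot>\<^bsub>H\<^esub> ?hh w) (e i)"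
        using fam a b i by (simp add: coefficient_family_def)
      also have "\<dots> = (\<Oplus>\<^bsub>?HL\<^esub>w\<in>I \<times> I. pure_tensor H L (c i (?ee w) \<odot>\<^bsub>H\<^esub> ?hh w) (e i))"
        using i a b hc
        by (intro linear_map_finsum[OF H.k_space_axioms HL.k_space_tensor
              bilinear_map_left[OF HL.bilinear_pure_tensor]]) auto
      finally show "pure_tensor H L (h i (a \<otimes>\<^bsub>L\<^esub> b)) (e i) = \<dots>" .
    qed (use a b hc in \<open>auto intro!: HL.AB.finsum_closed\<close>)
    also have "\<dots> = (\<Oplus>\<^bsub>?HL\<^esub>w\<in>I \<times> I. \<Oplus>\<^bsub>?HL\<^esub>i\<in>I. pure_tensor H L (c i (?ee w) \<odot>\<^bsub>H\<^esub> ?hh w) (e i))"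
      using a b hc by (intro HL.AB.finsum_swap) auto
    also have "\<dots> = (\<Oplus>\<^bsub>?HL\<^esub>w\<in>I \<times> I. pure_tensor H L (?hh w) (?ee w))"
      using a b hc by (intro HL.AB.finsum_cong') (auto simp: pull)
    also have "\<dots> = (\<Oplus>\<^bsub>?HL\<^esub>w\<in>I \<times> I. pure_tensor H L (h (fst w) a) (e (fst w)) \<otimes>\<^bsub>?HL\<^esub>
        pure_tensor H L (h (snd w) b) (e (snd w)))"
      using a b hc by (intro HL.AB.finsum_cong') (auto simp: HLa.mult_pure)
    also have "\<dots> = (\<Oplus>\<^bsub>?HL\<^esub>i\<in>I. pure_tensor H L (h i a) (e i)) \<otimes>\<^bsub>?HL\<^esub>
        (\<Oplus>\<^bsub>?HL\<^esub>i\<in>I. pure_tensor H L (h i b) (e i))"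
      using a b
      by (intro bilinear_map_finsum[OF _ _ _ HLa.bilinear_tensor_mult, symmetric] HL.k_space_tensor) (auto simp: hc)
    finally show ?thesis using a b by (simp add: exp)
  qed
  have "\<delta> \<in> alg_hom L ?HL"
    using linear_map_closed[OF \<delta>] linear_map_add[OF \<delta>] linear_map_smult[OF \<delta>] one mult
    by (simp add: alg_hom_def ring_hom_def)
  then show ?thesis
    using \<delta> coassoc counit L.k_algebra_axioms
    by (simp add: left_comodule_algebra_def left_comodule_def)
qed

end

section \<open>Twisting by a cocycle\<close>

text \<open>
  Twisting changes only the product of an algebra. Everything that is built from the vector space
  structure alone, in particular the vector space \<open>A \<otimes> B\<close>, is unaffected.
\<close>

definition same_space :: "('k, 'a, 'm) module_scheme \<Rightarrow> ('k, 'a, 'n) module_scheme \<Rightarrow> bool" where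
  "same_space A B \<longleftrightarrow> carrier A = carrier B \<and> add A = add B \<and> zero A = zero B \<and>
     module.smult A = module.smult B"

lemma same_space_finsum: "same_space A B \<Longrightarrow> finsum A f I = finsum B f I"
  by (simp add: same_space_def finsum_def finprod_def)

lemma same_space_k_space:
  assumes AB: "same_space A B" and A: "k_space A"
  shows "k_space B"
proof -
  interpret A: k_space A by (rule A)
  have [simp]: "carrier B = carrier A" "add B = add A" "zero B = zero A" "module.smult B = module.smult A"
    using AB by (simp_all add: same_space_def)
  show ?thesis
  proof (rule k_spaceI)
    show "abelian_group B"
    proof (rule abelian_groupI)
      fix x assume "x \<in> carrier B"
      then show "\<exists>y\<in>carrier B. y \<oplus>\<^bsub>B\<^esub> x = \<zero>\<^bsub>B\<^esub>"
        using A.l_neg[of x] A.a_inv_closed[of x] by auto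
    qed (auto simp: A.a_assoc intro: A.a_comm)
  qed (auto simp: A.smult_add_left A.smult_add_right A.smult_smult)
qed

lemma same_space_linear_map:
  "same_space A A' \<Longrightarrow> same_space B B' \<Longrightarrow> linear_map A B f \<longleftrightarrow> linear_map A' B' f"
  by (simp add: same_space_def linear_map_def)

lemma same_space_refl [simp]: "same_space A A"
  by (simp add: same_space_def)

lemma same_space_sym: "same_space A B \<Longrightarrow> same_space B A"
  by (simp add: same_space_def)

lemma same_space_tensor_null_mono:
  assumes "same_space A A'" "same_space B B'" "p \<in> tensor_null A B"
  shows "p \<in> tensor_null A' B'"
  using assms(3)
proof (induction rule: tensor_null.induct)
  case (add_left a a' b c)
  then show ?case using assms(1,2) tensor_null.add_left[of a A' a' b B' c] by (simp add: same_space_def)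
next
  case (add_right a b b' c)
  then show ?case using assms(1,2) tensor_null.add_right[of a A' b B' b' c] by (simp add: same_space_def)
next
  case (smult_left a b d c)
  then show ?case using assms(1,2) tensor_null.smult_left[of a A' b B' d c] by (simp add: same_space_def)
next
  case (smult_right a b d c)
  then show ?case using assms(1,2) tensor_null.smult_right[of a A' b B' d c] by (simp add: same_space_def)
qed (auto intro: tensor_null.zero tensor_null.diff)

lemma same_space_tensor_null:
  assumes "same_space A A'" "same_space B B'"
  shows "tensor_null A B = tensor_null A' B'"
  using assms same_space_tensor_null_mono[of A A' B B']
    same_space_tensor_null_mono[of A' A B' B] by (auto simp: same_space_sym)

lemma same_space_pre_tensor:
  assumes "same_space A A'" "same_space B B'"
  shows "same_space (pre_tensor A B) (pre_tensor A' B')"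
  using assms by (simp add: pre_tensor_def same_space_def)

lemma same_space_coset:
  "same_space A A' \<Longrightarrow> J +>\<^bsub>A\<^esub> p = J +>\<^bsub>A'\<^esub> p"
  by (simp add: same_space_def a_r_coset_def')

lemma same_space_tensor:
  assumes "same_space A A'" "same_space B B'"
  shows "same_space (tensor A B) (tensor A' B')"
proof -
  have "set_add (pre_tensor A B) = set_add (pre_tensor A' B')"
    using same_space_pre_tensor[OF assms] by (intro ext) (simp add: set_add_def' same_space_def)
  then show ?thesis
    using same_space_pre_tensor[OF assms]
    by (simp add: same_space_def tensor_def ring.extend_def module.fields_def FactRing_def
      A_RCOSETS_def' a_r_coset_def' same_space_tensor_null[OF assms])
qed

lemma same_space_pure_tensor:
  assumes "same_space A A'" "same_space B B'"
  shows "pure_tensor A B = pure_tensor A' B'"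
  unfolding pure_tensor_def
  by (simp add: same_space_tensor_null[OF assms] same_space_coset[OF same_space_pre_tensor[OF assms]])

lemma same_space_cocycle_deformation: "same_space H (cocycle_deformation H \<sigma>)"
  by (simp add: same_space_def cocycle_deformation_def)

lemma same_space_twisted_algebra: "same_space L (twisted_algebra \<sigma> L \<delta>)"
  by (simp add: same_space_def twisted_algebra_def)

lemma same_space_finite_basis:
  assumes "same_space A B" "finite_basis A I e c"
  shows "finite_basis B I e c"
proof -
  interpret A: finite_basis A I e c by fact
  show ?thesis
  proof (intro finite_basis.intro finite_basis_axioms.intro)
    show "k_space B" using same_space_k_space[OF assms(1) A.k_space_axioms] .
    show "linear_map B scalar_algebra (c i)" if "i \<in> I" for i
      using A.coord_linear[OF that] same_space_linear_map[OF assms(1) same_space_refl] by blast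
    show "(\<Oplus>\<^bsub>B\<^esub>i\<in>I. c i a \<odot>\<^bsub>B\<^esub> e i) = a" if "a \<in> carrier B" for a
      using A.expansion[of a] assms(1) that
      by (simp add: same_space_def flip: same_space_finsum[OF assms(1)])
  qed (use assms(1) A.e_closed in \<open>simp_all add: A.coord_e same_space_def\<close>)
qed

lemma linear_map_mult_scalar:
  "linear_map A scalar_algebra f \<Longrightarrow> linear_map A scalar_algebra (\<lambda>a. f a * r)"
  "linear_map A scalar_algebra f \<Longrightarrow> linear_map A scalar_algebra (\<lambda>a. r * f a)"
  by (simp_all add: linear_map_def algebra_simps)

lemma sum_pairs:
  "(\<Sum>w\<in>I \<times> J. f (fst w) (snd w)) = (\<Sum>i\<in>I. \<Sum>j\<in>J. f i j)"
  by (simp add: sum.cartesian_product case_prod_unfold)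

lemma (in k_space) finsum_smult_swap:
  assumes "finite I" "finite J" "\<And>j. j \<in> J \<Longrightarrow> v j \<in> carrier M"
  shows "(\<Oplus>i\<in>I. r i \<odot> (\<Oplus>j\<in>J. s i j \<odot> v j)) = (\<Oplus>j\<in>J. (\<Sum>i\<in>I. r i * s i j) \<odot> v j)"
proof -
  have "(\<Oplus>i\<in>I. r i \<odot> (\<Oplus>j\<in>J. s i j \<odot> v j)) = (\<Oplus>i\<in>I. \<Oplus>j\<in>J. (r i * s i j) \<odot> v j)"
    using assms(3) by (intro finsum_cong') (auto simp: smult_finsum smult_smult cong: finsum_cong)
  also have "\<dots> = (\<Oplus>j\<in>J. \<Oplus>i\<in>I. (r i * s i j) \<odot> v j)"
    using assms by (intro finsum_swap) auto
  also have "\<dots> = (\<Oplus>j\<in>J. (\<Sum>i\<in>I. r i * s i j) \<odot> v j)"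
    using assms(3) by (intro finsum_cong') (auto simp: sum_smult)
  finally show ?thesis .
qed

lemma is_convolution_inverse_conv_inv:
  "hopf_2_cocycle H \<sigma> \<Longrightarrow> is_convolution_inverse H \<sigma> (conv_inv H \<sigma>)"
  unfolding hopf_2_cocycle_def conv_inv_def by (metis someI_ex)

definition trilinear_map ::
    "('k::field, 'h, 'm) module_scheme \<Rightarrow> ('k, 'c, 'p) module_scheme \<Rightarrow> ('h \<Rightarrow> 'h \<Rightarrow> 'h \<Rightarrow> 'c) \<Rightarrow> bool" where
  "trilinear_map H C F \<longleftrightarrow> (\<forall>a\<in>carrier H. \<forall>b\<in>carrier H.
     linear_map H C (\<lambda>x. F x a b) \<and> linear_map H C (\<lambda>x. F a x b) \<and> linear_map H C (\<lambda>x. F a b x))"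

context bialg
begin

lemma bilinear_convolution_inner:
  assumes f: "bilinear_map H H scalar_algebra f" and g: "bilinear_map H H scalar_algebra g"
    and "a1 \<in> carrier H" "a2 \<in> carrier H"
  shows "bilinear_map H H scalar_algebra (\<lambda>b1 b2. f a1 b1 * g a2 b2)"
  using assms(3,4)
  by (intro bilinear_mapI linear_map_mult_scalar bilinear_map_right[OF f] bilinear_map_right[OF g])

lemma bilinear_convolution_outer:
  assumes f: "bilinear_map H H scalar_algebra f" and g: "bilinear_map H H scalar_algebra g"
    and t: "t \<in> carrier (tensor H H)"
  shows "bilinear_map H H scalar_algebra
    (\<lambda>a1 a2. tensor_lift scalar_algebra (\<lambda>b1 b2. f a1 b1 * g a2 b2) t)"
  by (intro bilinear_mapI HH.tensor_lift_param[OF k_space_scalar_algebra bilinear_convolution_inner[OF f g]]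
      linear_map_mult_scalar bilinear_map_left[OF f] bilinear_map_left[OF g] t k_space_axioms)

lemma sweedler3_aux:
  assumes C: "k_space C" and F: "trilinear_map H C F"
  shows "z \<in> carrier H \<Longrightarrow> bilinear_map H H C (\<lambda>a b. F a b z)"
    and "bilinear_map H H C (\<lambda>u a3. tensor_lift C (\<lambda>a1 a2. F a1 a2 a3) (comult H u))"
proof -
  show B: "bilinear_map H H C (\<lambda>a b. F a b z)" if "z \<in> carrier H" for z
    using F that by (auto simp: trilinear_map_def bilinear_map_def)
  show "bilinear_map H H C (\<lambda>u a3. tensor_lift C (\<lambda>a1 a2. F a1 a2 a3) (comult H u))"
  proof (rule bilinear_mapI)
    fix u assume "u \<in> carrier H"
    then show "linear_map H C (\<lambda>a3. tensor_lift C (\<lambda>a1 a2. F a1 a2 a3) (comult H u))"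
      using F by (intro HH.tensor_lift_param C B linear_map_closed[OF comult_linear] k_space_axioms)
        (auto simp: trilinear_map_def)
  next
    fix a3 assume "a3 \<in> carrier H"
    then show "linear_map H C (\<lambda>u. tensor_lift C (\<lambda>a1 a2. F a1 a2 a3) (comult H u))"
      by (intro linear_map_comp[OF comult_linear] HH.tensor_lift_linear C B)
  qed
qed

lemma sweedler3_param:
  assumes C: "k_space C" and D: "k_space D" and F: "\<And>l. l \<in> carrier D \<Longrightarrow> trilinear_map H C (F l)"
    and lin: "\<And>a b z. a \<in> carrier H \<Longrightarrow> b \<in> carrier H \<Longrightarrow> z \<in> carrier H \<Longrightarrow> linear_map D C (\<lambda>l. F l a b z)"
    and x: "x \<in> carrier H"
  shows "linear_map D C (\<lambda>l. sweedler3 H C (F l) x)"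
  unfolding sweedler3_def
proof (rule HH.tensor_lift_param[OF C _ _ linear_map_closed[OF comult_linear x] D])
  show "bilinear_map H H C (\<lambda>u a3. tensor_lift C (\<lambda>a1 a2. F l a1 a2 a3) (comult H u))"
    if "l \<in> carrier D" for l
    by (rule sweedler3_aux(2)[OF C F[OF that]])
  fix u z assume uz: "u \<in> carrier H" "z \<in> carrier H"
  show "linear_map D C (\<lambda>l. tensor_lift C (\<lambda>a1 a2. F l a1 a2 z) (comult H u))"
    using uz by (intro HH.tensor_lift_param[OF C sweedler3_aux(1)[OF C F] lin] D
        linear_map_closed[OF comult_linear])
qed

end

locale coefficients = based_comodule_setup H L I e c
  for H :: "('k::field, 'h) bialgebra" and L :: "('k, 'l) module" and I :: "'i set" and e c +
  fixes h :: "'i \<Rightarrow> 'l \<Rightarrow> 'h"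
  assumes family: "coefficient_family H L I e c h"
begin

lemma h_linear: "i \<in> I \<Longrightarrow> linear_map L H (h i)"
  using family by (simp add: coefficient_family_def)

lemma h_closed [simp]: "i \<in> I \<Longrightarrow> a \<in> carrier L \<Longrightarrow> h i a \<in> carrier H"
  by (rule linear_map_closed[OF h_linear])

lemma h_one: "i \<in> I \<Longrightarrow> h i \<one>\<^bsub>L\<^esub> = c i \<one>\<^bsub>L\<^esub> \<odot>\<^bsub>H\<^esub> \<one>\<^bsub>H\<^esub>"
  and h_comult: "i \<in> I \<Longrightarrow> a \<in> carrier L \<Longrightarrow>
    comult H (h i a) = (\<Oplus>\<^bsub>tensor H H\<^esub>j\<in>I. pure_tensor H H (h j a) (h i (e j)))"
  and h_counit: "i \<in> I \<Longrightarrow> a \<in> carrier L \<Longrightarrow> counit H (h i a) = c i a"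
  and h_mult: "i \<in> I \<Longrightarrow> a \<in> carrier L \<Longrightarrow> b \<in> carrier L \<Longrightarrow> h i (a \<otimes>\<^bsub>L\<^esub> b) =
     (\<Oplus>\<^bsub>H\<^esub>w\<in>I \<times> I. c i (e (fst w) \<otimes>\<^bsub>L\<^esub> e (snd w)) \<odot>\<^bsub>H\<^esub> (h (fst w) a \<otimes>\<^bsub>H\<^esub> h (snd w) b))"
  using family by (simp_all add: coefficient_family_def)

lemma lift_comult:
  assumes "k_space C" "bilinear_map H H C f" "i \<in> I" "a \<in> carrier L"
  shows "tensor_lift C f (comult H (h i a)) = (\<Oplus>\<^bsub>C\<^esub>j\<in>I. f (h j a) (h i (e j)))"
proof -
  interpret C: k_space C by fact
  have "tensor_lift C f (comult H (h i a)) =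
      (\<Oplus>\<^bsub>C\<^esub>j\<in>I. tensor_lift C f (pure_tensor H H (h j a) (h i (e j))))"
    unfolding h_comult[OF assms(3,4)] using assms
    by (intro linear_map_finsum[OF H.HH.k_space_tensor assms(1) H.HH.tensor_lift_linear]) auto
  also have "\<dots> = (\<Oplus>\<^bsub>C\<^esub>j\<in>I. f (h j a) (h i (e j)))"
    using assms bilinear_map_closed[OF assms(2)]
    by (intro C.finsum_cong') (auto simp: H.HH.tensor_lift_pure[OF assms(1,2)])
  finally show ?thesis .
qed

lemma convolution_coefficients:
  assumes f: "bilinear_map H H scalar_algebra f" and g: "bilinear_map H H scalar_algebra g"
    and "p \<in> I" "r \<in> I" "a \<in> carrier L" "b \<in> carrier L"
  shows "convolution H f g (h p a) (h r b) =
    (\<Sum>w\<in>I \<times> I. f (h (fst w) a) (h (snd w) b) * g (h p (e (fst w))) (h r (e (snd w))))"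
proof -
  note B = H.bilinear_convolution_inner[OF f g]
  have cb: "comult H (h r b) \<in> carrier (tensor H H)"
    using assms by (intro linear_map_closed[OF H.comult_linear]) simp
  note O = H.bilinear_convolution_outer[OF f g cb]
  have "convolution H f g (h p a) (h r b) =
    (\<Sum>i\<in>I. tensor_lift scalar_algebra (\<lambda>b1 b2. f (h i a) b1 * g (h p (e i)) b2) (comult H (h r b)))"
    unfolding convolution_def using assms lift_comult[OF k_space_scalar_algebra O] by simp
  also have "\<dots> = (\<Sum>i\<in>I. \<Sum>j\<in>I. f (h i a) (h j b) * g (h p (e i)) (h r (e j)))"
    using assms by (intro sum.cong) (simp_all add: lift_comult[OF k_space_scalar_algebra B])
  finally show ?thesis by (simp add: sum_pairs[symmetric])
qed

lemma sweedler3_coefficients: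
  assumes C: "k_space C" and F: "trilinear_map H C F" and "p \<in> I" "a \<in> carrier L"
  shows "sweedler3 H C F (h p a) = (\<Oplus>\<^bsub>C\<^esub>u\<in>I. \<Oplus>\<^bsub>C\<^esub>w\<in>I. F (h w a) (h u (e w)) (h p (e u)))"
proof -
  interpret C: k_space C by fact
  have Fc: "x \<in> carrier H \<Longrightarrow> y \<in> carrier H \<Longrightarrow> z \<in> carrier H \<Longrightarrow> F x y z \<in> carrier C" for x y z
    using bilinear_map_closed[OF H.sweedler3_aux(1)[OF C F]] by blast
  have "sweedler3 H C F (h p a) =
      (\<Oplus>\<^bsub>C\<^esub>u\<in>I. tensor_lift C (\<lambda>a1 a2. F a1 a2 (h p (e u))) (comult H (h u a)))"
    unfolding sweedler3_def using assms by (intro lift_comult H.sweedler3_aux(2))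
  also have "\<dots> = (\<Oplus>\<^bsub>C\<^esub>u\<in>I. \<Oplus>\<^bsub>C\<^esub>w\<in>I. F (h w a) (h u (e w)) (h p (e u)))"
    using assms Fc by (intro C.finsum_cong' lift_comult C H.sweedler3_aux(1)) (auto intro!: C.finsum_closed)
  finally show ?thesis .
qed

end

locale cocycle = bialg H for H :: "('k::field, 'h) bialgebra" (structure) +
  fixes \<sigma> :: "'h \<Rightarrow> 'h \<Rightarrow> 'k"
  assumes cocycle: "hopf_2_cocycle H \<sigma>"
begin

abbreviation "\<tau> \<equiv> conv_inv H \<sigma>"
abbreviation "D \<equiv> cocycle_deformation H \<sigma>"

lemma sigma_bilinear: "bilinear_map H H scalar_algebra \<sigma>"
  using cocycle by (simp add: hopf_2_cocycle_def bilinear_form_iff)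

lemma tau_bilinear: "bilinear_map H H scalar_algebra \<tau>"
  using is_convolution_inverse_conv_inv[OF cocycle]
  by (simp add: is_convolution_inverse_def bilinear_form_iff)

lemma tau_sigma: "a \<in> carrier H \<Longrightarrow> b \<in> carrier H \<Longrightarrow>
    convolution H \<tau> \<sigma> a b = counit H a * counit H b"
  using is_convolution_inverse_conv_inv[OF cocycle] by (simp add: is_convolution_inverse_def)

lemma sigma_one: "a \<in> carrier H \<Longrightarrow> \<sigma> a \<one>\<^bsub>H\<^esub> = counit H a" "a \<in> carrier H \<Longrightarrow> \<sigma> \<one>\<^bsub>H\<^esub> a = counit H a"
  using cocycle by (simp_all add: hopf_2_cocycle_def)

lemma cocycle_identity: "a \<in> carrier H \<Longrightarrow> b \<in> carrier H \<Longrightarrow> d \<in> carrier H \<Longrightarrow>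
   convolution H \<sigma> (\<lambda>a2 b2. \<sigma> (a2 \<otimes>\<^bsub>H\<^esub> b2) d) a b = convolution H \<sigma> (\<lambda>b2 c2. \<sigma> a (b2 \<otimes>\<^bsub>H\<^esub> c2)) b d"
  using cocycle by (simp add: hopf_2_cocycle_def)

lemma deformation_simps [simp]:
  "carrier D = carrier H" "\<zero>\<^bsub>D\<^esub> = \<zero>\<^bsub>H\<^esub>" "\<one>\<^bsub>D\<^esub> = \<one>\<^bsub>H\<^esub>" "x \<oplus>\<^bsub>D\<^esub> y = x \<oplus>\<^bsub>H\<^esub> y" "r \<odot>\<^bsub>D\<^esub> x = r \<odot>\<^bsub>H\<^esub> x"
  "comult D = comult H" "counit D = counit H"
  by (simp_all add: cocycle_deformation_def)

lemma deformed_product_trilinear: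
  assumes "a1 \<in> carrier H" "a2 \<in> carrier H" "a3 \<in> carrier H"
  shows "trilinear_map H H (\<lambda>b1 b2 b3. (\<sigma> a1 b1 * \<tau> a3 b3) \<odot>\<^bsub>H\<^esub> (a2 \<otimes>\<^bsub>H\<^esub> b2))"
  unfolding trilinear_map_def using assms
  by (intro ballI conjI linear_map_scale linear_map_scale_vector linear_map_mult_scalar k_space_axioms
      bilinear_map_right[OF sigma_bilinear] bilinear_map_right[OF tau_bilinear]
      bilinear_map_right[OF bilinear_mult]) auto

lemma deformed_product_trilinear_left:
  assumes "b \<in> carrier H"
  shows "trilinear_map H H (\<lambda>a1 a2 a3. sweedler3 H H (\<lambda>b1 b2 b3. (\<sigma> a1 b1 * \<tau> a3 b3) \<odot>\<^bsub>H\<^esub> (a2 \<otimes>\<^bsub>H\<^esub> b2)) b)"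
  unfolding trilinear_map_def using assms
  by (intro ballI conjI sweedler3_param deformed_product_trilinear k_space_axioms linear_map_scale
      linear_map_scale_vector linear_map_mult_scalar bilinear_map_left[OF sigma_bilinear]
      bilinear_map_left[OF tau_bilinear] bilinear_map_left[OF bilinear_mult]) auto

text \<open>
  On group-like elements the scalars contributed by \<open>\<sigma>\<close> and by its convolution inverse multiply to one.
\<close>

lemma grouplike_deformed_mult:
  assumes a: "a \<in> carrier H" "comult H a = pure_tensor H H a a" "counit H a = 1"
    and b: "b \<in> carrier H" "comult H b = pure_tensor H H b b" "counit H b = 1"
  shows "a \<otimes>\<^bsub>D\<^esub> b = a \<otimes> b"
proof -
  have sw: "sweedler3 H H F d = F d d d"
    if F: "trilinear_map H H F" and d: "d \<in> carrier H" "comult H d = pure_tensor H H d d" for F d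
    using sweedler3_aux[OF k_space_axioms F] d
    by (simp add: sweedler3_def HH.tensor_lift_pure[OF k_space_axioms])
  have "convolution H \<sigma> \<tau> a b = \<sigma> a b * \<tau> a b"
    using a b bilinear_convolution_outer[OF sigma_bilinear tau_bilinear, of "pure_tensor H H b b"]
    by (simp add: convolution_def HH.tensor_lift_pure[OF k_space_scalar_algebra]
        bilinear_convolution_inner[OF sigma_bilinear tau_bilinear])
  moreover have "convolution H \<sigma> \<tau> a b = 1"
    using is_convolution_inverse_conv_inv[OF cocycle] a b by (simp add: is_convolution_inverse_def)
  moreover have "a \<otimes>\<^bsub>D\<^esub> b = (\<sigma> a b * \<tau> a b) \<odot> (a \<otimes> b)"
    unfolding cocycle_deformation_def
    by (simp add: sw[OF deformed_product_trilinear_left[OF b(1)] a(1,2)]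
        sw[OF deformed_product_trilinear[OF a(1) a(1) a(1)] b(1,2)])
  ultimately show ?thesis using a b by simp
qed

end

context algebra_factors
begin

lemma bilinear_twist_inner:
  assumes \<sigma>: "bilinear_map A A scalar_algebra \<sigma>" and "h \<in> carrier A" "b \<in> carrier B"
  shows "bilinear_map A B B (\<lambda>h' b'. \<sigma> h h' \<odot>\<^bsub>B\<^esub> (b \<otimes>\<^bsub>B\<^esub> b'))"
  using assms
  by (intro bilinear_mapI linear_map_scale linear_map_scale_vector B.k_space_axioms
      bilinear_map_right[OF \<sigma>] bilinear_map_right[OF B.bilinear_mult]) auto

lemma bilinear_twist_outer:
  assumes \<sigma>: "bilinear_map A A scalar_algebra \<sigma>" and t: "t \<in> carrier (tensor A B)"
  shows "bilinear_map A B B (\<lambda>h b. tensor_lift B (\<lambda>h' b'. \<sigma> h h' \<odot>\<^bsub>B\<^esub> (b \<otimes>\<^bsub>B\<^esub> b')) t)"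
  by (intro bilinear_mapI tensor_lift_param[OF B.k_space_axioms bilinear_twist_inner[OF \<sigma>]] linear_map_scale
      linear_map_scale_vector t A.k_space_axioms B.k_space_axioms bilinear_map_left[OF \<sigma>]
      bilinear_map_left[OF B.bilinear_mult]) auto

end

locale twisting = coefficients H L I e c h + S: cocycle H \<sigma>
  for H :: "('k::field, 'h) bialgebra" and L :: "('k, 'l) module" and I :: "'i set" and e c h
    and \<sigma> :: "'h \<Rightarrow> 'h \<Rightarrow> 'k" +
  fixes \<delta> :: "'l \<Rightarrow> ('k, 'h, 'l) tensor"
  assumes coaction: "a \<in> carrier L \<Longrightarrow> \<delta> a = (\<Oplus>\<^bsub>tensor H L\<^esub>i\<in>I. pure_tensor H L (h i a) (e i))"
begin

abbreviation "A \<equiv> twisted_algebra \<sigma> L \<delta>"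
abbreviation "\<tau> \<equiv> conv_inv H \<sigma>"
abbreviation "D \<equiv> cocycle_deformation H \<sigma>"
abbreviation "ee w \<equiv> e (fst w) \<otimes>\<^bsub>L\<^esub> e (snd w)"
abbreviation "ss w a b \<equiv> \<sigma> (h (fst w) a) (h (snd w) b)"

lemma twisted_simps [simp]:
  "carrier A = carrier L" "\<zero>\<^bsub>A\<^esub> = \<zero>\<^bsub>L\<^esub>" "\<one>\<^bsub>A\<^esub> = \<one>\<^bsub>L\<^esub>" "a \<oplus>\<^bsub>A\<^esub> b = a \<oplus>\<^bsub>L\<^esub> b" "r \<odot>\<^bsub>A\<^esub> a = r \<odot>\<^bsub>L\<^esub> a"
  by (simp_all add: twisted_algebra_def)

lemma twisted_mult:
  assumes a: "a \<in> carrier L" and b: "b \<in> carrier L"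
  shows "a \<otimes>\<^bsub>A\<^esub> b = (\<Oplus>\<^bsub>L\<^esub>w\<in>I \<times> I. ss w a b \<odot>\<^bsub>L\<^esub> ee w)"
proof -
  note B = HLa.bilinear_twist_inner[OF S.sigma_bilinear]
  have \<delta>b: "\<delta> b \<in> carrier (tensor H L)"
    unfolding coaction[OF b] using b by (intro HL.AB.finsum_closed) auto
  note O = HLa.bilinear_twist_outer[OF S.sigma_bilinear \<delta>b]
  have "a \<otimes>\<^bsub>A\<^esub> b = tensor_lift L (\<lambda>hh a0. tensor_lift L (\<lambda>h' b0. \<sigma> hh h' \<odot>\<^bsub>L\<^esub> (a0 \<otimes>\<^bsub>L\<^esub> b0)) (\<delta> b)) (\<delta> a)"
    by (simp add: twisted_algebra_def)
  also have "\<dots> = (\<Oplus>\<^bsub>L\<^esub>i\<in>I. tensor_lift L (\<lambda>h' b0. \<sigma> (h i a) h' \<odot>\<^bsub>L\<^esub> (e i \<otimes>\<^bsub>L\<^esub> b0)) (\<delta> b))"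
    using a by (intro tensor_lift_expansion[OF L.k_space_axioms O _ coaction]) auto
  also have "\<dots> = (\<Oplus>\<^bsub>L\<^esub>i\<in>I. \<Oplus>\<^bsub>L\<^esub>j\<in>I. \<sigma> (h i a) (h j b) \<odot>\<^bsub>L\<^esub> (e i \<otimes>\<^bsub>L\<^esub> e j))"
    using a b
    by (intro L.finsum_cong' tensor_lift_expansion[OF L.k_space_axioms B _ coaction])
       (auto intro!: L.finsum_closed)
  also have "\<dots> = (\<Oplus>\<^bsub>L\<^esub>w\<in>I \<times> I. ss w a b \<odot>\<^bsub>L\<^esub> ee w)"
    by (intro L.finsum_cartesian) auto
  finally show ?thesis .
qed

lemma twisted_closed: "a \<in> carrier L \<Longrightarrow> b \<in> carrier L \<Longrightarrow> a \<otimes>\<^bsub>A\<^esub> b \<in> carrier L"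
  by (auto simp: twisted_mult intro!: L.finsum_closed)

lemma coord_twisted:
  "i \<in> I \<Longrightarrow> a \<in> carrier L \<Longrightarrow> b \<in> carrier L \<Longrightarrow> c i (a \<otimes>\<^bsub>A\<^esub> b) = (\<Sum>w\<in>I \<times> I. ss w a b * c i (ee w))"
  by (simp add: twisted_mult) (subst L.coord_finsum; auto simp: L.coord_smult intro!: sum.cong)

text \<open>
  In Sweedler notation, \<open>G a b u\<close> collects what remains in \<open>H\<close> of
  \<open>\<sigma>(a\<^sub>(\<^sub>-\<^sub>2\<^sub>), b\<^sub>(\<^sub>-\<^sub>2\<^sub>)) a\<^sub>(\<^sub>-\<^sub>1\<^sub>) b\<^sub>(\<^sub>-\<^sub>1\<^sub>)\<close> when the basis elements with indices \<open>fst u\<close> and \<open>snd u\<close> are split off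
  from \<open>a\<close> and \<open>b\<close>. Both the coaction on a twisted product and the deformed product of coefficients are
  combinations of these elements.
\<close>

definition G :: "'l \<Rightarrow> 'l \<Rightarrow> 'i \<times> 'i \<Rightarrow> 'h" where
  "G a b u = (\<Oplus>\<^bsub>H\<^esub>w\<in>I \<times> I. ss w a b \<odot>\<^bsub>H\<^esub> (h (fst u) (e (fst w)) \<otimes>\<^bsub>H\<^esub> h (snd u) (e (snd w))))"

lemma G_closed [simp]: "u \<in> I \<times> I \<Longrightarrow> G a b u \<in> carrier H"
  by (auto simp: G_def intro!: H.finsum_closed)

lemma h_twisted:
  assumes i: "i \<in> I" and a: "a \<in> carrier L" and b: "b \<in> carrier L"
  shows "h i (a \<otimes>\<^bsub>A\<^esub> b) = (\<Oplus>\<^bsub>H\<^esub>u\<in>I \<times> I. c i (ee u) \<odot>\<^bsub>H\<^esub> G a b u)"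
proof -
  let ?HH = "\<lambda>u w. h (fst u) (e (fst w)) \<otimes>\<^bsub>H\<^esub> h (snd u) (e (snd w))"
  have "h i (a \<otimes>\<^bsub>A\<^esub> b) = (\<Oplus>\<^bsub>H\<^esub>w\<in>I \<times> I. h i (ss w a b \<odot>\<^bsub>L\<^esub> ee w))"
    unfolding twisted_mult[OF a b]
    by (intro linear_map_finsum[OF L.k_space_axioms H.k_space_axioms h_linear[OF i]]) auto
  also have "\<dots> = (\<Oplus>\<^bsub>H\<^esub>w\<in>I \<times> I. ss w a b \<odot>\<^bsub>H\<^esub> (\<Oplus>\<^bsub>H\<^esub>u\<in>I \<times> I. c i (ee u) \<odot>\<^bsub>H\<^esub> ?HH u w))"
    using i by (intro H.finsum_cong')
      (auto simp: linear_map_smult[OF h_linear[OF i]] h_mult intro!: H.finsum_closed H.smult_closed)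
  also have "\<dots> = (\<Oplus>\<^bsub>H\<^esub>w\<in>I \<times> I. \<Oplus>\<^bsub>H\<^esub>u\<in>I \<times> I. (ss w a b * c i (ee u)) \<odot>\<^bsub>H\<^esub> ?HH u w)"
  proof (intro H.finsum_cong')
    fix w assume w: "w \<in> I \<times> I"
    have "ss w a b \<odot>\<^bsub>H\<^esub> (\<Oplus>\<^bsub>H\<^esub>u\<in>I \<times> I. c i (ee u) \<odot>\<^bsub>H\<^esub> ?HH u w) =
        (\<Oplus>\<^bsub>H\<^esub>u\<in>I \<times> I. ss w a b \<odot>\<^bsub>H\<^esub> (c i (ee u) \<odot>\<^bsub>H\<^esub> ?HH u w))"
      using w by (intro H.smult_finsum) auto
    also have "\<dots> = (\<Oplus>\<^bsub>H\<^esub>u\<in>I \<times> I. (ss w a b * c i (ee u)) \<odot>\<^bsub>H\<^esub> ?HH u w)"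
      using w by (intro H.finsum_cong') (auto simp: H.smult_smult)
    finally show "ss w a b \<odot>\<^bsub>H\<^esub> (\<Oplus>\<^bsub>H\<^esub>u\<in>I \<times> I. c i (ee u) \<odot>\<^bsub>H\<^esub> ?HH u w) = \<dots>" .
  qed (auto intro!: H.finsum_closed)
  also have "\<dots> = (\<Oplus>\<^bsub>H\<^esub>u\<in>I \<times> I. \<Oplus>\<^bsub>H\<^esub>w\<in>I \<times> I. (ss w a b * c i (ee u)) \<odot>\<^bsub>H\<^esub> ?HH u w)"
    by (intro H.finsum_swap) auto
  also have "\<dots> = (\<Oplus>\<^bsub>H\<^esub>u\<in>I \<times> I. c i (ee u) \<odot>\<^bsub>H\<^esub> G a b u)"
  proof (intro H.finsum_cong')
    fix u assume u: "u \<in> I \<times> I"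
    have "c i (ee u) \<odot>\<^bsub>H\<^esub> G a b u = (\<Oplus>\<^bsub>H\<^esub>w\<in>I \<times> I. c i (ee u) \<odot>\<^bsub>H\<^esub> (ss w a b \<odot>\<^bsub>H\<^esub> ?HH u w))"
      unfolding G_def using u by (intro H.smult_finsum) auto
    also have "\<dots> = (\<Oplus>\<^bsub>H\<^esub>w\<in>I \<times> I. (ss w a b * c i (ee u)) \<odot>\<^bsub>H\<^esub> ?HH u w)"
      using u by (intro H.finsum_cong') (auto simp: H.smult_smult mult.commute)
    finally show "(\<Oplus>\<^bsub>H\<^esub>w\<in>I \<times> I. (ss w a b * c i (ee u)) \<odot>\<^bsub>H\<^esub> ?HH u w) = c i (ee u) \<odot>\<^bsub>H\<^esub> G a b u" ..
  qed auto
  finally show ?thesis .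
qed

lemma functional_h_twisted:
  assumes f: "linear_map H scalar_algebra f" and i: "i \<in> I" and a: "a \<in> carrier L" and b: "b \<in> carrier L"
  shows "f (h i (a \<otimes>\<^bsub>A\<^esub> b)) = (\<Sum>u\<in>I \<times> I. c i (ee u) *
    (\<Sum>w\<in>I \<times> I. ss w a b * f (h (fst u) (e (fst w)) \<otimes>\<^bsub>H\<^esub> h (snd u) (e (snd w)))))"
proof -
  note lf = linear_map_finsum[OF H.k_space_axioms k_space_scalar_algebra f, unfolded finsum_scalar_algebra]
  have fs: "x \<in> carrier H \<Longrightarrow> f (r \<odot>\<^bsub>H\<^esub> x) = r * f x" for r x
    using linear_map_smult[OF f] by simp
  have "f (h i (a \<otimes>\<^bsub>A\<^esub> b)) = (\<Sum>u\<in>I \<times> I. f (c i (ee u) \<odot>\<^bsub>H\<^esub> G a b u))"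
    unfolding h_twisted[OF i a b] by (intro lf) auto
  also have "\<dots> = (\<Sum>u\<in>I \<times> I. c i (ee u) * f (G a b u))"
    by (intro sum.cong refl) (auto intro!: fs)
  also have "\<dots> = (\<Sum>u\<in>I \<times> I. c i (ee u) *
      (\<Sum>w\<in>I \<times> I. ss w a b * f (h (fst u) (e (fst w)) \<otimes>\<^bsub>H\<^esub> h (snd u) (e (snd w)))))"
    unfolding G_def
    by (intro sum.cong refl arg_cong2[where f = "(*)"]) (subst lf; auto simp: fs intro!: sum.cong)
  finally show ?thesis .
qed

lemma mult_bilinear_sigma:
  "d \<in> carrier H \<Longrightarrow> bilinear_map H H scalar_algebra (\<lambda>a2 b2. \<sigma> (a2 \<otimes>\<^bsub>H\<^esub> b2) d)"
  "d \<in> carrier H \<Longrightarrow> bilinear_map H H scalar_algebra (\<lambda>a2 b2. \<sigma> d (a2 \<otimes>\<^bsub>H\<^esub> b2))"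
  using bilinear_map_linear[OF H.bilinear_mult bilinear_map_left[OF S.sigma_bilinear]]
    bilinear_map_linear[OF H.bilinear_mult bilinear_map_right[OF S.sigma_bilinear]] by auto

lemma sigma_h_twisted_left:
  assumes "i \<in> I" "a \<in> carrier L" "b \<in> carrier L" "d \<in> carrier H"
  shows "\<sigma> (h i (a \<otimes>\<^bsub>A\<^esub> b)) d = (\<Sum>u\<in>I \<times> I. c i (ee u) *
    convolution H \<sigma> (\<lambda>a2 b2. \<sigma> (a2 \<otimes>\<^bsub>H\<^esub> b2) d) (h (fst u) a) (h (snd u) b))"
  using assms
  by (subst functional_h_twisted[OF bilinear_map_left[OF S.sigma_bilinear]])
     (auto simp: convolution_coefficients[OF S.sigma_bilinear mult_bilinear_sigma(1)] intro!: sum.cong)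

lemma sigma_h_twisted_right:
  assumes "i \<in> I" "a \<in> carrier L" "b \<in> carrier L" "d \<in> carrier H"
  shows "\<sigma> d (h i (a \<otimes>\<^bsub>A\<^esub> b)) = (\<Sum>u\<in>I \<times> I. c i (ee u) *
    convolution H \<sigma> (\<lambda>a2 b2. \<sigma> d (a2 \<otimes>\<^bsub>H\<^esub> b2)) (h (fst u) a) (h (snd u) b))"
  using assms
  by (subst functional_h_twisted[OF bilinear_map_right[OF S.sigma_bilinear]])
     (auto simp: convolution_coefficients[OF S.sigma_bilinear mult_bilinear_sigma(2)] intro!: sum.cong)

lemma coord_mult_left: "i \<in> I \<Longrightarrow> x \<in> carrier L \<Longrightarrow> y \<in> carrier L \<Longrightarrow>
    (\<Sum>p\<in>I. c p x * c i (e p \<otimes>\<^bsub>L\<^esub> y)) = c i (x \<otimes>\<^bsub>L\<^esub> y)"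
  by (rule L.functional_expansion[OF linear_map_comp[OF bilinear_map_left[OF L.bilinear_mult] L.coord_linear]])

lemma coord_mult_right: "i \<in> I \<Longrightarrow> x \<in> carrier L \<Longrightarrow> y \<in> carrier L \<Longrightarrow>
    (\<Sum>p\<in>I. c p x * c i (y \<otimes>\<^bsub>L\<^esub> e p)) = c i (y \<otimes>\<^bsub>L\<^esub> x)"
  by (rule L.functional_expansion[OF linear_map_comp[OF bilinear_map_right[OF L.bilinear_mult] L.coord_linear]])

text \<open>
  By \<open>sigma_h_twisted_left\<close> and \<open>sigma_h_twisted_right\<close> the two bracketings differ only in the scalars
  in front of the triple products of basis elements, and these scalars are the two sides of the cocycle
  identity.
\<close>

lemma twisted_assoc:
  assumes a: "a \<in> carrier L" and b: "b \<in> carrier L" and d: "d \<in> carrier L"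
  shows "(a \<otimes>\<^bsub>A\<^esub> b) \<otimes>\<^bsub>A\<^esub> d = a \<otimes>\<^bsub>A\<^esub> (b \<otimes>\<^bsub>A\<^esub> d)"
proof (rule L.coord_eqI)
  fix i assume i: "i \<in> I"
  let ?K = "\<lambda>p r s. convolution H \<sigma> (\<lambda>a2 b2. \<sigma> (a2 \<otimes>\<^bsub>H\<^esub> b2) (h s d)) (h p a) (h r b)"
  have "c i ((a \<otimes>\<^bsub>A\<^esub> b) \<otimes>\<^bsub>A\<^esub> d) =
      (\<Sum>p\<in>I. \<Sum>s\<in>I. \<sigma> (h p (a \<otimes>\<^bsub>A\<^esub> b)) (h s d) * c i (e p \<otimes>\<^bsub>L\<^esub> e s))"
    using a b d i by (simp add: coord_twisted twisted_closed sum_pairs[symmetric])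
  also have "\<dots> = (\<Sum>p\<in>I. \<Sum>s\<in>I. \<Sum>u\<in>I \<times> I. c p (ee u) * ?K (fst u) (snd u) s * c i (e p \<otimes>\<^bsub>L\<^esub> e s))"
    using a b d by (simp add: sigma_h_twisted_left sum_distrib_right)
  also have "\<dots> = (\<Sum>s\<in>I. \<Sum>u\<in>I \<times> I. \<Sum>p\<in>I. c p (ee u) * ?K (fst u) (snd u) s * c i (e p \<otimes>\<^bsub>L\<^esub> e s))"
    by (subst sum.swap, rule sum.cong[OF refl], rule sum.swap)
  also have "\<dots> = (\<Sum>s\<in>I. \<Sum>u\<in>I \<times> I. ?K (fst u) (snd u) s * (\<Sum>p\<in>I. c p (ee u) * c i (e p \<otimes>\<^bsub>L\<^esub> e s)))"
    by (simp add: sum_distrib_left ac_simps)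
  also have "\<dots> = (\<Sum>s\<in>I. \<Sum>u\<in>I \<times> I. ?K (fst u) (snd u) s * c i (ee u \<otimes>\<^bsub>L\<^esub> e s))"
    using i by (intro sum.cong refl) (auto simp: coord_mult_left)
  also have "\<dots> = (\<Sum>s\<in>I. \<Sum>p\<in>I. \<Sum>r\<in>I. ?K p r s * c i (e p \<otimes>\<^bsub>L\<^esub> e r \<otimes>\<^bsub>L\<^esub> e s))"
    by (intro sum.cong refl sum_pairs)
  finally have left: "c i ((a \<otimes>\<^bsub>A\<^esub> b) \<otimes>\<^bsub>A\<^esub> d) = \<dots>" .
  let ?K' = "\<lambda>p r s. convolution H \<sigma> (\<lambda>b2 c2. \<sigma> (h p a) (b2 \<otimes>\<^bsub>H\<^esub> c2)) (h r b) (h s d)"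
  have "c i (a \<otimes>\<^bsub>A\<^esub> (b \<otimes>\<^bsub>A\<^esub> d)) =
      (\<Sum>p\<in>I. \<Sum>m\<in>I. \<sigma> (h p a) (h m (b \<otimes>\<^bsub>A\<^esub> d)) * c i (e p \<otimes>\<^bsub>L\<^esub> e m))"
    using a b d i by (simp add: coord_twisted twisted_closed sum_pairs[symmetric])
  also have "\<dots> = (\<Sum>p\<in>I. \<Sum>m\<in>I. \<Sum>u\<in>I \<times> I. c m (ee u) * ?K' p (fst u) (snd u) * c i (e p \<otimes>\<^bsub>L\<^esub> e m))"
    using a b d by (simp add: sigma_h_twisted_right sum_distrib_right)
  also have "\<dots> = (\<Sum>p\<in>I. \<Sum>u\<in>I \<times> I. \<Sum>m\<in>I. c m (ee u) * ?K' p (fst u) (snd u) * c i (e p \<otimes>\<^bsub>L\<^esub> e m))"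
    by (rule sum.cong[OF refl], rule sum.swap)
  also have "\<dots> = (\<Sum>p\<in>I. \<Sum>u\<in>I \<times> I. ?K' p (fst u) (snd u) * (\<Sum>m\<in>I. c m (ee u) * c i (e p \<otimes>\<^bsub>L\<^esub> e m)))"
    by (simp add: sum_distrib_left ac_simps)
  also have "\<dots> = (\<Sum>p\<in>I. \<Sum>u\<in>I \<times> I. ?K' p (fst u) (snd u) * c i (e p \<otimes>\<^bsub>L\<^esub> ee u))"
    using i by (intro sum.cong refl) (auto simp: coord_mult_right)
  also have "\<dots> = (\<Sum>p\<in>I. \<Sum>r\<in>I. \<Sum>s\<in>I. ?K' p r s * c i (e p \<otimes>\<^bsub>L\<^esub> (e r \<otimes>\<^bsub>L\<^esub> e s)))"
    by (intro sum.cong refl sum_pairs)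
  also have "\<dots> = (\<Sum>p\<in>I. \<Sum>r\<in>I. \<Sum>s\<in>I. ?K p r s * c i (e p \<otimes>\<^bsub>L\<^esub> e r \<otimes>\<^bsub>L\<^esub> e s))"
    using a b d by (intro sum.cong refl) (simp add: S.cocycle_identity L.m_assoc)
  also have "\<dots> = (\<Sum>p\<in>I. \<Sum>s\<in>I. \<Sum>r\<in>I. ?K p r s * c i (e p \<otimes>\<^bsub>L\<^esub> e r \<otimes>\<^bsub>L\<^esub> e s))"
    by (rule sum.cong[OF refl], rule sum.swap)
  also have "\<dots> = (\<Sum>s\<in>I. \<Sum>p\<in>I. \<Sum>r\<in>I. ?K p r s * c i (e p \<otimes>\<^bsub>L\<^esub> e r \<otimes>\<^bsub>L\<^esub> e s))"
    by (rule sum.swap)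
  finally show "c i ((a \<otimes>\<^bsub>A\<^esub> b) \<otimes>\<^bsub>A\<^esub> d) = c i (a \<otimes>\<^bsub>A\<^esub> (b \<otimes>\<^bsub>A\<^esub> d))" using left by simp
qed (use a b d in \<open>simp_all add: twisted_closed\<close>)

lemma twisted_one:
  assumes a: "a \<in> carrier L"
  shows "\<one>\<^bsub>L\<^esub> \<otimes>\<^bsub>A\<^esub> a = a" "a \<otimes>\<^bsub>A\<^esub> \<one>\<^bsub>L\<^esub> = a"
proof -
  have s1: "\<sigma> (h p \<one>\<^bsub>L\<^esub>) (h r a) = c p \<one>\<^bsub>L\<^esub> * c r a" if "p \<in> I" "r \<in> I" for p r
    using that a linear_map_smult[OF bilinear_map_left[OF S.sigma_bilinear]]
    by (simp add: h_one S.sigma_one h_counit)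
  have s2: "\<sigma> (h r a) (h p \<one>\<^bsub>L\<^esub>) = c p \<one>\<^bsub>L\<^esub> * c r a" if "p \<in> I" "r \<in> I" for p r
    using that a linear_map_smult[OF bilinear_map_right[OF S.sigma_bilinear]]
    by (simp add: h_one S.sigma_one h_counit)
  show "\<one>\<^bsub>L\<^esub> \<otimes>\<^bsub>A\<^esub> a = a"
  proof (rule L.coord_eqI)
    fix i assume i: "i \<in> I"
    have "c i (\<one>\<^bsub>L\<^esub> \<otimes>\<^bsub>A\<^esub> a) = (\<Sum>p\<in>I. \<Sum>r\<in>I. \<sigma> (h p \<one>\<^bsub>L\<^esub>) (h r a) * c i (e p \<otimes>\<^bsub>L\<^esub> e r))"
      using a i by (simp add: coord_twisted sum_pairs[symmetric])
    also have "\<dots> = (\<Sum>p\<in>I. \<Sum>r\<in>I. c p \<one>\<^bsub>L\<^esub> * c r a * c i (e p \<otimes>\<^bsub>L\<^esub> e r))"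
      using s1 by simp
    also have "\<dots> = (\<Sum>p\<in>I. c p \<one>\<^bsub>L\<^esub> * (\<Sum>r\<in>I. c r a * c i (e p \<otimes>\<^bsub>L\<^esub> e r)))"
      by (simp add: sum_distrib_left mult.assoc)
    also have "\<dots> = c i a"
      using a i by (simp add: coord_mult_right coord_mult_left)
    finally show "c i (\<one>\<^bsub>L\<^esub> \<otimes>\<^bsub>A\<^esub> a) = c i a" .
  qed (use a in \<open>simp_all add: twisted_closed\<close>)
  show "a \<otimes>\<^bsub>A\<^esub> \<one>\<^bsub>L\<^esub> = a"
  proof (rule L.coord_eqI)
    fix i assume i: "i \<in> I"
    have "c i (a \<otimes>\<^bsub>A\<^esub> \<one>\<^bsub>L\<^esub>) = (\<Sum>r\<in>I. \<Sum>p\<in>I. \<sigma> (h r a) (h p \<one>\<^bsub>L\<^esub>) * c i (e r \<otimes>\<^bsub>L\<^esub> e p))"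
      using a i by (simp add: coord_twisted sum_pairs[symmetric])
    also have "\<dots> = (\<Sum>r\<in>I. \<Sum>p\<in>I. c p \<one>\<^bsub>L\<^esub> * c r a * c i (e r \<otimes>\<^bsub>L\<^esub> e p))"
      using s2 by simp
    also have "\<dots> = (\<Sum>r\<in>I. c r a * (\<Sum>p\<in>I. c p \<one>\<^bsub>L\<^esub> * c i (e r \<otimes>\<^bsub>L\<^esub> e p)))"
      by (simp add: sum_distrib_left ac_simps)
    also have "\<dots> = c i a"
      using a i coord_mult_left[OF i a L.one_closed] by (simp add: coord_mult_right)
    finally show "c i (a \<otimes>\<^bsub>A\<^esub> \<one>\<^bsub>L\<^esub>) = c i a" .
  qed (use a in \<open>simp_all add: twisted_closed\<close>)
qed

lemma twisted_bilinear: "bilinear_map L L L (\<lambda>a b. a \<otimes>\<^bsub>A\<^esub> b)"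
proof (rule bilinear_mapI)
  fix a assume a: "a \<in> carrier L"
  have "linear_map L L (\<lambda>b. \<Oplus>\<^bsub>L\<^esub>w\<in>I \<times> I. ss w a b \<odot>\<^bsub>L\<^esub> ee w)"
    using a by (intro linear_map_sum linear_map_scale_vector L.k_space_axioms
        linear_map_comp[OF h_linear bilinear_map_right[OF S.sigma_bilinear]]) auto
  then show "linear_map L L (\<lambda>b. a \<otimes>\<^bsub>A\<^esub> b)"
    by (rule linear_map_cong) (simp_all add: a twisted_mult L.k_space_axioms)
next
  fix b assume b: "b \<in> carrier L"
  have "linear_map L L (\<lambda>a. \<Oplus>\<^bsub>L\<^esub>w\<in>I \<times> I. ss w a b \<odot>\<^bsub>L\<^esub> ee w)"
    using b by (intro linear_map_sum linear_map_scale_vector L.k_space_axioms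
        linear_map_comp[OF h_linear bilinear_map_left[OF S.sigma_bilinear]]) auto
  then show "linear_map L L (\<lambda>a. a \<otimes>\<^bsub>A\<^esub> b)"
    by (rule linear_map_cong) (simp_all add: b twisted_mult L.k_space_axioms)
qed

lemma k_algebra_twisted: "k_algebra A"
proof -
  have kA: "k_space A"
    by (rule same_space_k_space[OF same_space_twisted_algebra L.k_space_axioms])
  then interpret A: k_space A .
  note r = bilinear_map_right[OF twisted_bilinear] and l = bilinear_map_left[OF twisted_bilinear]
  show ?thesis
  proof (rule k_algebra.intro)
    show "module (ring_of_type_algebra :: 'k ring) A" by (rule A.module)
    show "ring A"
      by (intro ringI A.abelian_group_axioms monoidI)
         (simp_all add: twisted_closed twisted_assoc twisted_one linear_map_add[OF r] linear_map_add[OF l])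
  qed (simp_all add: linear_map_smult[OF r] linear_map_smult[OF l])
qed

text \<open>
  The threefold coproducts of both factors give a fourfold sum over the basis; the sums over the legs
  that enter \<open>\<sigma>\<close> are those in \<open>G\<close>.
\<close>

lemma deformed_mult:
  assumes p: "p \<in> I" and r: "r \<in> I" and a: "a \<in> carrier L" and b: "b \<in> carrier L"
  shows "h p a \<otimes>\<^bsub>D\<^esub> h r b =
    (\<Oplus>\<^bsub>H\<^esub>u\<in>I \<times> I. \<tau> (h p (e (fst u))) (h r (e (snd u))) \<odot>\<^bsub>H\<^esub> G a b u)"
proof -
  let ?F = "\<lambda>a1 a2 a3 b1 b2 b3. (\<sigma> a1 b1 * \<tau> a3 b3) \<odot>\<^bsub>H\<^esub> (a2 \<otimes>\<^bsub>H\<^esub> b2)"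
  note T = S.deformed_product_trilinear and T' = S.deformed_product_trilinear_left[OF h_closed[OF r b]]
  let ?f = "\<lambda>u1 w1 u2 w2. (\<sigma> (h w1 a) (h w2 b) * \<tau> (h p (e u1)) (h r (e u2))) \<odot>\<^bsub>H\<^esub>
      (h u1 (e w1) \<otimes>\<^bsub>H\<^esub> h u2 (e w2))"
  have "h p a \<otimes>\<^bsub>D\<^esub> h r b = sweedler3 H H (\<lambda>a1 a2 a3. sweedler3 H H (?F a1 a2 a3) (h r b)) (h p a)"
    by (simp add: cocycle_deformation_def)
  also have "\<dots> = (\<Oplus>\<^bsub>H\<^esub>u1\<in>I. \<Oplus>\<^bsub>H\<^esub>w1\<in>I. sweedler3 H H (?F (h w1 a) (h u1 (e w1)) (h p (e u1))) (h r b))"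
    by (rule sweedler3_coefficients[OF H.k_space_axioms T' p a])
  also have "\<dots> = (\<Oplus>\<^bsub>H\<^esub>u1\<in>I. \<Oplus>\<^bsub>H\<^esub>w1\<in>I. \<Oplus>\<^bsub>H\<^esub>u2\<in>I. \<Oplus>\<^bsub>H\<^esub>w2\<in>I. ?f u1 w1 u2 w2)"
    using p r a b
    by (intro H.finsum_cong' sweedler3_coefficients[OF H.k_space_axioms T])
       (auto intro!: H.finsum_closed)
  also have "\<dots> = (\<Oplus>\<^bsub>H\<^esub>u1\<in>I. \<Oplus>\<^bsub>H\<^esub>u2\<in>I. \<Oplus>\<^bsub>H\<^esub>w1\<in>I. \<Oplus>\<^bsub>H\<^esub>w2\<in>I. ?f u1 w1 u2 w2)"
    by (intro H.finsum_cong' H.finsum_swap) (auto intro!: H.finsum_closed)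
  also have "\<dots> = (\<Oplus>\<^bsub>H\<^esub>u1\<in>I. \<Oplus>\<^bsub>H\<^esub>u2\<in>I. \<Oplus>\<^bsub>H\<^esub>w\<in>I \<times> I. ?f u1 (fst w) u2 (snd w))"
    by (intro H.finsum_cong' H.finsum_cartesian) (auto intro!: H.finsum_closed)
  also have "\<dots> = (\<Oplus>\<^bsub>H\<^esub>u\<in>I \<times> I. \<Oplus>\<^bsub>H\<^esub>w\<in>I \<times> I. ?f (fst u) (fst w) (snd u) (snd w))"
    by (intro H.finsum_cartesian) (auto intro!: H.finsum_closed)
  also have "\<dots> = (\<Oplus>\<^bsub>H\<^esub>u\<in>I \<times> I. \<tau> (h p (e (fst u))) (h r (e (snd u))) \<odot>\<^bsub>H\<^esub> G a b u)"
  proof (intro H.finsum_cong')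
    fix u assume u: "u \<in> I \<times> I"
    let ?t = "\<tau> (h p (e (fst u))) (h r (e (snd u)))"
    have "?t \<odot>\<^bsub>H\<^esub> G a b u = (\<Oplus>\<^bsub>H\<^esub>w\<in>I \<times> I. ?t \<odot>\<^bsub>H\<^esub> (ss w a b \<odot>\<^bsub>H\<^esub>
        (h (fst u) (e (fst w)) \<otimes>\<^bsub>H\<^esub> h (snd u) (e (snd w)))))"
      unfolding G_def using u by (intro H.smult_finsum) auto
    also have "\<dots> = (\<Oplus>\<^bsub>H\<^esub>w\<in>I \<times> I. ?f (fst u) (fst w) (snd u) (snd w))"
      using u by (intro H.finsum_cong') (auto simp: H.smult_smult mult.commute)
    finally show "(\<Oplus>\<^bsub>H\<^esub>w\<in>I \<times> I. ?f (fst u) (fst w) (snd u) (snd w)) = ?t \<odot>\<^bsub>H\<^esub> G a b u" ..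
  qed auto
  finally show ?thesis .
qed

text \<open>
  This is where \<open>\<sigma>\<close> cancels: the structure constants of the twist carry a factor \<open>\<sigma>\<close>, the deformed
  product carries its inverse \<open>\<tau>\<close>, and their convolution is the product of the counits, which picks the
  structure constants of \<open>L\<close>.
\<close>

lemma twisted_structure_tau:
  assumes i: "i \<in> I" and u: "u \<in> I \<times> I"
  shows "(\<Sum>w\<in>I \<times> I. c i (e (fst w) \<otimes>\<^bsub>A\<^esub> e (snd w)) *
      \<tau> (h (fst w) (e (fst u))) (h (snd w) (e (snd u)))) = c i (ee u)"
proof -
  let ?t = "\<lambda>w. \<tau> (h (fst w) (e (fst u))) (h (snd w) (e (snd u)))"
  have "(\<Sum>w\<in>I \<times> I. c i (e (fst w) \<otimes>\<^bsub>A\<^esub> e (snd w)) * ?t w) =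
      (\<Sum>w\<in>I \<times> I. \<Sum>v\<in>I \<times> I. ss v (e (fst w)) (e (snd w)) * c i (ee v) * ?t w)"
    using i by (intro sum.cong refl) (auto simp: coord_twisted sum_distrib_right)
  also have "\<dots> = (\<Sum>v\<in>I \<times> I. \<Sum>w\<in>I \<times> I. ss v (e (fst w)) (e (snd w)) * c i (ee v) * ?t w)"
    by (rule sum.swap)
  also have "\<dots> = (\<Sum>v\<in>I \<times> I. c i (ee v) * (\<Sum>w\<in>I \<times> I. ?t w * ss v (e (fst w)) (e (snd w))))"
    by (simp add: sum_distrib_left ac_simps)
  also have "\<dots> = (\<Sum>v\<in>I \<times> I. c i (ee v) *
      convolution H \<tau> \<sigma> (h (fst v) (e (fst u))) (h (snd v) (e (snd u))))"
    using u by (intro sum.cong refl arg_cong2[where f = "(*)"])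
      (subst convolution_coefficients[OF S.tau_bilinear S.sigma_bilinear]; auto)
  also have "\<dots> = (\<Sum>v\<in>I \<times> I. c i (ee v) * (if v = u then 1 else 0))"
    using u by (intro sum.cong refl) (auto simp: S.tau_sigma h_counit L.coord_e split: if_splits)
  also have "\<dots> = c i (ee u)"
    using u by (simp add: if_distrib cong: if_cong)
  finally show ?thesis .
qed

lemma h_twisted_mult:
  assumes i: "i \<in> I" and a: "a \<in> carrier L" and b: "b \<in> carrier L"
  shows "h i (a \<otimes>\<^bsub>A\<^esub> b) = (\<Oplus>\<^bsub>H\<^esub>w\<in>I \<times> I. c i (e (fst w) \<otimes>\<^bsub>A\<^esub> e (snd w)) \<odot>\<^bsub>H\<^esub>
     (h (fst w) a \<otimes>\<^bsub>D\<^esub> h (snd w) b))"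
proof -
  have "(\<Oplus>\<^bsub>H\<^esub>w\<in>I \<times> I. c i (e (fst w) \<otimes>\<^bsub>A\<^esub> e (snd w)) \<odot>\<^bsub>H\<^esub> (h (fst w) a \<otimes>\<^bsub>D\<^esub> h (snd w) b)) =
    (\<Oplus>\<^bsub>H\<^esub>w\<in>I \<times> I. c i (e (fst w) \<otimes>\<^bsub>A\<^esub> e (snd w)) \<odot>\<^bsub>H\<^esub>
      (\<Oplus>\<^bsub>H\<^esub>u\<in>I \<times> I. \<tau> (h (fst w) (e (fst u))) (h (snd w) (e (snd u))) \<odot>\<^bsub>H\<^esub> G a b u))"
    using a b by (intro H.finsum_cong') (auto simp: deformed_mult intro!: H.finsum_closed H.smult_closed)
  also have "\<dots> = (\<Oplus>\<^bsub>H\<^esub>u\<in>I \<times> I. (\<Sum>w\<in>I \<times> I. c i (e (fst w) \<otimes>\<^bsub>A\<^esub> e (snd w)) *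
      \<tau> (h (fst w) (e (fst u))) (h (snd w) (e (snd u)))) \<odot>\<^bsub>H\<^esub> G a b u)"
    by (intro H.finsum_smult_swap) auto
  also have "\<dots> = h i (a \<otimes>\<^bsub>A\<^esub> b)"
    unfolding h_twisted[OF assms]
    by (intro H.finsum_cong') (auto simp: twisted_structure_tau i)
  finally show ?thesis ..
qed

theorem twisted_coefficient_family: "coefficient_family D A I e c h"
proof -
  have DH: "same_space (tensor D D) (tensor H H)"
    by (intro same_space_tensor same_space_sym[OF same_space_cocycle_deformation])
  have pure: "pure_tensor D D = pure_tensor H H"
    by (intro same_space_pure_tensor same_space_sym[OF same_space_cocycle_deformation])
  have lin: "linear_map A D (h i)" if "i \<in> I" for i
    using h_linear[OF that] same_space_linear_map[OF same_space_twisted_algebra same_space_cocycle_deformation]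
    by blast
  show ?thesis
    unfolding coefficient_family_def same_space_finsum[OF DH] pure
      same_space_finsum[OF same_space_sym[OF same_space_cocycle_deformation]]
    using lin h_twisted_mult by (simp add: h_one h_comult h_counit)
qed

end

section \<open>Transport along an isomorphism of Hopf algebras\<close>

lemma alg_hom_linear_map: "f \<in> alg_hom A B \<Longrightarrow> linear_map A B f"
  by (auto simp: alg_hom_def ring_hom_def linear_map_def)

lemma alg_hom_mult: "f \<in> alg_hom A B \<Longrightarrow> a \<in> carrier A \<Longrightarrow> b \<in> carrier A \<Longrightarrow> f (a \<otimes>\<^bsub>A\<^esub> b) = f a \<otimes>\<^bsub>B\<^esub> f b"
  by (auto simp: alg_hom_def ring_hom_def)

lemma alg_hom_one: "f \<in> alg_hom A B \<Longrightarrow> f \<one>\<^bsub>A\<^esub> = \<one>\<^bsub>B\<^esub>"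
  by (auto simp: alg_hom_def ring_hom_def)

lemma hopf_isoD:
  assumes "hopf_iso H U \<iota>"
  shows "is_bialgebra H" "is_bialgebra U" "\<iota> \<in> alg_hom H U" "linear_map H U \<iota>"
    "a \<in> carrier H \<Longrightarrow> counit U (\<iota> a) = counit H a"
    "a \<in> carrier H \<Longrightarrow> comult U (\<iota> a) =
      tensor_lift (tensor U U) (\<lambda>a1 a2. pure_tensor U U (\<iota> a1) (\<iota> a2)) (comult H a)"
  using assms by (auto simp: hopf_iso_def is_hopf_algebra_def alg_hom_linear_map)

lemma (in coefficients) push_coefficient_family:
  assumes iso: "hopf_iso H U \<iota>"
  shows "coefficient_family U L I e c (\<lambda>i a. \<iota> (h i a))"
proof -
  note \<iota> = hopf_isoD(4)[OF iso]
  interpret U: k_algebra U using bialgebraD(1)[OF hopf_isoD(2)[OF iso]] .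
  interpret UU: tensor_factors U U by (intro tensor_factorsI U.k_space_axioms)
  have B: "bilinear_map H H (tensor U U) (\<lambda>a1 a2. pure_tensor U U (\<iota> a1) (\<iota> a2))"
    by (rule bilinear_map_comp[OF UU.bilinear_pure_tensor \<iota> \<iota>])
  have mult: "\<iota> (h i (a \<otimes>\<^bsub>L\<^esub> b)) = (\<Oplus>\<^bsub>U\<^esub>w\<in>I \<times> I. c i (e (fst w) \<otimes>\<^bsub>L\<^esub> e (snd w)) \<odot>\<^bsub>U\<^esub>
      (\<iota> (h (fst w) a) \<otimes>\<^bsub>U\<^esub> \<iota> (h (snd w) b)))"
    if "i \<in> I" "a \<in> carrier L" "b \<in> carrier L" for i a b
  proof -
    have "\<iota> (h i (a \<otimes>\<^bsub>L\<^esub> b)) = (\<Oplus>\<^bsub>U\<^esub>w\<in>I \<times> I. \<iota> (c i (e (fst w) \<otimes>\<^bsub>L\<^esub> e (snd w)) \<odot>\<^bsub>H\<^esub>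
      (h (fst w) a \<otimes>\<^bsub>H\<^esub> h (snd w) b)))"
      unfolding h_mult[OF that] using that
      by (intro linear_map_finsum[OF H.k_space_axioms U.k_space_axioms \<iota>]) auto
    also have "\<dots> = (\<Oplus>\<^bsub>U\<^esub>w\<in>I \<times> I. c i (e (fst w) \<otimes>\<^bsub>L\<^esub> e (snd w)) \<odot>\<^bsub>U\<^esub>
      (\<iota> (h (fst w) a) \<otimes>\<^bsub>U\<^esub> \<iota> (h (snd w) b)))"
      using that linear_map_closed[OF \<iota>]
      by (intro U.finsum_cong') (auto simp: linear_map_smult[OF \<iota>] alg_hom_mult[OF hopf_isoD(3)[OF iso]])
    finally show ?thesis .
  qed
  show ?thesis
    unfolding coefficient_family_def
    using linear_map_comp[OF h_linear \<iota>] mult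
    by (auto simp: h_one linear_map_smult[OF \<iota>] alg_hom_one[OF hopf_isoD(3)[OF iso]]
        hopf_isoD(5,6)[OF iso] lift_comult[OF UU.k_space_tensor B] h_counit)
qed

text \<open>
  The coefficients of the coaction on the twist are the images under \<open>\<iota>\<close> of the coefficients of \<open>\<delta>\<close>.
\<close>

theorem twisted_comodule_algebra:
  fixes H :: "('k::field, 'h) bialgebra" and U :: "('k, 'u) bialgebra" and L :: "('k, 'l) module"
  assumes H: "is_bialgebra H" and cocycle: "hopf_2_cocycle H \<sigma>"
    and iso: "hopf_iso (cocycle_deformation H \<sigma>) U \<iota>"
    and com: "left_comodule_algebra H L \<delta>" and basis: "finite_basis L I e c"
  shows "left_comodule_algebra U (twisted_algebra \<sigma> L \<delta>) (push_coaction U L \<iota> \<delta>)"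
proof -
  let ?D = "cocycle_deformation H \<sigma>" and ?A = "twisted_algebra \<sigma> L \<delta>"
  interpret L: finite_basis L I e c by fact
  interpret H: k_algebra H by (rule bialgebraD(1)[OF H])
  interpret La: k_algebra L using com by (simp add: left_comodule_algebra_def)
  interpret HL: based_comodule_setup H L I e c
    by (intro based_comodule_setup.intro based_tensor.intro bialgI H
        La.k_algebra_axioms H.k_space_axioms basis)
  obtain h where h: "coefficient_family H L I e c h"
    "\<And>a. a \<in> carrier L \<Longrightarrow> \<delta> a = (\<Oplus>\<^bsub>tensor H L\<^esub>i\<in>I. pure_tensor H L (h i a) (e i))"
    using HL.comodule_algebra_imp_coefficient_family[OF com] by blast
  interpret tw: twisting H L I e c h \<sigma> \<delta>
    by (intro twisting.intro coefficients.intro coefficients_axioms.intro twisting_axioms.intro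
        cocycle.intro cocycle_axioms.intro bialgI[OF H] HL.based_comodule_setup_axioms h cocycle)
  interpret D: k_algebra ?D using bialgebraD(1)[OF hopf_isoD(1)[OF iso]] .
  interpret A: k_algebra ?A by (rule tw.k_algebra_twisted)
  interpret U: k_algebra U using bialgebraD(1)[OF hopf_isoD(2)[OF iso]] .
  have basisA: "finite_basis ?A I e c"
    by (rule same_space_finite_basis[OF same_space_twisted_algebra basis])
  interpret DA: coefficients ?D ?A I e c h
    by (intro coefficients.intro coefficients_axioms.intro based_comodule_setup.intro based_tensor.intro
        bialgI[OF hopf_isoD(1)[OF iso]] A.k_algebra_axioms D.k_space_axioms
        basisA tw.twisted_coefficient_family)
  interpret UA: based_comodule_setup U ?A I e c
    by (intro based_comodule_setup.intro based_tensor.intro bialgI[OF hopf_isoD(2)[OF iso]]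
        A.k_algebra_axioms U.k_space_axioms basisA)
  interpret UL: tensor_factors U L
    by (intro tensor_factorsI U.k_space_axioms L.k_space_axioms)
  have \<iota>: "linear_map H U \<iota>"
    using hopf_isoD(4)[OF iso] same_space_linear_map[OF same_space_cocycle_deformation same_space_refl] by blast
  have B: "bilinear_map H L (tensor U L) (\<lambda>h l. pure_tensor U L (\<iota> h) l)"
    by (rule bilinear_map_comp[OF UL.bilinear_pure_tensor \<iota> linear_map_id])
  show ?thesis
  proof (rule UA.coefficient_family_imp_comodule_algebra[OF DA.push_coefficient_family[OF iso]])
    fix a assume "a \<in> carrier ?A"
    then have a: "a \<in> carrier L" by simp
    have "push_coaction U L \<iota> \<delta> a = (\<Oplus>\<^bsub>tensor U L\<^esub>i\<in>I. pure_tensor U L (\<iota> (h i a)) (e i))"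
      unfolding push_coaction_def
      using a by (intro HL.tensor_lift_expansion[OF UL.k_space_tensor B _ h(2)]) auto
    then show "push_coaction U L \<iota> \<delta> a = (\<Oplus>\<^bsub>tensor U ?A\<^esub>i\<in>I. pure_tensor U ?A (\<iota> (h i a)) (e i))"
      by (simp add: same_space_finsum[OF same_space_tensor[OF same_space_refl same_space_twisted_algebra[of L \<sigma> \<delta>]]]
          same_space_pure_tensor[OF same_space_refl same_space_twisted_algebra[of L \<sigma> \<delta>]])
  qed
qed

section \<open>Presentations with one generator\<close>

lemma ring_ring_of_type_algebra: "ring (ring_of_type_algebra :: 'a::ring_1 ring)"
proof (rule ringI)
  show "abelian_group (ring_of_type_algebra :: 'a ring)"
  proof (rule abelian_groupI)
    fix x :: 'a
    show "\<exists>y\<in>carrier ring_of_type_algebra. y \<oplus>\<^bsub>ring_of_type_algebra\<^esub> x = \<zero>\<^bsub>ring_of_type_algebra\<^esub>"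
      by (rule bexI[of _ "- x"]) simp_all
  qed (simp_all add: ac_simps)
  show "Group.monoid (ring_of_type_algebra :: 'a ring)"
    by (rule monoidI) (simp_all add: mult.assoc)
qed (simp_all add: algebra_simps)

lemma const_one: "const 1 = 1"
  using single_one by (metis zero_list_def)

context k_algebra
begin

lemma smult_mult_smult:
  "a \<in> carrier A \<Longrightarrow> b \<in> carrier A \<Longrightarrow> (r \<odot> a) \<otimes> (s \<odot> b) = (r * s) \<odot> (a \<otimes> b)"
  by (simp add: smult_mult_left smult_mult_right smult_smult mult.commute)

lemma word_eval_closed: "range f \<subseteq> carrier A \<Longrightarrow> word_eval A f w \<in> carrier A"
  by (induction w) (auto simp: word_eval_def)

lemma word_eval_Nil [simp]: "word_eval A f [] = \<one>"
  and word_eval_Cons [simp]: "word_eval A f (s # w) = f s \<otimes> word_eval A f w"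
  by (simp_all add: word_eval_def)

lemma word_eval_append:
  "range f \<subseteq> carrier A \<Longrightarrow> word_eval A f (v @ w) = word_eval A f v \<otimes> word_eval A f w"
  by (induction v) (simp_all add: word_eval_closed m_assoc image_subset_iff)

lemma free_eval_eq: "free_eval A f = linear_extension A (word_eval A f)"
  by (simp add: free_eval_def linear_extension_def fun_eq_iff)

context
  fixes f :: "'g \<Rightarrow> 'a" assumes f: "range f \<subseteq> carrier A"
begin

lemma free_eval_closed: "free_eval A f p \<in> carrier A"
  unfolding free_eval_eq by (intro linear_extension_closed word_eval_closed f)

lemma free_eval_add: "free_eval A f (p + r) = free_eval A f p \<oplus> free_eval A f r"
  unfolding free_eval_eq by (intro linear_extension_add word_eval_closed f)

lemma free_eval_single: "free_eval A f (Poly_Mapping.single w c) = c \<odot> word_eval A f w"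
  unfolding free_eval_eq by (intro linear_extension_single word_eval_closed f)

lemma free_eval_mult: "free_eval A f (p * r) = free_eval A f p \<otimes> free_eval A f r"
proof (induction p rule: poly_mapping_induct_add)
  case (single v a)
  show ?case
  proof (induction r rule: poly_mapping_induct_add)
    case (single w b)
    show ?case
      by (simp add: mult_single plus_list_def free_eval_single word_eval_append[OF f] word_eval_closed[OF f]
          smult_mult_smult)
  next
    case (add r r')
    then show ?case by (simp add: distrib_left free_eval_add r_distr free_eval_closed)
  qed
next
  case (add p p')
  then show ?case by (simp add: distrib_right free_eval_add l_distr free_eval_closed)
qed

lemma free_eval_one: "free_eval A f 1 = \<one>"
  using free_eval_single[of "[]" 1] by (simp add: const_one)

lemma free_eval_gen: "free_eval A f (gen s) = f s"
  by (simp add: free_eval_single range_subsetD[OF f])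

lemma free_eval_const: "free_eval A f (const c) = c \<odot> \<one>"
  by (simp add: free_eval_single)

lemma free_eval_diff: "free_eval A f (p - r) = free_eval A f p \<ominus> free_eval A f r"
  using free_eval_add[of "p - r" r] free_eval_closed
    add.inv_solve_right[of "free_eval A f (p - r)" "free_eval A f p" "free_eval A f r"]
  by (simp add: a_minus_def)

lemma free_eval_pow: "free_eval A f (p ^ n) = free_eval A f p [^] n"
  by (induction n) (simp_all add: free_eval_one free_eval_mult power_Suc2 del: power_Suc)

lemma free_eval_ring_hom: "ring_hom_ring ring_of_type_algebra A (free_eval A f)"
  by (intro ring_hom_ringI2 ring_ring_of_type_algebra is_ring ring_hom_memI)
     (simp_all add: free_eval_closed free_eval_mult free_eval_add free_eval_one)

end

end

lemma presented_byD:
  assumes "presented_by A f R"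
  shows "k_algebra A" "range f \<subseteq> carrier A" "range (free_eval A f) = carrier A"
    "r \<in> R \<Longrightarrow> free_eval A f r = \<zero>\<^bsub>A\<^esub>"
proof -
  show "k_algebra A" "range f \<subseteq> carrier A" "range (free_eval A f) = carrier A"
    using assms by (simp_all add: presented_by_def)
  assume "r \<in> R"
  then have "r \<in> a_kernel ring_of_type_algebra A (free_eval A f)"
    using assms ring.genideal_self[OF ring_ring_of_type_algebra, of R] by (auto simp: presented_by_def)
  then show "free_eval A f r = \<zero>\<^bsub>A\<^esub>"
    by (simp add: a_kernel_def')
qed

text \<open>
  A word in one letter is determined by its length, so the free algebra on one generator is the
  polynomial ring. Passing to polynomials makes division with remainder available.
\<close>

definition to_poly :: "('k::field, unit) free_algebra \<Rightarrow> 'k poly" where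
  "to_poly p = (\<Sum>w\<in>Poly_Mapping.keys p. monom (Poly_Mapping.lookup p w) (length w))"

lemma to_poly_add: "to_poly (p + r) = to_poly p + to_poly r"
  unfolding to_poly_def by (rule setsum_keys_plus_distrib) (simp_all add: add_monom)

lemma to_poly_single: "to_poly (Poly_Mapping.single w c) = monom c (length w)"
  by (cases "c = 0") (simp_all add: to_poly_def)

lemma to_poly_mult: "to_poly (p * r) = to_poly p * to_poly r"
proof (induction p rule: poly_mapping_induct_add)
  case (single v a)
  show ?case
    by (induction r rule: poly_mapping_induct_add)
       (simp_all add: mult_single plus_list_def to_poly_single mult_monom distrib_left to_poly_add)
qed (simp add: distrib_right to_poly_add)

lemma to_poly_diff: "to_poly (p - r) = to_poly p - to_poly r"
  using to_poly_add[of "p - r" r] by (simp add: algebra_simps)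

lemma to_poly_zero: "to_poly 0 = 0"
  by (simp add: to_poly_def)

lemma to_poly_one: "to_poly 1 = 1"
  using to_poly_single[of "[]" 1] by (simp add: monom_0 one_pCons const_one)

lemma to_poly_sum: "to_poly (sum f I) = (\<Sum>i\<in>I. to_poly (f i))"
  by (induction I rule: infinite_finite_induct) (simp_all add: to_poly_zero to_poly_add)

lemma to_poly_pow: "to_poly (p ^ n) = to_poly p ^ n"
  by (induction n) (simp_all add: to_poly_one to_poly_mult)

lemma coeff_to_poly: "coeff (to_poly p) n = Poly_Mapping.lookup p (replicate n ())"
proof (induction p rule: poly_mapping_induct_add)
  case (single w c)
  have "w = replicate n () \<longleftrightarrow> length w = n"
    by (metis length_replicate replicate_length_same unit.exhaust)
  then show ?case by (auto simp: to_poly_single lookup_single when_def)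
qed (simp add: to_poly_add lookup_add)

lemma bij_to_poly: "bij (to_poly :: ('k::field, unit) free_algebra \<Rightarrow> 'k poly)"
proof (rule bijI)
  show "inj (to_poly :: ('k, unit) free_algebra \<Rightarrow> _)"
  proof (rule injI, rule poly_mapping_eqI)
    fix p r :: "('k, unit) free_algebra" and w :: "unit list" assume "to_poly p = to_poly r"
    moreover have "w = replicate (length w) ()"
      by (metis replicate_length_same unit.exhaust)
    ultimately show "Poly_Mapping.lookup p w = Poly_Mapping.lookup r w"
      by (metis coeff_to_poly)
  qed
  show "surj (to_poly :: ('k, unit) free_algebra \<Rightarrow> _)"
  proof (rule surjI)
    show "to_poly (\<Sum>i\<le>degree f. Poly_Mapping.single (replicate i ()) (coeff f i)) = f" for f :: "'k poly"
      by (simp add: to_poly_sum to_poly_single poly_as_sum_of_monoms)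
  qed
qed

definition poly_eval :: "('k::field, 'a, 'm) module_scheme \<Rightarrow> 'a \<Rightarrow> 'k poly \<Rightarrow> 'a" where
  "poly_eval A w f = free_eval A (\<lambda>_. w) (inv_into UNIV to_poly f)"

lemma free_eval_eq_poly_eval: "free_eval A (\<lambda>_. w) p = poly_eval A w (to_poly p)"
  by (simp add: poly_eval_def bij_is_inj[OF bij_to_poly])

locale pointed_algebra = k_algebra A
  for A :: "('k::field, 'a, 'm) module_scheme" (structure) + fixes w :: 'a
  assumes w_closed [simp]: "w \<in> carrier A"
begin

lemma range_w: "range (\<lambda>_::unit. w) \<subseteq> carrier A" by simp

lemma to_poly_ex: "\<exists>p. f = to_poly p"
  using bij_is_surj[OF bij_to_poly] by (metis surjD)

lemma poly_eval_closed [simp]: "poly_eval A w f \<in> carrier A"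
  unfolding poly_eval_def by (rule free_eval_closed[OF range_w])

lemma poly_eval_add: "poly_eval A w (f + h) = poly_eval A w f \<oplus> poly_eval A w h"
  using to_poly_ex[of f] to_poly_ex[of h] free_eval_add[OF range_w]
  by (metis free_eval_eq_poly_eval to_poly_add)

lemma poly_eval_diff: "poly_eval A w (f - h) = poly_eval A w f \<ominus> poly_eval A w h"
  using to_poly_ex[of f] to_poly_ex[of h] free_eval_diff[OF range_w]
  by (metis free_eval_eq_poly_eval to_poly_diff)

lemma poly_eval_mult: "poly_eval A w (f * h) = poly_eval A w f \<otimes> poly_eval A w h"
  using to_poly_ex[of f] to_poly_ex[of h] free_eval_mult[OF range_w]
  by (metis free_eval_eq_poly_eval to_poly_mult)

lemma poly_eval_monom: "poly_eval A w (Polynomial.monom c n) = c \<odot> w [^] n"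
proof -
  have "word_eval A (\<lambda>_. w) (replicate n ()) = w [^] n"
    by (induction n) (simp, metis nat_pow_Suc2 replicate_Suc w_closed word_eval_Cons)
  then show ?thesis
    using free_eval_single[OF range_w, of "replicate n ()" c] free_eval_eq_poly_eval[of A w]
    by (simp add: to_poly_single)
qed

lemma poly_eval_smult: "poly_eval A w (smult c f) = c \<odot> poly_eval A w f"
  using poly_eval_mult[of "Polynomial.monom c 0" f] poly_eval_monom[of c 0]
  by (simp add: smult_mult_left monom_0)

lemma poly_eval_zero [simp]: "poly_eval A w 0 = \<zero>"
  using poly_eval_monom[of 0 0] by simp

lemma poly_eval_one [simp]: "poly_eval A w 1 = \<one>"
  using poly_eval_monom[of 1 0] by (simp add: monom_0 one_pCons)

lemma poly_eval_X [simp]: "poly_eval A w [:0, 1:] = w"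
  using poly_eval_monom[of 1 1] by (simp add: monom_altdef)

lemma poly_eval_sum: "poly_eval A w (sum f I) = (\<Oplus>i\<in>I. poly_eval A w (f i))"
  by (induction I rule: infinite_finite_induct) (simp_all add: poly_eval_add Pi_def)

text \<open>
  Modulo a monic polynomial of degree \<open>n\<close> every polynomial has a unique representative of degree below
  \<open>n\<close>. So a monic relation presents \<open>A\<close> iff it holds in \<open>A\<close> and evaluation is bijective on the
  polynomials of degree below \<open>n\<close>.
\<close>

lemma presented_by_monic_iff:
  assumes monic: "Polynomial.coeff (to_poly \<rho>) n = 1" and deg: "Polynomial.degree (to_poly \<rho>) = n" and n: "n > 0"
  shows "presented_by A (\<lambda>_::unit. w) {\<rho>} \<longleftrightarrow>
    poly_eval A w (to_poly \<rho>) = \<zero> \<and>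
    (\<forall>a\<in>carrier A. \<exists>f. Polynomial.degree f < n \<and> poly_eval A w f = a) \<and>
    (\<forall>f. Polynomial.degree f < n \<longrightarrow> poly_eval A w f = \<zero> \<longrightarrow> f = 0)"
    (is "?P \<longleftrightarrow> ?zero \<and> ?span \<and> ?indep")
proof
  let ?R = "ring_of_type_algebra :: ('k, unit) free_algebra ring"
  let ?r = "to_poly \<rho>"
  interpret R: ring ?R by (rule ring_ring_of_type_algebra)
  have r: "?r \<noteq> 0" using deg n by auto
  have red: "Polynomial.degree (f mod ?r) < n" "f = ?r * (f div ?r) + f mod ?r" for f
    using degree_mod_less[OF r, of f] deg n by auto
  show "?zero \<and> ?span \<and> ?indep" if P: ?P
  proof (intro conjI ballI allI impI)
    show zero: ?zero
      using presented_byD(4)[OF P] by (simp add: free_eval_eq_poly_eval)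
    fix a assume "a \<in> carrier A"
    then obtain p where "a = poly_eval A w (to_poly p)"
      using presented_byD(3)[OF P] by (auto simp: free_eval_eq_poly_eval)
    also have "\<dots> = poly_eval A w (to_poly p mod ?r)"
      using zero by (subst red(2)) (simp only: poly_eval_add poly_eval_mult, simp)
    finally show "\<exists>f. Polynomial.degree f < n \<and> poly_eval A w f = a"
      using red(1) by blast
  next
    fix f assume f: "Polynomial.degree f < n" "poly_eval A w f = \<zero>"
    obtain p where p: "f = to_poly p" using to_poly_ex by blast
    have "inv\<^bsub>add_monoid ?R\<^esub> x = - x" for x
      using R.minus_equality[of "- x" x] unfolding a_inv_def by simp
    then have "subgroup {p. ?r dvd to_poly p} (add_monoid ?R)"
      by (intro subgroup.intro) (auto simp: to_poly_add to_poly_zero to_poly_diff[of 0, simplified])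
    then have "ideal {p. ?r dvd to_poly p} ?R"
      by (intro idealI R.ring_axioms) (auto simp: to_poly_mult)
    then have "genideal ?R {\<rho>} \<subseteq> {p. ?r dvd to_poly p}"
      by (rule R.genideal_minimal) simp
    moreover have "p \<in> a_kernel ?R A (free_eval A (\<lambda>_. w))"
      using f p by (simp add: a_kernel_def' free_eval_eq_poly_eval)
    ultimately have "?r dvd f"
      using that p by (auto simp: presented_by_def)
    then show "f = 0"
      using f deg by (metis dvd_imp_degree_le not_less)
  qed
  show ?P if "?zero \<and> ?span \<and> ?indep"
    unfolding presented_by_def
  proof (intro conjI)
    show "range (free_eval A (\<lambda>_::unit. w)) = carrier A"
    proof
      show "range (free_eval A (\<lambda>_::unit. w)) \<subseteq> carrier A"
        by (auto simp: free_eval_eq_poly_eval)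
      show "carrier A \<subseteq> range (free_eval A (\<lambda>_::unit. w))"
        using that to_poly_ex by (metis free_eval_eq_poly_eval rangeI subsetI)
    qed
    have ideal: "ideal (a_kernel ?R A (free_eval A (\<lambda>_. w))) ?R"
      by (rule ring_hom_ring.kernel_is_ideal[OF free_eval_ring_hom[OF range_w]])
    show "a_kernel ?R A (free_eval A (\<lambda>_. w)) = genideal ?R {\<rho>}"
    proof
      show "genideal ?R {\<rho>} \<subseteq> a_kernel ?R A (free_eval A (\<lambda>_. w))"
        using that by (intro R.genideal_minimal ideal) (simp add: a_kernel_def' free_eval_eq_poly_eval)
      show "a_kernel ?R A (free_eval A (\<lambda>_. w)) \<subseteq> genideal ?R {\<rho>}"
      proof
        fix p assume "p \<in> a_kernel ?R A (free_eval A (\<lambda>_. w))"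
        then have "poly_eval A w (to_poly p) = \<zero>"
          by (simp add: a_kernel_def' free_eval_eq_poly_eval)
        then have "poly_eval A w (to_poly p mod ?r) = \<zero>"
          using that poly_eval_add[of "?r * (to_poly p div ?r)" "to_poly p mod ?r"]
          by (simp add: poly_eval_mult)
        then have "to_poly p mod ?r = 0"
          using that red(1) by blast
        then have "to_poly p = ?r * (to_poly p div ?r)"
          using red(2)[of "to_poly p"] by simp
        moreover obtain s where "to_poly p div ?r = to_poly s" using to_poly_ex by blast
        ultimately have "p = \<rho> * s"
          by (simp add: inj_eq[OF bij_is_inj[OF bij_to_poly]] flip: to_poly_mult)
        moreover have "\<rho> \<otimes>\<^bsub>?R\<^esub> s \<in> genideal ?R {\<rho>}"
          using R.genideal_self'[of \<rho>] R.genideal_ideal[of "{\<rho>}"] by (intro ideal.I_r_closed) simp_all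
        ultimately show "p \<in> genideal ?R {\<rho>}" by simp
      qed
    qed
  qed (use k_algebra_axioms in simp_all)
qed

end

section \<open>Gaussian binomials at a root of unity\<close>

text \<open>
  \<open>gauss_binomial t k j\<close> is the Gaussian binomial of \<open>k + j\<close> over \<open>k\<close>. Indexing by \<open>k\<close> and \<open>j\<close> makes the
  symmetry visible and avoids truncated subtraction.
\<close>

fun gauss_binomial :: "'k::comm_ring_1 \<Rightarrow> nat \<Rightarrow> nat \<Rightarrow> 'k" where
  "gauss_binomial t 0 j = 1"
| "gauss_binomial t (Suc k) 0 = 1"
| "gauss_binomial t (Suc k) (Suc j) = gauss_binomial t k (Suc j) + t ^ Suc k * gauss_binomial t (Suc k) j"

lemma gauss_binomial_0_right [simp]: "gauss_binomial t k 0 = 1"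
  by (cases k) simp_all

text \<open>
  The two absorption laws are proved together, since the induction step of each uses both.
\<close>

lemma gauss_binomial_absorption:
  "(1 - t ^ Suc k) * gauss_binomial t (Suc k) j = (1 - t ^ Suc (k + j)) * gauss_binomial t k j \<and>
   (1 - t ^ Suc j) * gauss_binomial t k (Suc j) = (1 - t ^ Suc (k + j)) * gauss_binomial t k j"
proof (induction "k + j" arbitrary: k j rule: less_induct)
  case less
  have "(1 - t ^ Suc k) * gauss_binomial t (Suc k) j = (1 - t ^ Suc (k + j)) * gauss_binomial t k j"
  proof (cases j)
    case (Suc i)
    have "(1 - t ^ Suc k) * gauss_binomial t (Suc k) i = (1 - t ^ Suc (k + i)) * gauss_binomial t k i"
      "(1 - t ^ Suc i) * gauss_binomial t k (Suc i) = (1 - t ^ Suc (k + i)) * gauss_binomial t k i"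
      using less[of k i] Suc by auto
    then have "(1 - t ^ Suc k) * gauss_binomial t (Suc k) i = (1 - t ^ Suc i) * gauss_binomial t k (Suc i)"
      by simp
    moreover have "(1 - t ^ Suc k) * gauss_binomial t (Suc k) j = (1 - t ^ Suc k) * gauss_binomial t k (Suc i) +
        t ^ Suc k * ((1 - t ^ Suc k) * gauss_binomial t (Suc k) i)"
      using Suc by (simp add: algebra_simps)
    ultimately have "(1 - t ^ Suc k) * gauss_binomial t (Suc k) j =
        ((1 - t ^ Suc k) + t ^ Suc k * (1 - t ^ Suc i)) * gauss_binomial t k (Suc i)"
      by (simp only: distrib_right mult.assoc)
    also have "(1 - t ^ Suc k) + t ^ Suc k * (1 - t ^ Suc i) = 1 - t ^ Suc (k + j)"
      using Suc by (simp add: algebra_simps power_add)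
    finally show ?thesis using Suc by simp
  qed simp
  moreover have "(1 - t ^ Suc j) * gauss_binomial t k (Suc j) = (1 - t ^ Suc (k + j)) * gauss_binomial t k j"
  proof (cases k)
    case (Suc i)
    have "(1 - t ^ Suc i) * gauss_binomial t (Suc i) j = (1 - t ^ Suc (i + j)) * gauss_binomial t i j"
      "(1 - t ^ Suc j) * gauss_binomial t i (Suc j) = (1 - t ^ Suc (i + j)) * gauss_binomial t i j"
      using less[of i j] Suc by auto
    then have "(1 - t ^ Suc i) * gauss_binomial t (Suc i) j = (1 - t ^ Suc j) * gauss_binomial t i (Suc j)"
      by simp
    moreover have "(1 - t ^ Suc j) * gauss_binomial t k (Suc j) =
        (1 - t ^ Suc j) * gauss_binomial t i (Suc j) + (1 - t ^ Suc j) * t ^ Suc i * gauss_binomial t (Suc i) j"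
      using Suc by (simp add: algebra_simps)
    ultimately have "(1 - t ^ Suc j) * gauss_binomial t k (Suc j) =
        ((1 - t ^ Suc i) + (1 - t ^ Suc j) * t ^ Suc i) * gauss_binomial t (Suc i) j"
      by (simp only: distrib_right mult.assoc)
    also have "(1 - t ^ Suc i) + (1 - t ^ Suc j) * t ^ Suc i = 1 - t ^ Suc (k + j)"
      using Suc by (simp add: algebra_simps power_add)
    finally show ?thesis using Suc by simp
  qed simp
  ultimately show ?case by blast
qed

text \<open>
  Absorption turns the factor \<open>1 - t ^ k\<close>, which is nonzero, into \<open>1 - t ^ N = 0\<close>.
\<close>

lemma gauss_binomial_root_of_unity:
  fixes t :: "'k::field"
  assumes "t ^ N = 1" "\<And>m. 0 < m \<Longrightarrow> m < N \<Longrightarrow> t ^ m \<noteq> 1" "0 < k" "k < N"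
  shows "gauss_binomial t k (N - k) = 0"
proof -
  obtain i where k: "k = Suc i" using assms(3) by (cases k) auto
  have "(1 - t ^ k) * gauss_binomial t k (N - k) = (1 - t ^ N) * gauss_binomial t i (N - k)"
  proof -
    have "Suc (i + (N - k)) = N" using assms(4) k by simp
    then show ?thesis using gauss_binomial_absorption[of t i "N - k"] by (simp only: k)
  qed
  then show ?thesis using assms by simp
qed

definition rogers_szego :: "'k::comm_ring_1 \<Rightarrow> 'k \<Rightarrow> 'k \<Rightarrow> nat \<Rightarrow> 'k" where
  "rogers_szego t u v m = (\<Sum>k\<le>m. gauss_binomial t k (m - k) * u ^ k * v ^ (m - k))"

lemma gauss_binomial_second_difference:
  "gauss_binomial t (Suc k) (Suc j) =
    gauss_binomial t k (Suc j) + gauss_binomial t (Suc k) j - (1 - t ^ Suc (k + j)) * gauss_binomial t k j"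
  using gauss_binomial_absorption[of t k j] by (simp add: algebra_simps)

lemma rogers_szego_Suc_Suc:
  "rogers_szego t u v (Suc (Suc m)) =
     (u + v) * rogers_szego t u v (Suc m) - (1 - t ^ Suc m) * u * v * rogers_szego t u v m"
proof -
  let ?S = "\<lambda>f. \<Sum>k\<le>m. f k * u ^ Suc k * v ^ Suc (m - k)"
  have "rogers_szego t u v (Suc (Suc m)) =
      v ^ Suc (Suc m) + u ^ Suc (Suc m) + ?S (\<lambda>k. gauss_binomial t (Suc k) (Suc (m - k)))"
    unfolding rogers_szego_def
    by (subst sum.atMost_Suc_shift, subst sum.atMost_Suc) (simp add: Suc_diff_le del: gauss_binomial.simps(3))
  also have "?S (\<lambda>k. gauss_binomial t (Suc k) (Suc (m - k))) =
      ?S (\<lambda>k. gauss_binomial t k (Suc (m - k))) + ?S (\<lambda>k. gauss_binomial t (Suc k) (m - k)) -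
      ?S (\<lambda>k. (1 - t ^ Suc m) * gauss_binomial t k (m - k))"
    unfolding sum.distrib[symmetric] sum_subtractf[symmetric]
    by (intro sum.cong refl) (subst gauss_binomial_second_difference, simp add: algebra_simps)
  also have "?S (\<lambda>k. (1 - t ^ Suc m) * gauss_binomial t k (m - k)) =
      (1 - t ^ Suc m) * u * v * rogers_szego t u v m"
    unfolding rogers_szego_def sum_distrib_left by (intro sum.cong refl) (simp add: algebra_simps)
  also have "?S (\<lambda>k. gauss_binomial t k (Suc (m - k))) = u * rogers_szego t u v (Suc m) - u ^ Suc (Suc m)"
    unfolding rogers_szego_def sum.atMost_Suc distrib_left sum_distrib_left
    by (simp add: Suc_diff_le algebra_simps)
  also have "?S (\<lambda>k. gauss_binomial t (Suc k) (m - k)) = v * rogers_szego t u v (Suc m) - v ^ Suc (Suc m)"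
    unfolding rogers_szego_def sum.atMost_Suc_shift distrib_left sum_distrib_left
    by (simp add: algebra_simps)
  finally show ?thesis by (simp add: algebra_simps)
qed

lemma rogers_szego_root_of_unity:
  fixes t :: "'k::field"
  assumes "N > 0" "t ^ N = 1" "\<And>m. 0 < m \<Longrightarrow> m < N \<Longrightarrow> t ^ m \<noteq> 1"
  shows "rogers_szego t u v N = u ^ N + v ^ N"
proof -
  obtain n where N: "N = Suc n" using assms(1) by (cases N) auto
  have "(\<Sum>k<n. gauss_binomial t (Suc k) (n - k) * u ^ Suc k * v ^ (n - k)) = 0"
    using gauss_binomial_root_of_unity[OF assms(2,3), of "Suc k" for k] N
    by (intro sum.neutral) (auto simp del: gauss_binomial.simps(3))
  then show ?thesis
    unfolding rogers_szego_def N by (subst sum.atMost_Suc_shift) (simp add: sum.lessThan_Suc flip: lessThan_Suc_atMost)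
qed

section \<open>Lucas polynomials\<close>

text \<open>
  The integer \<open>n / (n - k) * (n - k choose k)\<close>, see \<open>lucas_coeff_eq\<close>. As a sum of two binomials it
  inherits a recursion from Pascal's rule. The condition \<open>n \<le> k\<close> only guards against truncated
  subtraction, as in \<open>n = k = 1\<close>.
\<close>

definition lucas_coeff :: "nat \<Rightarrow> nat \<Rightarrow> nat" where
  "lucas_coeff n k = (n - k choose k) + (if k = 0 \<or> n \<le> k then 0 else n - k - 1 choose (k - 1))"

lemma lucas_coeff_0 [simp]: "lucas_coeff n 0 = 1"
  by (simp add: lucas_coeff_def)

lemma lucas_coeff_eq_0: "n > 0 \<Longrightarrow> n < 2 * k \<Longrightarrow> lucas_coeff n k = 0"
  by (cases k) (auto simp: lucas_coeff_def)

lemma lucas_coeff_Suc: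
  assumes "n > 0"
  shows "lucas_coeff (Suc (Suc n)) (Suc k) = lucas_coeff (Suc n) (Suc k) + lucas_coeff n k"
proof (cases "k \<le> n")
  case True
  then obtain j where j: "n = k + j" using le_Suc_ex by blast
  show ?thesis
    using assms by (cases k; cases j) (auto simp: lucas_coeff_def j)
next
  case False
  then show ?thesis using assms by (simp add: lucas_coeff_eq_0)
qed

lemma lucas_coeff_eq:
  assumes "k < n"
  shows "of_nat (lucas_coeff n k) = (of_nat n / of_nat (n - k) * of_nat ((n - k) choose k) :: 'k::field_char_0)"
proof (cases k)
  case (Suc i)
  obtain j where j: "n = Suc (k + j)" using assms less_imp_Suc_add by blast
  have "Suc (k + j) - k = Suc j" by simp
  have "k * (Suc j choose k) = Suc j * (j choose i)"
    using Suc_times_binomial[of i j] Suc by simp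
  then have "Suc j * lucas_coeff n k = n * (Suc j choose k)"
    by (simp add: lucas_coeff_def j Suc algebra_simps)
  then have "of_nat (Suc j) * of_nat (lucas_coeff n k) = (of_nat n * of_nat (Suc j choose k) :: 'k)"
    by (metis of_nat_mult)
  then show ?thesis
    using j by (simp add: field_simps del: of_nat_Suc)
qed (use assms in \<open>simp_all add: lucas_coeff_def\<close>)

definition lucas_poly :: "'k::comm_ring_1 \<Rightarrow> nat \<Rightarrow> 'k \<Rightarrow> 'k" where
  "lucas_poly d n z = (\<Sum>k\<le>n. of_nat (lucas_coeff n k) * d ^ k * z ^ (n - 2 * k))"

lemma lucas_poly_Suc_Suc:
  assumes "n > 0"
  shows "lucas_poly d (Suc (Suc n)) z = z * lucas_poly d (Suc n) z + d * lucas_poly d n z"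
proof -
  let ?f = "\<lambda>k. of_nat (lucas_coeff (Suc n) (Suc k)) * d ^ Suc k * z ^ (n - 2 * k)"
  let ?g = "\<lambda>k. of_nat (lucas_coeff n k) * d ^ Suc k * z ^ (n - 2 * k)"
  have "lucas_poly d (Suc (Suc n)) z = z ^ Suc (Suc n) + (\<Sum>k\<le>Suc n. ?f k + ?g k)"
    unfolding lucas_poly_def
    by (subst sum.atMost_Suc_shift, intro arg_cong2[where f = "(+)"] sum.cong)
       (use assms in \<open>simp_all add: lucas_coeff_Suc algebra_simps\<close>)
  also have "\<dots> = z ^ Suc (Suc n) + (\<Sum>k\<le>n. ?f k) + (\<Sum>k\<le>n. ?g k)"
    using assms by (simp add: sum.distrib lucas_coeff_eq_0)
  also have "(\<Sum>k\<le>n. ?g k) = d * lucas_poly d n z"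
    unfolding lucas_poly_def sum_distrib_left by (intro sum.cong refl) (simp add: algebra_simps)
  also have "z ^ Suc (Suc n) + (\<Sum>k\<le>n. ?f k) = z * lucas_poly d (Suc n) z"
  proof -
    have "?f k = z * (of_nat (lucas_coeff (Suc n) (Suc k)) * d ^ Suc k * z ^ (Suc n - 2 * Suc k))" for k
    proof (cases "Suc n < 2 * Suc k")
      case False
      then have "z ^ (n - 2 * k) = z * z ^ (Suc n - 2 * Suc k)"
        by (metis (no_types, lifting) Suc_diff_le diff_Suc_Suc mult_Suc_right not_less power_Suc
            add_2_eq_Suc Suc_le_mono)
      then show ?thesis by (simp add: algebra_simps)
    qed (simp add: lucas_coeff_eq_0)
    then have "(\<Sum>k\<le>n. ?f k) =
        (\<Sum>k\<le>n. z * (of_nat (lucas_coeff (Suc n) (Suc k)) * d ^ Suc k * z ^ (Suc n - 2 * Suc k)))"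
      by (intro sum.cong refl)
    then show ?thesis
      unfolding lucas_poly_def sum.atMost_Suc_shift distrib_left sum_distrib_left by simp
  qed
  finally show ?thesis .
qed

text \<open>
  Girard's formula: both sides satisfy the recursion with characteristic roots \<open>u\<close> and \<open>v\<close>.
\<close>

lemma lucas_poly_power_sum:
  assumes "n > 0"
  shows "lucas_poly (- (u * v)) n (u + v) = u ^ n + (v :: 'k::comm_ring_1) ^ n"
  using assms
proof (induction n rule: less_induct)
  case (less n)
  consider "n = 1" | "n = 2" | m where "n = Suc (Suc m)" "m > 0"
    using less.prems by (metis One_nat_def Suc_1 gr0_conv_Suc neq0_conv)
  then show ?case
  proof cases
    case 1
    then show ?thesis by (simp add: lucas_poly_def lucas_coeff_def)
  next
    case 2
    then show ?thesis
      by (simp add: lucas_poly_def lucas_coeff_def numeral_2_eq_2 algebra_simps)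
  next
    case 3
    then show ?thesis
      using less.IH[of m] less.IH[of "Suc m"] by (simp add: lucas_poly_Suc_Suc algebra_simps)
  qed
qed

section \<open>q-Hermite polynomials\<close>

fun q_hermite :: "'k::comm_ring_1 \<Rightarrow> 'k \<Rightarrow> nat \<Rightarrow> 'k poly" where
  "q_hermite t b 0 = 1"
| "q_hermite t b (Suc 0) = [:0, 1:]"
| "q_hermite t b (Suc (Suc m)) =
     [:0, 1:] * q_hermite t b (Suc m) - smult (b * (\<Sum>j<Suc m. t ^ j)) (q_hermite t b m)"

lemma q_hermite_monic:
  "degree (q_hermite t b m) = m \<and> coeff (q_hermite (t :: 'k::field) b m) m = 1"
proof (induction m rule: less_induct)
  case (less m)
  consider "m = 0" | "m = Suc 0" | n where "m = Suc (Suc n)"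
    by (metis old.nat.exhaust)
  then show ?case
  proof cases
    case 3
    let ?p = "q_hermite t b (Suc n)" and ?r = "smult (b * (\<Sum>j<Suc n. t ^ j)) (q_hermite t b n)"
    have p: "degree ?p = Suc n" "coeff ?p (Suc n) = 1" "degree (q_hermite t b n) = n"
      using less[of n] less[of "Suc n"] 3 by auto
    then have "?p \<noteq> 0" by auto
    then have "degree ([:0, 1:] * ?p) = Suc (Suc n)"
      using p by (simp add: degree_mult_eq)
    moreover have "degree ?r < Suc (Suc n)"
      using degree_smult_le[of _ "q_hermite t b n"] p(3) by (metis le_imp_less_Suc less_SucI)
    ultimately have "degree ([:0, 1:] * ?p - ?r) = Suc (Suc n)"
      by (metis degree_add_eq_left degree_minus diff_conv_add_uminus)
    moreover have "coeff ?r (Suc (Suc n)) = 0"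
      using \<open>degree ?r < Suc (Suc n)\<close> by (rule coeff_eq_0)
    ultimately show ?thesis
      using p 3 by simp
  qed simp_all
qed

lemma q_hermite_eq_rogers_szego:
  fixes t :: "'k::field"
  assumes "t \<noteq> 1" "(t - 1) * (u * v) = - b"
  shows "poly (q_hermite t b m) (u + v) = rogers_szego t u v m"
proof (induction m rule: less_induct)
  case (less m)
  consider "m = 0" | "m = Suc 0" | n where "m = Suc (Suc n)"
    by (metis old.nat.exhaust)
  then show ?case
  proof cases
    case 3
    have "(1 - t ^ Suc n) = - ((t - 1) * (\<Sum>j<Suc n. t ^ j))"
      using power_diff_1_eq[of t "Suc n"] by (metis minus_diff_eq)
    then have "(1 - t ^ Suc n) * u * v = - ((t - 1) * (u * v)) * (\<Sum>j<Suc n. t ^ j)"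
      by (simp only: ac_simps minus_mult_left[symmetric] minus_mult_right[symmetric])
    then have "(1 - t ^ Suc n) * u * v = b * (\<Sum>j<Suc n. t ^ j)"
      using assms(2) by simp
    then show ?thesis
      using 3 less[of n] less[of "Suc n"] by (simp add: rogers_szego_Suc_Suc)
  qed (simp_all add: rogers_szego_def)
qed

text \<open>
  Polynomials over an infinite field are compared by their values. Each value \<open>z\<close> is of the form
  \<open>u + v\<close> with \<open>u v = - b / (t - 1)\<close>, and there the recursion of the q-Hermite polynomials is that of
  the Rogers-Szegoe polynomials, of which only the two extreme terms survive at a root of unity.
\<close>

theorem q_hermite_root_of_unity:
  fixes t b :: "'k::{alg_closed_field, field_char_0}"
  assumes "N > 1" "t ^ N = 1" "\<And>m. 0 < m \<Longrightarrow> m < N \<Longrightarrow> t ^ m \<noteq> 1" "odd N"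
  shows "q_hermite t b N =
    (\<Sum>k = 0..(N - 1) div 2. smult (of_nat N / of_nat (N - k) * of_nat ((N - k) choose k) * (b / (t - 1)) ^ k)
       ([:0, 1:] ^ (N - 2 * k)))"
proof -
  let ?d = "b / (t - 1)"
  have t: "t \<noteq> 1" using assms(1) assms(3)[of 1] by auto
  have "poly (q_hermite t b N) z = lucas_poly ?d N z" for z
  proof -
    \<comment> \<open>\<open>u\<close> and \<open>v\<close> are the roots of \<open>X\<^sup>2 - z X - d\<close>.\<close>
    obtain u where u: "poly [: - ?d, - z, 1:] u = 0"
      using alg_closed_imp_poly_has_root[of "[: - ?d, - z, 1:]"] by auto
    define v where "v = z - u"
    have uv: "u * v = - ?d" using u by (simp add: v_def algebra_simps add_eq_0_iff)
    have "poly (q_hermite t b N) (u + v) = rogers_szego t u v N"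
      using t uv by (intro q_hermite_eq_rogers_szego) auto
    also have "\<dots> = u ^ N + v ^ N"
      using assms by (intro rogers_szego_root_of_unity) auto
    also have "\<dots> = lucas_poly ?d N (u + v)"
      using lucas_poly_power_sum[of N u v] assms(1) uv by simp
    finally show ?thesis by (simp add: v_def)
  qed
  moreover have "lucas_poly ?d N z = poly (\<Sum>k = 0..(N - 1) div 2. smult (of_nat N / of_nat (N - k) *
      of_nat ((N - k) choose k) * ?d ^ k) ([:0, 1:] ^ (N - 2 * k))) z" for z
  proof -
    have "lucas_poly ?d N z = (\<Sum>k = 0..(N - 1) div 2. of_nat (lucas_coeff N k) * ?d ^ k * z ^ (N - 2 * k))"
      unfolding lucas_poly_def using assms(1)
      by (intro sum.mono_neutral_right) (use assms(4) in \<open>auto simp: not_le intro!: disjI1 lucas_coeff_eq_0 elim!: oddE\<close>)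
    also have "\<dots> = (\<Sum>k = 0..(N - 1) div 2. of_nat N / of_nat (N - k) *
        of_nat ((N - k) choose k) * ?d ^ k * z ^ (N - 2 * k))"
      using assms(1) by (intro sum.cong refl) (use assms(4) in \<open>auto simp: lucas_coeff_eq elim!: oddE\<close>)
    finally show ?thesis by (simp add: poly_sum)
  qed
  ultimately show ?thesis
    by (intro poly_eq_poly_eq_iff[THEN iffD1] ext) simp
qed

section \<open>Bases of algebras with one generator\<close>

lemma poly_sum_of_monoms:
  fixes f :: "'k::comm_monoid_add poly"
  assumes "degree f < n"
  shows "f = (\<Sum>i<n. monom (coeff f i) i)"
proof -
  obtain m where "n = Suc m" using assms by (cases n) auto
  then show ?thesis
    using assms poly_as_sum_of_monoms'[of f m] by (simp add: lessThan_Suc_atMost)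
qed

lemma (in pointed_algebra) powers_finite_basis:
  assumes span: "\<And>a. a \<in> carrier A \<Longrightarrow> \<exists>f. Polynomial.degree f < n \<and> poly_eval A w f = a"
    and indep: "\<And>f. Polynomial.degree f < n \<Longrightarrow> poly_eval A w f = \<zero> \<Longrightarrow> f = 0"
  shows "\<exists>c. finite_basis A {..<n} (\<lambda>i. w [^] i) c"
proof -
  define rep where "rep a = (SOME f. Polynomial.degree f < n \<and> poly_eval A w f = a)" for a
  have rep: "Polynomial.degree (rep a) < n" "poly_eval A w (rep a) = a" if "a \<in> carrier A" for a
    using someI_ex[OF span[OF that]] by (auto simp: rep_def)
  have rep_eqI: "rep a = f" if "a \<in> carrier A" "Polynomial.degree f < n" "poly_eval A w f = a" for a f
  proof -
    have "rep a - f = 0"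
      using rep[OF that(1)] that
      by (intro indep) (auto simp: poly_eval_diff degree_diff_less r_right_minus_eq)
    then show ?thesis by simp
  qed
  have "finite_basis A {..<n} (\<lambda>i. w [^] i) (\<lambda>i a. Polynomial.coeff (rep a) i)"
  proof (intro finite_basis.intro finite_basis_axioms.intro k_space_axioms)
    show "linear_map A scalar_algebra (\<lambda>a. Polynomial.coeff (rep a) i)" for i
    proof (rule linear_mapI)
      fix a b assume "a \<in> carrier A" "b \<in> carrier A"
      then have "rep (a \<oplus> b) = rep a + rep b"
        using rep by (intro rep_eqI) (auto simp: poly_eval_add degree_add_less)
      then show "Polynomial.coeff (rep (a \<oplus> b)) i =
          Polynomial.coeff (rep a) i \<oplus>\<^bsub>scalar_algebra\<^esub> Polynomial.coeff (rep b) i" by simp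
    next
      fix r a assume "a \<in> carrier A"
      then have "rep (r \<odot> a) = Polynomial.smult r (rep a)"
        using rep by (intro rep_eqI le_less_trans[OF degree_smult_le]) (auto simp: poly_eval_smult)
      then show "Polynomial.coeff (rep (r \<odot> a)) i = r \<odot>\<^bsub>scalar_algebra\<^esub> Polynomial.coeff (rep a) i" by simp
    qed simp
    show "(\<Oplus>i\<in>{..<n}. Polynomial.coeff (rep a) i \<odot> w [^] i) = a" if "a \<in> carrier A" for a
    proof -
      have "a = poly_eval A w (\<Sum>i<n. Polynomial.monom (Polynomial.coeff (rep a) i) i)"
        using rep[OF that] poly_sum_of_monoms[of "rep a" n] by simp
      then show ?thesis by (simp add: poly_eval_sum poly_eval_monom)
    qed
    fix i j assume "i \<in> {..<n}" "j \<in> {..<n}"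
    then have "rep (w [^] j) = Polynomial.monom 1 j"
      by (intro rep_eqI) (auto simp: poly_eval_monom Polynomial.degree_monom_eq)
    then show "Polynomial.coeff (rep (w [^] j)) i = (if i = j then 1 else 0)" by simp
  qed simp_all
  then show ?thesis by blast
qed

lemma monic_family_expansion:
  fixes P :: "nat \<Rightarrow> 'k::field poly"
  assumes P: "\<And>m. degree (P m) = m \<and> coeff (P m) m = 1" and f: "degree f < n \<or> f = 0"
  shows "\<exists>b. f = (\<Sum>m<n. smult (b m) (P m))"
  using f
proof (induction n arbitrary: f)
  case (Suc n)
  let ?h = "f - smult (coeff f n) (P n)"
  have "degree f \<le> n" using Suc.prems by auto
  have "?h = 0 \<or> degree ?h < n"
  proof (rule disjCI)
    assume "\<not> degree ?h < n"
    moreover have "degree ?h \<le> n"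
      using P[of n] \<open>degree f \<le> n\<close> by (intro degree_diff_le) (auto intro: order_trans[OF degree_smult_le])
    ultimately have "degree ?h = n" by simp
    moreover have "coeff ?h n = 0" using P[of n] by simp
    ultimately show "?h = 0" by (metis leading_coeff_0_iff)
  qed
  then obtain b where "?h = (\<Sum>m<n. smult (b m) (P m))" using Suc.IH by blast
  then have "f = (\<Sum>m<Suc n. smult ((b(n := coeff f n)) m) (P m))"
    by (simp add: algebra_simps)
  then show ?case by blast
qed (auto)

text \<open>
  If the values at \<open>w\<close> of monic polynomials of degrees \<open>0, \<dots>, n - 1\<close> form a basis, then so do
  \<open>1, w, \<dots>\<close>, because the change of basis is unitriangular. The basis is taken from an algebra \<open>L\<close> that
  shares its vector space with \<open>A\<close>, but not its product.
\<close>

lemma presented_by_change_of_basis: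
  fixes L :: "('k::field, 'l, 'n) module_scheme" and A :: "('k, 'l, 'p) module_scheme"
  assumes basis: "finite_basis L {..<n} e c" and A: "k_algebra A" and LA: "same_space L A" and w: "w \<in> carrier A"
    and P: "\<And>m. degree (P m) = m \<and> coeff (P m) m = 1"
    and eval: "\<And>m. m < n \<Longrightarrow> poly_eval A w (P m) = e m"
    and \<rho>: "coeff (to_poly \<rho>) n = 1" "degree (to_poly \<rho>) = n" "n > 0" "poly_eval A w (to_poly \<rho>) = \<zero>\<^bsub>A\<^esub>"
  shows "presented_by A (\<lambda>_::unit. w) {\<rho>}"
proof -
  interpret A: k_algebra A by (rule A)
  interpret W: pointed_algebra A w
    using A w by (simp add: pointed_algebra_def pointed_algebra_axioms_def)
  interpret B: finite_basis A "{..<n}" e c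
    by (rule same_space_finite_basis[OF LA basis])
  have ev: "poly_eval A w (\<Sum>m<n. Polynomial.smult (b m) (P m)) = (\<Oplus>\<^bsub>A\<^esub>m\<in>{..<n}. b m \<odot>\<^bsub>A\<^esub> e m)" for b
    by (simp add: W.poly_eval_sum W.poly_eval_smult eval cong: A.finsum_cong)
  show ?thesis
    unfolding W.presented_by_monic_iff[OF \<rho>(1-3)]
  proof (intro conjI ballI allI impI)
    fix a assume a: "a \<in> carrier A"
    have "Polynomial.degree (\<Sum>m<n. Polynomial.smult (c m a) (P m)) < n"
      using P \<rho>(3) by (intro degree_sum_less) (auto intro: le_less_trans[OF degree_smult_le])
    moreover have "poly_eval A w (\<Sum>m<n. Polynomial.smult (c m a) (P m)) = a"
      using a by (simp add: ev B.expansion)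
    ultimately show "\<exists>f. Polynomial.degree f < n \<and> poly_eval A w f = a" by blast
  next
    fix f assume f: "Polynomial.degree f < n" "poly_eval A w f = \<zero>\<^bsub>A\<^esub>"
    obtain b where b: "f = (\<Sum>m<n. Polynomial.smult (b m) (P m))"
      using monic_family_expansion[of P f n] P f by blast
    then have z: "(\<Oplus>\<^bsub>A\<^esub>m\<in>{..<n}. b m \<odot>\<^bsub>A\<^esub> e m) = \<zero>\<^bsub>A\<^esub>" using f ev by simp
    have "b m = 0" if "m < n" for m
      using that B.coord_expansion[of m b] linear_map_zero[OF A.k_space_axioms k_space_scalar_algebra B.coord_linear, of m]
      by (simp add: z)
    then show "f = 0" by (simp add: b)
  qed (use \<rho>(4) in simp_all)
qed

section \<open>The associated graded Hopf algebra\<close>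

lemma (in monoid) pow_commute: "a \<in> carrier G \<Longrightarrow> a \<otimes> a [^] n = a [^] (n::nat) \<otimes> a"
  using nat_pow_Suc2 nat_pow_Suc by metis

lemma (in k_algebra) q_commute_pow:
  assumes "a \<in> carrier A" "b \<in> carrier A" "b \<otimes> a = s \<odot> (a \<otimes> b)"
  shows "b \<otimes> (a [^] n) = s ^ n \<odot> (a [^] (n::nat) \<otimes> b)"
proof (induction n)
  case (Suc n)
  have "b \<otimes> (a [^] Suc n) = (b \<otimes> a [^] n) \<otimes> a"
    using assms by (simp add: m_assoc)
  also have "\<dots> = s ^ n \<odot> (a [^] n \<otimes> (b \<otimes> a))"
    using assms by (simp add: Suc smult_mult_left m_assoc)
  also have "\<dots> = s ^ Suc n \<odot> (a [^] Suc n \<otimes> b)"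
    using assms by (simp add: smult_mult_right smult_smult m_assoc mult.commute)
  finally show ?case .
qed (use assms in simp)

locale gr_uq =
  fixes N :: nat and q :: "'k::field" and H :: "('k, 'h) bialgebra" (structure) and x y g :: 'h
  assumes N: "N > 1" and q: "q ^ N = 1" and gr: "is_gr_uq_sl2 N q H x y g"
begin

lemma is_bialgebra: "is_bialgebra H"
  using gr by (simp add: is_gr_uq_sl2_def is_hopf_algebra_def)

sublocale bialg H by (rule bialgI[OF is_bialgebra])

lemma presented: "presented_by H (case_gr_gen x y g) (gr_uq_relations N q)"
  using gr by (simp add: is_gr_uq_sl2_def)

lemma q_nonzero: "q \<noteq> 0"
  using q N by (auto simp: power_0_left)

lemma range_generators: "range (case_gr_gen x y g) \<subseteq> carrier H"
  using presented_byD(2)[OF presented] .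

lemma generators_closed [simp]: "x \<in> carrier H" "y \<in> carrier H" "g \<in> carrier H"
  using range_subsetD[OF range_generators, of gen_x] range_subsetD[OF range_generators, of gen_y]
    range_subsetD[OF range_generators, of gen_g] by simp_all

lemmas free_eval_hom = free_eval_mult[OF range_generators] free_eval_pow[OF range_generators]
  free_eval_diff[OF range_generators] free_eval_gen[OF range_generators]
  free_eval_const[OF range_generators] free_eval_one[OF range_generators]

lemma relation: "r \<in> gr_uq_relations N q \<Longrightarrow> free_eval H (case_gr_gen x y g) r = \<zero>"
  by (rule presented_byD(4)[OF presented])

lemma relations:
  "x [^] N = \<zero>" "y [^] N = \<zero>" "g [^] N = \<one>"
  "g \<otimes> x = q ^ 2 \<odot> (x \<otimes> g)" "g \<otimes> y = inverse q ^ 2 \<odot> (y \<otimes> g)" "x \<otimes> y = q ^ 2 \<odot> (y \<otimes> x)"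
proof -
  have "free_eval H (case_gr_gen x y g) (gen gen_x ^ N) = \<zero>"
    "free_eval H (case_gr_gen x y g) (gen gen_y ^ N) = \<zero>"
    "free_eval H (case_gr_gen x y g) (gen gen_g ^ N - 1) = \<zero>"
    "free_eval H (case_gr_gen x y g) (gen gen_g * gen gen_x - const (q ^ 2) * gen gen_x * gen gen_g) = \<zero>"
    "free_eval H (case_gr_gen x y g) (gen gen_g * gen gen_y - const (inverse q ^ 2) * gen gen_y * gen gen_g) = \<zero>"
    "free_eval H (case_gr_gen x y g) (gen gen_x * gen gen_y - const (q ^ 2) * gen gen_y * gen gen_x) = \<zero>"
    by (intro relation, simp add: gr_uq_relations_def Let_def)+
  then show "x [^] N = \<zero>" "y [^] N = \<zero>" "g [^] N = \<one>"
    "g \<otimes> x = q ^ 2 \<odot> (x \<otimes> g)" "g \<otimes> y = inverse q ^ 2 \<odot> (y \<otimes> g)" "x \<otimes> y = q ^ 2 \<odot> (y \<otimes> x)"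
    by (simp_all only: free_eval_hom gr_gen.case) (simp_all add: r_right_minus_eq smult_mult_left)
qed

lemma yx: "y \<otimes> x = inverse q ^ 2 \<odot> (x \<otimes> y)"
  using relations(6) q_nonzero by (simp add: smult_smult field_simps)

abbreviation "pbw \<equiv> PBW_monomial H x y g"

lemma pbw_closed [simp]: "pbw i j k \<in> carrier H"
  by (simp add: PBW_monomial_def)

lemma x_pbw: "x \<otimes> pbw i j k = pbw (Suc i) j k"
  by (simp add: PBW_monomial_def m_assoc[symmetric] pow_commute)

lemma y_pbw: "y \<otimes> pbw i j k = (inverse q ^ 2) ^ i \<odot> pbw i (Suc j) k"
proof -
  have "y \<otimes> pbw i j k = (y \<otimes> x [^] i) \<otimes> y [^] j \<otimes> g [^] k"
    by (simp add: PBW_monomial_def m_assoc)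
  also have "\<dots> = (inverse q ^ 2) ^ i \<odot> (x [^] i \<otimes> (y \<otimes> y [^] j) \<otimes> g [^] k)"
    by (simp add: q_commute_pow[OF _ _ yx] smult_mult_left m_assoc)
  finally show ?thesis by (simp add: PBW_monomial_def pow_commute)
qed

lemma g_pbw: "g \<otimes> pbw i j k = ((q ^ 2) ^ i * (inverse q ^ 2) ^ j) \<odot> pbw i j (Suc k)"
proof -
  have "g \<otimes> pbw i j k = (g \<otimes> x [^] i) \<otimes> y [^] j \<otimes> g [^] k"
    by (simp add: PBW_monomial_def m_assoc)
  also have "\<dots> = (q ^ 2) ^ i \<odot> (x [^] i \<otimes> (g \<otimes> y [^] j) \<otimes> g [^] k)"
    by (simp add: q_commute_pow[OF _ _ relations(4)] smult_mult_left m_assoc)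
  also have "\<dots> = ((q ^ 2) ^ i * (inverse q ^ 2) ^ j) \<odot> (x [^] i \<otimes> y [^] j \<otimes> (g \<otimes> g [^] k))"
    by (simp add: q_commute_pow[OF _ _ relations(5)] smult_mult_left smult_mult_right smult_smult m_assoc)
  finally show ?thesis by (simp add: PBW_monomial_def pow_commute)
qed

lemma pbw_overflow: "pbw N j k = \<zero>" "pbw i N k = \<zero>" "pbw i j N = pbw i j 0"
  by (simp_all add: PBW_monomial_def relations)

text \<open>
  All relations of \<open>H\<close> reorder or kill monomials without producing sums, so each word is a multiple of
  one PBW monomial.
\<close>

lemma word_eval_pbw:
  "\<exists>r i j k. i < N \<and> j < N \<and> k < N \<and> word_eval H (case_gr_gen x y g) w = r \<odot> pbw i j k"
proof (induction w)
  case Nil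
  have "word_eval H (case_gr_gen x y g) [] = 1 \<odot> pbw 0 0 0" by (simp add: PBW_monomial_def)
  then show ?case using N by (metis less_trans zero_less_one)
next
  case (Cons s w)
  then obtain r i j k where ijk: "i < N" "j < N" "k < N"
    and w: "word_eval H (case_gr_gen x y g) w = r \<odot> pbw i j k" by blast
  let ?E = "word_eval H (case_gr_gen x y g) (s # w)"
  \<comment> \<open>One factor raises a single exponent, possibly to \<open>N\<close>.\<close>
  have "\<exists>r' i' j' k'. i' \<le> N \<and> j' \<le> N \<and> k' \<le> N \<and> ?E = r' \<odot> pbw i' j' k'"
  proof (cases s)
    case gen_x
    then have "?E = r \<odot> pbw (Suc i) j k" by (simp add: w smult_mult_right x_pbw)
    then show ?thesis using ijk by (metis Suc_leI less_imp_le)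
  next
    case gen_y
    then have "?E = (r * (inverse q ^ 2) ^ i) \<odot> pbw i (Suc j) k"
      by (simp add: w smult_mult_right y_pbw smult_smult)
    then show ?thesis using ijk by (metis Suc_leI less_imp_le)
  next
    case gen_g
    then have "?E = (r * ((q ^ 2) ^ i * (inverse q ^ 2) ^ j)) \<odot> pbw i j (Suc k)"
      by (simp add: w smult_mult_right g_pbw smult_smult)
    then show ?thesis using ijk by (metis Suc_leI less_imp_le)
  qed
  then obtain r' i' j' k' where le: "i' \<le> N" "j' \<le> N" "k' \<le> N" and E: "?E = r' \<odot> pbw i' j' k'" by blast
  show ?case
  proof (cases "i' = N \<or> j' = N")
    case True
    then have "?E = 0 \<odot> pbw 0 0 0" by (auto simp: E pbw_overflow simp del: word_eval_Cons)
    then show ?thesis using N by (metis less_trans zero_less_one)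
  next
    case False
    have "?E = r' \<odot> pbw i' j' (if k' = N then 0 else k')"
      by (simp add: E pbw_overflow del: word_eval_Cons)
    moreover have "i' < N" "j' < N" "(if k' = N then 0 else k') < N" using False le N by auto
    ultimately show ?thesis by blast
  qed
qed

lemma functional_eqI:
  assumes f: "linear_map H scalar_algebra f" and f': "linear_map H scalar_algebra f'"
    and eq: "\<And>i j k. i < N \<Longrightarrow> j < N \<Longrightarrow> k < N \<Longrightarrow> f (pbw i j k) = f' (pbw i j k)"
    and a: "a \<in> carrier H"
  shows "f a = f' a"
proof -
  have "f (free_eval H (case_gr_gen x y g) p) = f' (free_eval H (case_gr_gen x y g) p)" for p
  proof (induction p rule: poly_mapping_induct_add)
    case (single w r)
    obtain s i j k where "i < N" "j < N" "k < N" "word_eval H (case_gr_gen x y g) w = s \<odot> pbw i j k"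
      using word_eval_pbw by blast
    then show ?case
      by (simp add: free_eval_single[OF range_generators] linear_map_smult[OF f] linear_map_smult[OF f'] eq)
  next
    case (add p r)
    then show ?case
      by (simp add: free_eval_add[OF range_generators] free_eval_closed[OF range_generators]
          linear_map_add[OF f] linear_map_add[OF f'])
  qed
  then show ?thesis
    using a presented_byD(3)[OF presented] by (metis imageE)
qed

end

section \<open>The cocycle on the associated graded Hopf algebra\<close>

locale gr_uq_cocycle = gr_uq N q H x y g
  for N :: nat and q :: "'k::field" and H :: "('k, 'h) bialgebra" (structure) and x y g :: 'h +
  fixes \<sigma> :: "'h \<Rightarrow> 'h \<Rightarrow> 'k"
  assumes uq_cocycle: "is_uq_cocycle N q H x y g \<sigma>"

sublocale gr_uq_cocycle \<subseteq> cocycle H \<sigma>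
  using uq_cocycle by unfold_locales (simp add: is_uq_cocycle_def)

context gr_uq_cocycle
begin

lemma sigma_pbw:
  "i1 < N \<Longrightarrow> j1 < N \<Longrightarrow> k1 < N \<Longrightarrow> i2 < N \<Longrightarrow> j2 < N \<Longrightarrow> k2 < N \<Longrightarrow>
    \<sigma> (pbw i1 j1 k1) (pbw i2 j2 k2) =
      (if i1 = j2 \<and> j1 = 0 \<and> i2 = 0 then q_fact (q ^ 2) i1 * inverse q ^ (2 * i1 * k1) else 0)"
  using uq_cocycle by (simp add: is_uq_cocycle_def)

lemma pbw_generators: "pbw 0 0 0 = \<one>" "pbw (Suc 0) 0 0 = x" "pbw 0 (Suc 0) 0 = y" "pbw 0 0 k = g [^] k"
  by (simp_all add: PBW_monomial_def)

lemma counit_pbw: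
  "i < N \<Longrightarrow> j < N \<Longrightarrow> k < N \<Longrightarrow> counit H (pbw i j k) = (if i = 0 \<and> j = 0 then 1 else 0)"
  using sigma_pbw[of 0 0 0 i j k] N sigma_one(2)[of "pbw i j k"] by (simp add: pbw_generators q_fact_def)

lemma sigma_x_pbw:
  "i < N \<Longrightarrow> j < N \<Longrightarrow> k < N \<Longrightarrow> \<sigma> x (pbw i j k) = (if i = 0 \<and> j = 1 then 1 else 0)"
  using sigma_pbw[of "Suc 0" 0 0 i j k] N by (simp add: pbw_generators q_fact_def)

lemmas zero_functional = linear_map_const_zero[OF k_space_scalar_algebra, simplified]

lemmas sigma_right = bilinear_map_right[OF sigma_bilinear]

lemma sigma_y: "a \<in> carrier H \<Longrightarrow> \<sigma> y a = 0"
  by (rule functional_eqI[of "\<sigma> y" "\<lambda>_. 0"])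
     (use N sigma_pbw[of 0 "Suc 0" 0] in \<open>simp_all add: pbw_generators zero_functional sigma_right\<close>)

lemma sigma_g_pow: "a \<in> carrier H \<Longrightarrow> k < N \<Longrightarrow> \<sigma> (g [^] k) a = counit H a"
  by (rule functional_eqI[of "\<sigma> (g [^] k)" "counit H"])
     (use sigma_pbw[of 0 0 k] in \<open>simp_all add: pbw_generators counit_pbw q_fact_def sigma_right counit_linear\<close>)

lemma sigma_smult: "a \<in> carrier H \<Longrightarrow> b \<in> carrier H \<Longrightarrow> \<sigma> a (r \<odot> b) = r * \<sigma> a b"
  using linear_map_smult[OF sigma_right] by simp

lemma sigma_zero: "a \<in> carrier H \<Longrightarrow> \<sigma> a \<zero> = 0"
  using linear_map_zero[OF k_space_axioms k_space_scalar_algebra sigma_right] by simp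

lemma sigma_mult_linear: "a \<in> carrier H \<Longrightarrow> b \<in> carrier H \<Longrightarrow> linear_map H scalar_algebra (\<lambda>h. \<sigma> a (b \<otimes> h))"
  by (intro linear_map_comp[OF bilinear_map_right[OF bilinear_mult] sigma_right])

text \<open>
  The functional \<open>\<sigma>(x, -)\<close> is one on the monomials \<open>y g\<^bsup>k\<^esup>\<close> and zero on all other PBW monomials. The next
  lemmas compute it on left multiples. The cases where an exponent reaches \<open>N\<close> are consistent, because
  \<open>x\<^bsup>N\<^esup>\<close> and \<open>y\<^bsup>N\<^esup>\<close> vanish and \<open>N > 1\<close>.
\<close>

lemma sigma_x_x: "a \<in> carrier H \<Longrightarrow> \<sigma> x (x \<otimes> a) = 0"
proof (rule functional_eqI[of "\<lambda>a. \<sigma> x (x \<otimes> a)" "\<lambda>_. 0"])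
  fix i j k assume "i < N" "j < N" "k < N"
  then show "\<sigma> x (x \<otimes> pbw i j k) = 0"
    by (cases "Suc i = N") (simp_all add: x_pbw pbw_overflow sigma_zero sigma_x_pbw)
qed (auto simp: sigma_mult_linear zero_functional)

lemma sigma_x_y: "a \<in> carrier H \<Longrightarrow> \<sigma> x (y \<otimes> a) = counit H a"
proof (rule functional_eqI[of "\<lambda>a. \<sigma> x (y \<otimes> a)" "counit H"])
  fix i j k assume "i < N" "j < N" "k < N"
  then show "\<sigma> x (y \<otimes> pbw i j k) = counit H (pbw i j k)"
    using N by (cases "Suc j = N") (auto simp: y_pbw pbw_overflow sigma_zero sigma_smult sigma_x_pbw counit_pbw)
qed (auto simp: sigma_mult_linear counit_linear)

lemma sigma_x_g: "a \<in> carrier H \<Longrightarrow> \<sigma> x (g \<otimes> a) = inverse q ^ 2 * \<sigma> x a"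
proof (rule functional_eqI[of "\<lambda>a. \<sigma> x (g \<otimes> a)" "\<lambda>a. inverse q ^ 2 * \<sigma> x a"])
  fix i j k assume "i < N" "j < N" "k < N"
  then show "\<sigma> x (g \<otimes> pbw i j k) = inverse q ^ 2 * \<sigma> x (pbw i j k)"
    using N by (cases "Suc k = N") (auto simp: g_pbw pbw_overflow sigma_smult sigma_x_pbw)
qed (auto simp: sigma_mult_linear intro!: linear_map_mult_scalar sigma_right)

abbreviation "g' \<equiv> inv g"

lemma g_inverse: "g' = g [^] (N - 1)" "g \<otimes> g' = \<one>" "g' \<otimes> g = \<one>"
proof -
  have 1: "g \<otimes> g [^] (N - 1) = \<one>" "g [^] (N - 1) \<otimes> g = \<one>"
    using relations(3) N nat_pow_Suc[of g "N - 1"] by (simp_all add: pow_commute)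
  then show "g' = g [^] (N - 1)"
    by (intro inv_char) simp_all
  then show "g \<otimes> g' = \<one>" "g' \<otimes> g = \<one>" using 1 by simp_all
qed

lemma g'_closed [simp]: "g' \<in> carrier H"
  by (simp add: g_inverse(1))

lemma sigma_g': "a \<in> carrier H \<Longrightarrow> \<sigma> g' a = counit H a"
  using N by (simp add: g_inverse(1) sigma_g_pow)

lemma sigma_x_g': "a \<in> carrier H \<Longrightarrow> \<sigma> x (g' \<otimes> a) = q ^ 2 * \<sigma> x a"
  using sigma_x_g[of "g' \<otimes> a"] q_nonzero
  by (simp add: g_inverse(2) field_simps flip: m_assoc)

sublocale HHa: algebra_factors H H ..

lemma comult_hom: "comult H \<in> alg_hom H (tensor H H)"
  using is_bialgebra by (simp add: is_bialgebra_def)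

lemma comult_g_pow: "comult H (g [^] n) = pure_tensor H H (g [^] n) (g [^] (n::nat))"
proof (induction n)
  case 0
  show ?case using alg_hom_one[OF comult_hom] by (simp add: HH.one_tensor)
next
  case (Suc n)
  have "comult H g = pure_tensor H H g g"
    using gr by (simp add: is_gr_uq_sl2_def)
  then show ?case
    by (simp add: alg_hom_mult[OF comult_hom] Suc HHa.mult_pure)
qed

lemma g_inverse_deformed: "g \<otimes>\<^bsub>D\<^esub> g' = \<one>" "g' \<otimes>\<^bsub>D\<^esub> g = \<one>"
proof -
  \<comment> \<open>\<open>inv g\<close> is \<open>g ^ (N - 1)\<close>, hence group-like as well.\<close>
  have gl: "g [^] k \<in> carrier H" "comult H (g [^] k) = pure_tensor H H (g [^] k) (g [^] k)"
    "counit H (g [^] k) = 1" if "k < N" for k :: nat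
    using that counit_pbw[of 0 0 k] N by (simp_all add: comult_g_pow pbw_generators)
  have "g \<otimes>\<^bsub>D\<^esub> g' = g \<otimes> g'" "g' \<otimes>\<^bsub>D\<^esub> g = g' \<otimes> g"
    using gl[of 1] gl[of "N - 1"] N
    by (simp_all add: grouplike_deformed_mult g_inverse(1))
  then show "g \<otimes>\<^bsub>D\<^esub> g' = \<one>" "g' \<otimes>\<^bsub>D\<^esub> g = \<one>"
    by (simp_all add: g_inverse(2,3))
qed

end

section \<open>The twisted powers of the generator\<close>

definition contract :: "('k::field, 'l, 'n) module_scheme \<Rightarrow> ('h \<Rightarrow> 'k) \<Rightarrow> ('k, 'h, 'l) tensor \<Rightarrow> 'l" where
  "contract L f = tensor_lift L (\<lambda>h l. f h \<odot>\<^bsub>L\<^esub> l)"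

lemma (in tensor_factors) contract_linear:
  "linear_map A scalar_algebra f \<Longrightarrow> linear_map AB B (contract B f)"
  unfolding contract_def
  by (intro tensor_lift_linear B.bilinear_functional_left A.k_space_axioms B.k_space_axioms)

lemma (in tensor_factors) contract_pure:
  "linear_map A scalar_algebra f \<Longrightarrow> a \<in> carrier A \<Longrightarrow> b \<in> carrier B \<Longrightarrow>
    contract B f (pure_tensor A B a b) = f a \<odot>\<^bsub>B\<^esub> b"
  unfolding contract_def
  by (intro tensor_lift_pure B.bilinear_functional_left A.k_space_axioms B.k_space_axioms)

locale gr_uq_L4 = gr_uq_cocycle N q H x y g \<sigma>
  for N :: nat and q :: "'k::field" and H :: "('k, 'h) bialgebra" (structure) and x y g :: 'h and \<sigma> +
  fixes \<alpha> \<beta> \<xi> :: 'k and L :: "('k, 'l) module" and \<delta> and W :: 'l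
  assumes L4: "is_L4 N H x y g \<alpha> \<beta> \<xi> L \<delta> W"
begin

abbreviation "xy \<equiv> \<alpha> \<odot> x \<oplus> \<beta> \<odot> y"
abbreviation "A \<equiv> twisted_algebra \<sigma> L \<delta>"

lemma comodule_algebra: "left_comodule_algebra H L \<delta>"
  using L4 by (simp add: is_L4_def)

sublocale L: k_algebra L
  using comodule_algebra by (simp add: left_comodule_algebra_def)

sublocale HL: algebra_factors H L ..

lemma presented_L: "presented_by L (\<lambda>_::unit. W) {gen () ^ N - const \<xi>}"
  using L4 by (simp add: is_L4_def)

lemma W_closed [simp]: "W \<in> carrier L"
  using presented_byD(2)[OF presented_L] by auto

lemma coaction_hom: "\<delta> \<in> alg_hom L (tensor H L)"
  using comodule_algebra by (simp add: left_comodule_algebra_def)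

lemmas coaction_linear = alg_hom_linear_map[OF coaction_hom]
lemmas coaction_closed [simp] = linear_map_closed[OF coaction_linear]

lemma coaction_W: "\<delta> W = pure_tensor H L xy \<one>\<^bsub>L\<^esub> \<oplus>\<^bsub>tensor H L\<^esub> pure_tensor H L g' W"
  using L4 by (simp add: is_L4_def)

lemma contract_counit: "a \<in> carrier L \<Longrightarrow> contract L (counit H) (\<delta> a) = a"
  using comodule_algebra by (simp add: left_comodule_algebra_def left_comodule_def contract_def)

lemma sigma_X: "a \<in> carrier H \<Longrightarrow> \<sigma> xy a = \<alpha> * \<sigma> x a"
  using linear_map_add[OF bilinear_map_left[OF sigma_bilinear]]
    linear_map_smult[OF bilinear_map_left[OF sigma_bilinear]]
  by (simp add: sigma_y)

lemma sigma_x_X: "a \<in> carrier H \<Longrightarrow> \<sigma> x (xy \<otimes> a) = \<beta> * counit H a"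
  using linear_map_add[OF sigma_right[of x]]
  by (simp add: l_distr smult_mult_left sigma_smult sigma_x_x sigma_x_y)

lemma twisted_mult_W:
  assumes a: "a \<in> carrier L"
  shows "W \<otimes>\<^bsub>A\<^esub> a = \<alpha> \<odot>\<^bsub>L\<^esub> contract L (\<sigma> x) (\<delta> a) \<oplus>\<^bsub>L\<^esub> W \<otimes>\<^bsub>L\<^esub> a"
proof -
  let ?f = "\<lambda>h b. tensor_lift L (\<lambda>h' b'. \<sigma> h h' \<odot>\<^bsub>L\<^esub> (b \<otimes>\<^bsub>L\<^esub> b'))"
  note inner = HL.bilinear_twist_inner[OF sigma_bilinear]
  note outer = HL.bilinear_twist_outer[OF sigma_bilinear coaction_closed[OF a]]
  have "W \<otimes>\<^bsub>A\<^esub> a = tensor_lift L (\<lambda>h b. ?f h b (\<delta> a)) (\<delta> W)"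
    by (simp add: twisted_algebra_def)
  also have "\<dots> = ?f xy \<one>\<^bsub>L\<^esub> (\<delta> a) \<oplus>\<^bsub>L\<^esub> ?f g' W (\<delta> a)"
    using linear_map_add[OF HL.tensor_lift_linear[OF L.k_space_axioms outer]]
    by (simp add: coaction_W HL.tensor_lift_pure[OF L.k_space_axioms outer])
  also have "?f xy \<one>\<^bsub>L\<^esub> (\<delta> a) = \<alpha> \<odot>\<^bsub>L\<^esub> contract L (\<sigma> x) (\<delta> a)"
    by (rule HL.linear_map_tensor_eqI[OF HL.tensor_lift_linear[OF L.k_space_axioms inner]
          linear_map_scale[OF L.k_space_axioms HL.contract_linear[OF sigma_right]]])
       (simp_all add: a HL.tensor_lift_pure[OF L.k_space_axioms inner] HL.contract_pure[OF sigma_right]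
          sigma_X L.smult_smult)
  also have "?f g' W (\<delta> a) = W \<otimes>\<^bsub>L\<^esub> contract L (counit H) (\<delta> a)"
    by (rule HL.linear_map_tensor_eqI[OF HL.tensor_lift_linear[OF L.k_space_axioms inner]
          linear_map_comp[OF HL.contract_linear[OF counit_linear] bilinear_map_right[OF L.bilinear_mult]]])
       (simp_all add: a HL.tensor_lift_pure[OF L.k_space_axioms inner] HL.contract_pure[OF counit_linear]
          sigma_g' L.smult_mult_right)
  finally show ?thesis using a by (simp add: contract_counit)
qed

text \<open>
  \<open>contract L (\<sigma> x) (\<delta> a)\<close> is \<open>\<sigma>(x, a\<^sub>(\<^sub>-\<^sub>1\<^sub>)) a\<^sub>(\<^sub>0\<^sub>)\<close>. It inherits a Leibniz rule from the behaviour of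
  \<open>\<sigma>(x, -)\<close> on left multiples of \<open>x\<close>, \<open>y\<close> and \<open>g\<^sup>-\<^sup>1\<close>.
\<close>

lemma contract_coaction_W:
  assumes a: "a \<in> carrier L"
  shows "contract L (\<sigma> x) (\<delta> (W \<otimes>\<^bsub>L\<^esub> a)) =
    \<beta> \<odot>\<^bsub>L\<^esub> a \<oplus>\<^bsub>L\<^esub> q ^ 2 \<odot>\<^bsub>L\<^esub> (W \<otimes>\<^bsub>L\<^esub> contract L (\<sigma> x) (\<delta> a))"
proof -
  let ?HL = "tensor H L"
  note cx = HL.contract_linear[OF sigma_right[OF generators_closed(1)]]
  have ml: "linear_map ?HL ?HL (\<lambda>t. pure_tensor H L h l \<otimes>\<^bsub>?HL\<^esub> t)" if "h \<in> carrier H" "l \<in> carrier L" for h l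
    using that by (intro bilinear_map_right[OF HL.bilinear_tensor_mult]) simp
  have "\<delta> (W \<otimes>\<^bsub>L\<^esub> a) = pure_tensor H L xy \<one>\<^bsub>L\<^esub> \<otimes>\<^bsub>?HL\<^esub> \<delta> a \<oplus>\<^bsub>?HL\<^esub> pure_tensor H L g' W \<otimes>\<^bsub>?HL\<^esub> \<delta> a"
    using a by (simp add: alg_hom_mult[OF coaction_hom] coaction_W HL.tensor_add_mult)
  then have "contract L (\<sigma> x) (\<delta> (W \<otimes>\<^bsub>L\<^esub> a)) =
      contract L (\<sigma> x) (pure_tensor H L xy \<one>\<^bsub>L\<^esub> \<otimes>\<^bsub>?HL\<^esub> \<delta> a) \<oplus>\<^bsub>L\<^esub>
      contract L (\<sigma> x) (pure_tensor H L g' W \<otimes>\<^bsub>?HL\<^esub> \<delta> a)"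
    using a by (simp add: linear_map_add[OF cx] HL.tensor_mult_closed)
  also have "contract L (\<sigma> x) (pure_tensor H L xy \<one>\<^bsub>L\<^esub> \<otimes>\<^bsub>?HL\<^esub> \<delta> a) =
      \<beta> \<odot>\<^bsub>L\<^esub> contract L (counit H) (\<delta> a)"
    by (rule HL.linear_map_tensor_eqI[OF linear_map_comp[OF ml cx]
          linear_map_scale[OF L.k_space_axioms HL.contract_linear[OF counit_linear]]])
       (simp_all add: a HL.mult_pure HL.contract_pure[OF sigma_right] HL.contract_pure[OF counit_linear]
          sigma_x_X L.smult_smult)
  also have "contract L (\<sigma> x) (pure_tensor H L g' W \<otimes>\<^bsub>?HL\<^esub> \<delta> a) =
      q ^ 2 \<odot>\<^bsub>L\<^esub> (W \<otimes>\<^bsub>L\<^esub> contract L (\<sigma> x) (\<delta> a))"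
    by (rule HL.linear_map_tensor_eqI[OF linear_map_comp[OF ml cx]
          linear_map_scale[OF L.k_space_axioms linear_map_comp[OF cx bilinear_map_right[OF L.bilinear_mult]]]])
       (simp_all add: a HL.mult_pure HL.contract_pure[OF sigma_right] sigma_x_g'
          L.smult_mult_right L.smult_smult)
  finally show ?thesis using a by (simp add: contract_counit)
qed

lemma contract_coaction_W_pow:
  "contract L (\<sigma> x) (\<delta> (W [^]\<^bsub>L\<^esub> Suc m)) = (\<beta> * (\<Sum>j<Suc m. (q ^ 2) ^ j)) \<odot>\<^bsub>L\<^esub> W [^]\<^bsub>L\<^esub> m"
proof (induction m)
  case 0
  have "contract L (\<sigma> x) (\<delta> \<one>\<^bsub>L\<^esub>) = \<zero>\<^bsub>L\<^esub>"
    using sigma_x_pbw[of 0 0 0] N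
    by (simp add: alg_hom_one[OF coaction_hom] HL.one_tensor HL.contract_pure[OF sigma_right] pbw_generators)
  then show ?case
    using contract_coaction_W[of "\<one>\<^bsub>L\<^esub>"] by simp
next
  case (Suc m)
  have "W [^]\<^bsub>L\<^esub> Suc (Suc m) = W \<otimes>\<^bsub>L\<^esub> W [^]\<^bsub>L\<^esub> Suc m"
    by (simp only: L.nat_pow_Suc2 W_closed)
  then have "contract L (\<sigma> x) (\<delta> (W [^]\<^bsub>L\<^esub> Suc (Suc m))) = \<beta> \<odot>\<^bsub>L\<^esub> W [^]\<^bsub>L\<^esub> Suc m \<oplus>\<^bsub>L\<^esub>
      q ^ 2 \<odot>\<^bsub>L\<^esub> (W \<otimes>\<^bsub>L\<^esub> ((\<beta> * (\<Sum>j<Suc m. (q ^ 2) ^ j)) \<odot>\<^bsub>L\<^esub> W [^]\<^bsub>L\<^esub> m))"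
    by (simp only: contract_coaction_W L.nat_pow_closed W_closed Suc)
  also have "\<dots> = (\<beta> + q ^ 2 * (\<beta> * (\<Sum>j<Suc m. (q ^ 2) ^ j))) \<odot>\<^bsub>L\<^esub> W [^]\<^bsub>L\<^esub> Suc m"
    by (simp add: L.smult_mult_right L.smult_smult L.smult_add_left L.pow_commute)
  also have "\<beta> + q ^ 2 * (\<beta> * (\<Sum>j<Suc m. (q ^ 2) ^ j)) = \<beta> * (\<Sum>j<Suc (Suc m). (q ^ 2) ^ j)"
    unfolding sum.lessThan_Suc_shift[of _ "Suc m"] by (simp add: sum_distrib_left algebra_simps)
  finally show ?case .
qed

lemma twisted_mult_W_pow:
  "W \<otimes>\<^bsub>A\<^esub> W [^]\<^bsub>L\<^esub> Suc m =
    (\<alpha> * \<beta> * (\<Sum>j<Suc m. (q ^ 2) ^ j)) \<odot>\<^bsub>L\<^esub> W [^]\<^bsub>L\<^esub> m \<oplus>\<^bsub>L\<^esub> W [^]\<^bsub>L\<^esub> Suc (Suc m)"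
proof -
  have "W \<otimes>\<^bsub>L\<^esub> W [^]\<^bsub>L\<^esub> Suc m = W [^]\<^bsub>L\<^esub> Suc (Suc m)"
    by (rule L.nat_pow_Suc2[symmetric]) simp
  then show ?thesis
    using twisted_mult_W[of "W [^]\<^bsub>L\<^esub> Suc m"]
    by (simp only: contract_coaction_W_pow L.nat_pow_closed W_closed L.smult_smult mult.assoc)
qed

end

section \<open>The twisted algebra\<close>

lemma square_primitive_root:
  fixes q :: "'k::field"
  assumes "odd N" "q ^ N = 1" "\<And>m. 0 < m \<Longrightarrow> m < N \<Longrightarrow> q ^ m \<noteq> 1" "0 < m" "m < N"
  shows "(q ^ 2) ^ m \<noteq> 1"
proof
  assume "(q ^ 2) ^ m = 1"
  then have q2m: "q ^ (2 * m) = 1" by (simp add: power_mult)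
  show False
  proof (cases "2 * m < N")
    case True
    then show False using assms(3)[of "2 * m"] assms(4) q2m by simp
  next
    case False
    then have "2 * m > N" using assms(1) by (metis dvd_triv_left linorder_neqE_nat)
    moreover from this have "q ^ (2 * m - N) * q ^ N = 1"
      using q2m by (simp flip: power_add)
    ultimately show False
      using assms(3)[of "2 * m - N"] assms(2,5) by simp
  qed
qed

lemma to_poly_power_relation:
  "to_poly (gen () ^ N - const \<xi>) = monom 1 N - [:\<xi> :: 'k::field:]"
  by (simp add: to_poly_diff to_poly_pow to_poly_single monom_0 monom_power flip: monom_altdef)
    
lemma to_poly_phi:
  "to_poly (phi N q \<alpha> \<beta> \<xi> (gen ())) =
    (\<Sum>k = 0..(N - 1) div 2. smult (of_nat N / of_nat (N - k) * of_nat ((N - k) choose k) *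
       (\<alpha> * \<beta> / (q ^ 2 - 1)) ^ k) ([:0, 1:] ^ (N - 2 * k))) - [:\<xi> :: 'k::field:]"
proof -
  have "to_poly (gen ()) = [:0, 1 :: 'k:]" by (simp add: to_poly_single monom_altdef)
  then show ?thesis
    by (simp add: phi_def to_poly_diff to_poly_sum to_poly_mult to_poly_pow)
       (simp add: to_poly_single monom_0)
qed

lemma monic_minus_const:
  fixes f :: "'k::field poly"
  assumes "degree f = n" "coeff f n = 1" "n > 0"
  shows "degree (f - [:r:]) = n" "coeff (f - [:r:]) n = 1"
proof -
  show c: "coeff (f - [:r:]) n = 1"
    using assms by (simp add: coeff_pCons split: nat.split)
  show "degree (f - [:r:]) = n"
    using assms c by (intro antisym degree_diff_le le_degree) simp_all
qed

context gr_uq_L4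
begin

lemma W_pow_N: "W [^]\<^bsub>L\<^esub> N = \<xi> \<odot>\<^bsub>L\<^esub> \<one>\<^bsub>L\<^esub>"
proof -
  have r: "range (\<lambda>_::unit. W) \<subseteq> carrier L" by simp
  have "free_eval L (\<lambda>_. W) (gen () ^ N - const \<xi>) = \<zero>\<^bsub>L\<^esub>"
    by (rule presented_byD(4)[OF presented_L]) simp
  then show ?thesis
    by (simp only: L.free_eval_diff[OF r] L.free_eval_pow[OF r] L.free_eval_gen[OF r] L.free_eval_const[OF r])
      (simp add: L.r_right_minus_eq)
qed

lemma L_basis: "\<exists>c. finite_basis L {..<N} (\<lambda>i. W [^]\<^bsub>L\<^esub> i) c"
proof -
  interpret W: pointed_algebra L W by unfold_locales simp
  have "Polynomial.degree (Polynomial.monom 1 N - [:\<xi>:]) = N" "Polynomial.coeff (Polynomial.monom 1 N - [:\<xi>:]) N = 1"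
    using N by (intro monic_minus_const; simp add: Polynomial.degree_monom_eq)+
  then show ?thesis
    using W.presented_by_monic_iff[of "gen () ^ N - const \<xi>" N] presented_L N
    by (intro W.powers_finite_basis) (auto simp: to_poly_power_relation)
qed

text \<open>
  The recursion of the q-Hermite polynomials is \<open>twisted_mult_W_pow\<close> solved for the highest power.
\<close>

lemma poly_eval_q_hermite:
  assumes A: "k_algebra A"
  shows "poly_eval A W (q_hermite (q ^ 2) (\<alpha> * \<beta>) m) = W [^]\<^bsub>L\<^esub> m"
proof -
  interpret A: k_algebra A by (rule A)
  have simps [simp]: "carrier A = carrier L" "\<one>\<^bsub>A\<^esub> = \<one>\<^bsub>L\<^esub>" "r \<odot>\<^bsub>A\<^esub> a = r \<odot>\<^bsub>L\<^esub> a" "a \<oplus>\<^bsub>A\<^esub> b = a \<oplus>\<^bsub>L\<^esub> b" for r a b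
    by (simp_all add: twisted_algebra_def)
  interpret W: pointed_algebra A W by unfold_locales simp
  show ?thesis
  proof (induction m rule: less_induct)
    case (less m)
    consider "m = 0" | "m = Suc 0" | n where "m = Suc (Suc n)"
      by (metis old.nat.exhaust)
    then show ?case
    proof cases
      case 3
      let ?b = "\<alpha> * \<beta> * (\<Sum>j<Suc n. (q ^ 2) ^ j)"
      have "poly_eval A W (q_hermite (q ^ 2) (\<alpha> * \<beta>) m) =
          W \<otimes>\<^bsub>A\<^esub> W [^]\<^bsub>L\<^esub> Suc n \<ominus>\<^bsub>A\<^esub> ?b \<odot>\<^bsub>L\<^esub> W [^]\<^bsub>L\<^esub> n"
        unfolding 3 q_hermite.simps(3) W.poly_eval_diff W.poly_eval_mult W.poly_eval_smult W.poly_eval_X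
        using less[of n] less[of "Suc n"] 3 by simp
      also have "W \<otimes>\<^bsub>A\<^esub> W [^]\<^bsub>L\<^esub> Suc n = W [^]\<^bsub>L\<^esub> m \<oplus>\<^bsub>A\<^esub> ?b \<odot>\<^bsub>L\<^esub> W [^]\<^bsub>L\<^esub> n"
        unfolding twisted_mult_W_pow 3 by (simp add: L.a_comm del: L.nat_pow_Suc)
      also have "\<dots> \<ominus>\<^bsub>A\<^esub> ?b \<odot>\<^bsub>L\<^esub> W [^]\<^bsub>L\<^esub> n = W [^]\<^bsub>L\<^esub> m"
        using A.r_neg[of "?b \<odot>\<^bsub>L\<^esub> W [^]\<^bsub>L\<^esub> n"] A.a_inv_closed[of "?b \<odot>\<^bsub>L\<^esub> W [^]\<^bsub>L\<^esub> n"]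
          A.a_assoc[of "W [^]\<^bsub>L\<^esub> m" "?b \<odot>\<^bsub>L\<^esub> W [^]\<^bsub>L\<^esub> n" "\<ominus>\<^bsub>A\<^esub> (?b \<odot>\<^bsub>L\<^esub> W [^]\<^bsub>L\<^esub> n)"] A.r_zero[of "W [^]\<^bsub>L\<^esub> m"]
        unfolding a_minus_def simps by simp
      finally show ?thesis .
    qed simp_all
  qed
qed

end

theorem lemma5p22:
  fixes q \<alpha> \<beta> \<xi> :: "'k :: {alg_closed_field, field_char_0}"
    and N :: nat
    and U :: "('k, 'u) bialgebra" and E F K :: 'u
    and H :: "('k, 'h) bialgebra" and x y g :: 'h
    and \<sigma> :: "'h \<Rightarrow> 'h \<Rightarrow> 'k" and \<iota> :: "'h \<Rightarrow> 'u"
    and L :: "('k, 'l) module" and \<delta> :: "'l \<Rightarrow> ('k, 'h, 'l) tensor" and W :: 'l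
  assumes "N > 1" and "odd N"
    and "q ^ N = 1" and "\<And>m. 0 < m \<Longrightarrow> m < N \<Longrightarrow> q ^ m \<noteq> 1"
    and "(\<alpha>, \<beta>) \<noteq> (0, 0)"
    and "is_uq_sl2 N q U E F K"
    and "is_gr_uq_sl2 N q H x y g"
    and "is_uq_cocycle N q H x y g \<sigma>"
    and "hopf_iso (cocycle_deformation H \<sigma>) U \<iota>"
    and "\<iota> x = E_tilde U q E K" and "\<iota> y = F" and "\<iota> g = K"
    and "is_L4 N H x y g \<alpha> \<beta> \<xi> L \<delta> W"
  defines "A \<equiv> twisted_algebra \<sigma> L \<delta>"
    and "\<delta>A \<equiv> push_coaction U L \<iota> \<delta>"
  shows "left_comodule_algebra U A \<delta>A \<and>
    presented_by A (\<lambda>_::unit. W) {phi N q \<alpha> \<beta> \<xi> (gen ())} \<and>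
    \<delta>A W = pure_tensor U A (\<alpha> \<odot>\<^bsub>U\<^esub> E_tilde U q E K \<oplus>\<^bsub>U\<^esub> \<beta> \<odot>\<^bsub>U\<^esub> F) \<one>\<^bsub>A\<^esub>
             \<oplus>\<^bsub>tensor U A\<^esub> pure_tensor U A (inv\<^bsub>U\<^esub> K) W"
proof (intro conjI)
  note iso = assms(9)
  interpret L4: gr_uq_L4 N q H x y g \<sigma> \<alpha> \<beta> \<xi> L \<delta> W
    using assms(1,3,7,8,13) by unfold_locales
  \<comment> \<open>The basis of powers of \<open>W\<close> with respect to the product of \<open>L\<close>, not of \<open>A\<close>.\<close>
  obtain c where basis: "finite_basis L {..<N} (\<lambda>i. W [^]\<^bsub>L\<^esub> i) c"
    using L4.L_basis by blast
  show com: "left_comodule_algebra U A \<delta>A"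
    unfolding A_def \<delta>A_def
    by (rule twisted_comodule_algebra[OF L4.is_bialgebra L4.cocycle iso L4.comodule_algebra basis])
  then have A: "k_algebra A" by (simp add: left_comodule_algebra_def)
  then interpret A: k_algebra A .
  interpret W: pointed_algebra A W by unfold_locales (simp add: A_def twisted_algebra_def)
  let ?P = "q_hermite (q ^ 2) (\<alpha> * \<beta>)"
  have eval: "poly_eval A W (?P m) = W [^]\<^bsub>L\<^esub> m" for m
    using L4.poly_eval_q_hermite A by (simp add: A_def)
  have phi: "to_poly (phi N q \<alpha> \<beta> \<xi> (gen ())) = ?P N - [:\<xi>:]"
  proof -
    have "(q ^ 2) ^ N = 1"
      using assms(3) by (metis mult.commute power_mult power_one)
    then show ?thesis
      unfolding to_poly_phi
      using q_hermite_root_of_unity[of N "q ^ 2" "\<alpha> * \<beta>"] assms(1,2) square_primitive_root[OF assms(2-4)]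
      by (metis (no_types, lifting))
  qed
  have deg: "degree (?P N - [:\<xi>:]) = N" "coeff (?P N - [:\<xi>:]) N = 1"
    using q_hermite_monic[of "q ^ 2" "\<alpha> * \<beta>" N] assms(1)
    by (intro monic_minus_const; simp)+
  have "poly_eval A W (?P N - [:\<xi>:]) = \<zero>\<^bsub>A\<^esub>"
  proof -
    have "poly_eval A W [:\<xi>:] = \<xi> \<odot>\<^bsub>A\<^esub> \<one>\<^bsub>A\<^esub>"
      using W.poly_eval_monom[of \<xi> 0] by (simp add: monom_0)
    moreover have "W [^]\<^bsub>L\<^esub> N = \<xi> \<odot>\<^bsub>A\<^esub> \<one>\<^bsub>A\<^esub>"
      using L4.W_pow_N by (simp add: A_def twisted_algebra_def)
    ultimately show ?thesis
      by (simp add: W.poly_eval_diff eval A.r_right_minus_eq)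
  qed
  then show "presented_by A (\<lambda>_::unit. W) {phi N q \<alpha> \<beta> \<xi> (gen ())}"
    using assms(1) deg q_hermite_monic same_space_twisted_algebra[of L \<sigma> \<delta>] eval W.w_closed
    by (intro presented_by_change_of_basis[OF basis A, where P = ?P])
       (auto simp only: phi A_def)
  show "\<delta>A W = pure_tensor U A (\<alpha> \<odot>\<^bsub>U\<^esub> E_tilde U q E K \<oplus>\<^bsub>U\<^esub> \<beta> \<odot>\<^bsub>U\<^esub> F) \<one>\<^bsub>A\<^esub>
             \<oplus>\<^bsub>tensor U A\<^esub> pure_tensor U A (inv\<^bsub>U\<^esub> K) W"
  proof -
    interpret U: k_algebra U using bialgebraD(1)[OF hopf_isoD(2)[OF iso]] .
    interpret UL: tensor_factors U L by (intro tensor_factorsI U.k_space_axioms L4.L.k_space_axioms)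
    have \<iota>: "linear_map H U \<iota>"
      using hopf_isoD(4)[OF iso] same_space_linear_map[OF same_space_cocycle_deformation same_space_refl] by blast
    note \<iota>c = linear_map_closed[OF \<iota>]
    \<comment> \<open>\<open>\<iota>\<close> is multiplicative for the deformed product only, but \<open>g\<close> and its inverse are group-like.\<close>
    have mult: "\<iota> (a \<otimes>\<^bsub>L4.D\<^esub> b) = \<iota> a \<otimes>\<^bsub>U\<^esub> \<iota> b" if "a \<in> carrier H" "b \<in> carrier H" for a b
      using alg_hom_mult[OF hopf_isoD(3)[OF iso]] that by simp
    have "\<iota> \<one>\<^bsub>H\<^esub> = \<one>\<^bsub>U\<^esub>"
      using alg_hom_one[OF hopf_isoD(3)[OF iso]] by simp
    then have "\<iota> g \<otimes>\<^bsub>U\<^esub> \<iota> L4.g' = \<one>\<^bsub>U\<^esub>" "\<iota> L4.g' \<otimes>\<^bsub>U\<^esub> \<iota> g = \<one>\<^bsub>U\<^esub>"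
      by (simp_all add: L4.g_inverse_deformed flip: mult)
    then have inv: "\<iota> L4.g' = inv\<^bsub>U\<^esub> K"
      using assms(12) \<iota>c by (intro U.inv_char[symmetric]) auto
    have \<iota>xy: "\<iota> L4.xy = \<alpha> \<odot>\<^bsub>U\<^esub> E_tilde U q E K \<oplus>\<^bsub>U\<^esub> \<beta> \<odot>\<^bsub>U\<^esub> F"
      by (simp add: linear_map_add[OF \<iota>] linear_map_smult[OF \<iota>] assms(10,11))
    have B: "bilinear_map H L (tensor U L) (\<lambda>h l. pure_tensor U L (\<iota> h) l)"
      by (rule bilinear_map_comp[OF UL.bilinear_pure_tensor \<iota> linear_map_id])
    have "\<delta>A W = pure_tensor U L (\<iota> L4.xy) \<one>\<^bsub>L\<^esub> \<oplus>\<^bsub>tensor U L\<^esub> pure_tensor U L (\<iota> L4.g') W"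
      using linear_map_add[OF L4.HL.tensor_lift_linear[OF UL.k_space_tensor B]]
      by (simp add: \<delta>A_def push_coaction_def L4.coaction_W L4.HL.tensor_lift_pure[OF UL.k_space_tensor B])
    moreover have "pure_tensor U L = pure_tensor U A" "add (tensor U L) = add (tensor U A)"
      using same_space_pure_tensor[OF same_space_refl same_space_twisted_algebra[of L \<sigma> \<delta>]]
        same_space_tensor[OF same_space_refl[of U] same_space_twisted_algebra[of L \<sigma> \<delta>]]
      by (simp_all only: A_def same_space_def)
    ultimately show ?thesis
      by (simp add: \<iota>xy inv A_def twisted_algebra_def)
  qed
qed

end
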